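(* Let $\mathcal{C}$ be a type-theoretic fibration category, $\widetilde U\to U$ a universe in $\mathcal{C}$, and $I$ an inverse category. If $I$ is admissible for the universe $\widetilde U\to U$, then the induced Reedy fibration $\widetilde V\to V$ is a universe in $(\mathcal{C}^I)_{\mathbf f}$ for the Reedy small-fibrations (i.e. it is a universe, and its small fibrations are the Reedy small-fibrations in $(\mathcal{C}^I)_{\mathbf f}$).
   Context: A type-theoretic fibration category is a category $\mathcal{C}$ with the following structure. (1) A terminal object $1$. (2) A subcategory $\mathcal{F}\subset\mathcal{C}$ containing all objects, all isomorphisms, and all morphisms with codomain $1$; morphisms of $\mathcal{F}$ are called fibrations, and a morphism is called an acyclic cofibration if it has the left lifting property with respect to all fibrations. (3) All pullbacks of fibrations (along arbitrary morphisms) exist and are fibrations. (4) For every fibration $g:A\to B$, the pullback functor $g^*:\mathcal{C}/B\to\mathcal{C}/A$ has a partial right adjoint $\Pi_g$, defined at all fibrations over $A$, whose values are fibrations over $B$. (5) Every morphism factors as an acyclic cofibration followed by a fibration. (6) If $A\to C$ and $B\to C$ are fibrations, $A\to B$ is an acyclic cofibration over $C$, and $Z\to C$ is any morphism, then the induced map $Z\times_C A\to Z\times_C B$ is an acyclic cofibration. A homotopy $f\sim g$ between $f,g:A\rightrightarrows B$ is a lift of $(f,g):A\to B\times B$ to a path object of $B$, i.e. to a factorization $B\to PB\to B\times B$ of the diagonal as an acyclic cofibration followed by a fibration. An equivalence (homotopy equivalence) is a morphism having an inverse up to homotopy. A fibration $p:\widetilde U\to U$ is a universe if, calling pullbacks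 of $p$ small fibrations: (i) small fibrations are closed under composition and contain the identities; (ii) if $f:B\to A$ and $g:A\to C$ are small fibrations, so is $\Pi_gf\to C$; (iii) if $A\to C$ and $B\to C$ are small fibrations, any morphism $A\to B$ over $C$ factors as an acyclic cofibration followed by a small fibration. An inverse category is a category $I$ such that the relation $y\prec x$, meaning that there is a nonidentity arrow $x\to y$, is well-founded on objects. For $x\in I$, $x/\!\!/I$ is the full subcategory of the co-slice category $x/I$ excluding only $\mathrm{id}_x$; it is again an inverse category. The matching object is $M_xA=\lim_{x/\!\!/I}A$, if it exists (it depends only on $A$ restricted to $\{y\mid y\prec x\}$). A Reedy fibration in $\mathcal{C}^I$ is a map $f:A\to B$ such that $A$ and $B$ have all matching objects, each pullback $M_xA\times_{M_xB}B_x$ exists, and each induced map $A_x\to M_xA\times_{M_xB}B_x$ is a fibration. A Reedy acyclic cofibration is a levelwise acyclic cofibration. $A$ is Reedy fibrant if it has all matching objects and each $A_x\to M_xA$ is a fibration; $(\mathcal{C}^I)_{\mathbf f}$ is the full subcategory of Reedy fibrant objects. For an inverse category $J$, $\mathcal{C}$ has Reedy $J$-limits if: every Reedy fibrant $A\in\mathcal{C}^J$ has a limit, which is fibrant; and for any morphism $f:A\to B$ of Reedy fibrant objects, $\lim f$ is a fibration if $f$ is a Reedy fibration, an equivalence if $f$ is a levelwise equivalence, and an acyclic cofibration if $f$ is a Reedy acyclic cofibration. $I$ is admissible for $\mathcal{C}$ if $\mathcal{C}$ has Reedy $(x/\!\!/I)$-limits for every $x\in I$; then $(\mathcal{C}^I)_{\mathbf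 f}$ with the Reedy fibrations is a type-theoretic fibration category. A morphism $f:A\to B$ in $(\mathcal{C}^I)_{\mathbf f}$ (and likewise for other inverse index categories, such as $x/\!\!/I$) is a Reedy small-fibration if each map $A_x\to M_xA\times_{M_xB}B_x$ is a small fibration in $\mathcal{C}$. $I$ is admissible for the universe $\widetilde U\to U$ if it is admissible for $\mathcal{C}$ and moreover Reedy $(x/\!\!/I)$-limits take Reedy small-fibrations to small fibrations in $\mathcal{C}$, for every $x\in I$. The induced Reedy fibration $\widetilde V\to V$ is defined by well-founded recursion: given it on $\{y\mid y\prec x\}$, with induced fibration $m:M_x\widetilde V\to M_xV$ of matching objects, let $V_x=\Pi_m(M_x\widetilde V\times U\to M_x\widetilde V)$, with its projection fibration $V_x\to M_xV$ (the local exponential $(M_xV\times U\to M_xV)^{(M_x\widetilde V\to M_xV)}$), and let $\widetilde V_x\to V_x\times_{M_xV}M_x\widetilde V$ be the pullback of $\widetilde U\to U$ along the evaluation map $V_x\times_{M_xV}M_x\widetilde V\to U$. *)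

theory Defs
  imports "HOL-Library.FuncSet"
begin

section \<open>Categories\<close>

record ('o, 'a) cat_data =
  Obj :: "'o set"
  Arr :: "'a set"
  Dom :: "'a \<Rightarrow> 'o"
  Cod :: "'a \<Rightarrow> 'o"
  Ident :: "'o \<Rightarrow> 'a"
  Comp :: "'a \<Rightarrow> 'a \<Rightarrow> 'a"  (infixl "\<cdot>\<index>" 70)

definition hom :: "('o, 'a) cat_data \<Rightarrow> 'o \<Rightarrow> 'o \<Rightarrow> 'a set" where
  "hom C a b = {f \<in> Arr C. Dom C f = a \<and> Cod C f = b}"

locale category =
  fixes C :: "('o, 'a) cat_data" (structure)
  assumes Dom_in_Obj: "f \<in> Arr C \<Longrightarrow> Dom C f \<in> Obj C"
    and Cod_in_Obj: "f \<in> Arr C \<Longrightarrow> Cod C f \<in> Obj C"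
    and Ident_in_hom: "a \<in> Obj C \<Longrightarrow> Ident C a \<in> hom C a a"
    and Comp_in_hom: "f \<in> hom C a b \<Longrightarrow> g \<in> hom C b c \<Longrightarrow> g \<cdot> f \<in> hom C a c"
    and Comp_Ident: "f \<in> hom C a b \<Longrightarrow> f \<cdot> Ident C a = f"
    and Ident_Comp: "f \<in> hom C a b \<Longrightarrow> Ident C b \<cdot> f = f"
    and Comp_assoc: "f \<in> hom C a b \<Longrightarrow> g \<in> hom C b c \<Longrightarrow> h \<in> hom C c d
      \<Longrightarrow> (h \<cdot> g) \<cdot> f = h \<cdot> (g \<cdot> f)"

definition full_subcategory :: "('o, 'a) cat_data \<Rightarrow> 'o set \<Rightarrow> ('o, 'a) cat_data" where
  "full_subcategory C S =
     C\<lparr>Obj := Obj C \<inter> S, Arr := {f \<in> Arr C. Dom C f \<in> S \<and> Cod C f \<in> S}\<rparr>"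

definition is_iso :: "('o, 'a) cat_data \<Rightarrow> 'a \<Rightarrow> bool" where
  "is_iso C f \<longleftrightarrow> f \<in> Arr C \<and>
     (\<exists>g \<in> hom C (Cod C f) (Dom C f).
        g \<cdot>\<^bsub>C\<^esub> f = Ident C (Dom C f) \<and> f \<cdot>\<^bsub>C\<^esub> g = Ident C (Cod C f))"

definition is_terminal :: "('o, 'a) cat_data \<Rightarrow> 'o \<Rightarrow> bool" where
  "is_terminal C t \<longleftrightarrow> t \<in> Obj C \<and> (\<forall>a \<in> Obj C. \<exists>!f. f \<in> hom C a t)"

definition is_product :: "('o, 'a) cat_data \<Rightarrow> 'o \<Rightarrow> 'o \<Rightarrow> 'a \<Rightarrow> 'a \<Rightarrow> bool" where
  "is_product C X Y p q \<longleftrightarrow>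
     Dom C p = Dom C q \<and> p \<in> hom C (Dom C p) X \<and> q \<in> hom C (Dom C p) Y \<and>
     (\<forall>Z. \<forall>f \<in> hom C Z X. \<forall>g \<in> hom C Z Y.
        \<exists>!u. u \<in> hom C Z (Dom C p) \<and> p \<cdot>\<^bsub>C\<^esub> u = f \<and> q \<cdot>\<^bsub>C\<^esub> u = g)"

text \<open>\<open>is_pullback C f g p q\<close>: the cospan \<open>f : X \<rightarrow> Z \<leftarrow> Y : g\<close> has pullback
  \<open>P\<close> with projections \<open>p : P \<rightarrow> X\<close> and \<open>q : P \<rightarrow> Y\<close>.\<close>

definition is_pullback :: "('o, 'a) cat_data \<Rightarrow> 'a \<Rightarrow> 'a \<Rightarrow> 'a \<Rightarrow> 'a \<Rightarrow> bool" where
  "is_pullback C f g p q \<longleftrightarrow>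
     f \<in> Arr C \<and> g \<in> Arr C \<and> Cod C f = Cod C g \<and> Dom C p = Dom C q \<and>
     p \<in> hom C (Dom C p) (Dom C f) \<and> q \<in> hom C (Dom C p) (Dom C g) \<and>
     f \<cdot>\<^bsub>C\<^esub> p = g \<cdot>\<^bsub>C\<^esub> q \<and>
     (\<forall>Z. \<forall>a \<in> hom C Z (Dom C f). \<forall>b \<in> hom C Z (Dom C g).
        f \<cdot>\<^bsub>C\<^esub> a = g \<cdot>\<^bsub>C\<^esub> b \<longrightarrow>
        (\<exists>!u. u \<in> hom C Z (Dom C p) \<and> p \<cdot>\<^bsub>C\<^esub> u = a \<and> q \<cdot>\<^bsub>C\<^esub> u = b))"

text \<open>The partial right adjoint of \<open>g\<^sup>*\<close> at a single object.  For \<open>g : A \<rightarrow> B\<close> and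
  \<open>f : X \<rightarrow> A\<close>, the object \<open>r : P \<rightarrow> B\<close> of \<open>C/B\<close> is \<open>\<Pi>\<^sub>g f\<close> with counit
  \<open>e : g\<^sup>*P \<rightarrow> X\<close> over \<open>A\<close>, where \<open>g\<^sup>*P\<close> is the pullback with projections \<open>q1\<close> (to \<open>P\<close>)
  and \<open>q2\<close> (to \<open>A\<close>): every map \<open>k : g\<^sup>*Y \<rightarrow> X\<close> over \<open>A\<close> is \<open>e \<cdot> g\<^sup>*u\<close> for a unique
  \<open>u : Y \<rightarrow> P\<close> over \<open>B\<close>.  The arrow \<open>v\<close> below is \<open>g\<^sup>*u\<close>.\<close>

definition is_pi ::
  "('o, 'a) cat_data \<Rightarrow> 'a \<Rightarrow> 'a \<Rightarrow> 'a \<Rightarrow> 'a \<Rightarrow> 'a \<Rightarrow> 'a \<Rightarrow> bool" where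
  "is_pi C g f r q1 q2 e \<longleftrightarrow>
     g \<in> Arr C \<and> f \<in> Arr C \<and> Cod C f = Dom C g \<and>
     is_pullback C r g q1 q2 \<and> e \<in> hom C (Dom C q1) (Dom C f) \<and> f \<cdot>\<^bsub>C\<^esub> e = q2 \<and>
     (\<forall>h s1 s2 k. is_pullback C h g s1 s2 \<and> k \<in> hom C (Dom C s1) (Dom C f) \<and>
          f \<cdot>\<^bsub>C\<^esub> k = s2 \<longrightarrow>
        (\<exists>!u. u \<in> hom C (Dom C h) (Dom C r) \<and> r \<cdot>\<^bsub>C\<^esub> u = h \<and>
           (\<exists>v \<in> hom C (Dom C s1) (Dom C q1).
              q1 \<cdot>\<^bsub>C\<^esub> v = u \<cdot>\<^bsub>C\<^esub> s1 \<and> q2 \<cdot>\<^bsub>C\<^esub> v = s2 \<and> e \<cdot>\<^bsub>C\<^esub> v = k)))"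

section \<open>Diagrams and limits\<close>

record ('i, 'j, 'o, 'a) diagram =
  OMap :: "'i \<Rightarrow> 'o"
  AMap :: "'j \<Rightarrow> 'a"

text \<open>Functors and natural transformations are extensional, so that equality of records is
  equality of functors and of transformations.\<close>

definition is_functor ::
  "('i, 'j) cat_data \<Rightarrow> ('o, 'a) cat_data \<Rightarrow> ('i, 'j, 'o, 'a) diagram \<Rightarrow> bool" where
  "is_functor J C A \<longleftrightarrow>
     OMap A \<in> Obj J \<rightarrow>\<^sub>E Obj C \<and> AMap A \<in> Arr J \<rightarrow>\<^sub>E Arr C \<and>
     (\<forall>f \<in> Arr J. AMap A f \<in> hom C (OMap A (Dom J f)) (OMap A (Cod J f))) \<and>
     (\<forall>x \<in> Obj J. AMap A (Ident J x) = Ident C (OMap A x)) \<and>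
     (\<forall>f \<in> Arr J. \<forall>g \<in> Arr J. Cod J f = Dom J g \<longrightarrow>
        AMap A (g \<cdot>\<^bsub>J\<^esub> f) = AMap A g \<cdot>\<^bsub>C\<^esub> AMap A f)"

record ('i, 'j, 'o, 'a) transf =
  Src :: "('i, 'j, 'o, 'a) diagram"
  Tgt :: "('i, 'j, 'o, 'a) diagram"
  At :: "'i \<Rightarrow> 'a"

definition is_natural ::
  "('i, 'j) cat_data \<Rightarrow> ('o, 'a) cat_data \<Rightarrow> ('i, 'j, 'o, 'a) transf \<Rightarrow> bool" where
  "is_natural J C t \<longleftrightarrow>
     is_functor J C (Src t) \<and> is_functor J C (Tgt t) \<and>
     At t \<in> Obj J \<rightarrow>\<^sub>E Arr C \<and>
     (\<forall>x \<in> Obj J. At t x \<in> hom C (OMap (Src t) x) (OMap (Tgt t) x)) \<and>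
     (\<forall>f \<in> Arr J. At t (Cod J f) \<cdot>\<^bsub>C\<^esub> AMap (Src t) f = AMap (Tgt t) f \<cdot>\<^bsub>C\<^esub> At t (Dom J f))"

definition functor_category ::
  "('i, 'j) cat_data \<Rightarrow> ('o, 'a) cat_data \<Rightarrow>
     (('i, 'j, 'o, 'a) diagram, ('i, 'j, 'o, 'a) transf) cat_data" where
  "functor_category J C =
     \<lparr>Obj = {A. is_functor J C A},
      Arr = {t. is_natural J C t},
      Dom = Src,
      Cod = Tgt,
      Ident = (\<lambda>A. \<lparr>Src = A, Tgt = A, At = (\<lambda>x \<in> Obj J. Ident C (OMap A x))\<rparr>),
      Comp = (\<lambda>s t. \<lparr>Src = Src t, Tgt = Tgt s, At = (\<lambda>x \<in> Obj J. At s x \<cdot>\<^bsub>C\<^esub> At t x)\<rparr>)\<rparr>"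

definition is_cone ::
  "('i, 'j) cat_data \<Rightarrow> ('o, 'a) cat_data \<Rightarrow> ('i, 'j, 'o, 'a) diagram \<Rightarrow> 'o \<Rightarrow> ('i \<Rightarrow> 'a) \<Rightarrow> bool"
  where
  "is_cone J C A L c \<longleftrightarrow> L \<in> Obj C \<and>
     (\<forall>x \<in> Obj J. c x \<in> hom C L (OMap A x)) \<and>
     (\<forall>f \<in> Arr J. AMap A f \<cdot>\<^bsub>C\<^esub> c (Dom J f) = c (Cod J f))"

definition is_limit ::
  "('i, 'j) cat_data \<Rightarrow> ('o, 'a) cat_data \<Rightarrow> ('i, 'j, 'o, 'a) diagram \<Rightarrow> 'o \<Rightarrow> ('i \<Rightarrow> 'a) \<Rightarrow> bool"
  where
  "is_limit J C A L c \<longleftrightarrow> is_cone J C A L c \<and>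
     (\<forall>K d. is_cone J C A K d \<longrightarrow>
        (\<exists>!u. u \<in> hom C K L \<and> (\<forall>x \<in> Obj J. c x \<cdot>\<^bsub>C\<^esub> u = d x)))"

text \<open>\<open>l = lim t\<close>, relative to chosen limits \<open>(L, c)\<close> of the source and \<open>(K, d)\<close> of the target
  of \<open>t\<close>.\<close>

definition is_lim_map ::
  "('i, 'j) cat_data \<Rightarrow> ('o, 'a) cat_data \<Rightarrow> ('i, 'j, 'o, 'a) transf \<Rightarrow>
     'o \<Rightarrow> ('i \<Rightarrow> 'a) \<Rightarrow> 'o \<Rightarrow> ('i \<Rightarrow> 'a) \<Rightarrow> 'a \<Rightarrow> bool" where
  "is_lim_map J C t L c K d l \<longleftrightarrow>
     is_limit J C (Src t) L c \<and> is_limit J C (Tgt t) K d \<and> l \<in> hom C L K \<and>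
     (\<forall>x \<in> Obj J. d x \<cdot>\<^bsub>C\<^esub> l = At t x \<cdot>\<^bsub>C\<^esub> c x)"

section \<open>Type-theoretic fibration categories\<close>

definition acyclic_cofibration :: "('o, 'a) cat_data \<Rightarrow> 'a set \<Rightarrow> 'a \<Rightarrow> bool" where
  "acyclic_cofibration C F i \<longleftrightarrow> i \<in> Arr C \<and>
     (\<forall>p \<in> F. \<forall>u \<in> hom C (Dom C i) (Dom C p). \<forall>v \<in> hom C (Cod C i) (Cod C p).
        p \<cdot>\<^bsub>C\<^esub> u = v \<cdot>\<^bsub>C\<^esub> i \<longrightarrow>
        (\<exists>h \<in> hom C (Cod C i) (Dom C p). h \<cdot>\<^bsub>C\<^esub> i = u \<and> p \<cdot>\<^bsub>C\<^esub> h = v))"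

locale tt_fibration_category = category C
  for C :: "('o, 'a) cat_data" (structure) +
  fixes F :: "'a set"
  assumes terminal_exists: "\<exists>t. is_terminal C t"
    and fib_arr: "F \<subseteq> Arr C"
    and fib_comp: "f \<in> F \<Longrightarrow> g \<in> F \<Longrightarrow> Cod C f = Dom C g \<Longrightarrow> g \<cdot> f \<in> F"
    and fib_iso: "is_iso C f \<Longrightarrow> f \<in> F"
    and fib_terminal: "f \<in> Arr C \<Longrightarrow> is_terminal C (Cod C f) \<Longrightarrow> f \<in> F"
    and fib_pullback_exists:
      "f \<in> F \<Longrightarrow> g \<in> Arr C \<Longrightarrow> Cod C f = Cod C g \<Longrightarrow> \<exists>p q. is_pullback C f g p q"
    and fib_pullback: "f \<in> F \<Longrightarrow> is_pullback C f g p q \<Longrightarrow> q \<in> F"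
    and pi_exists: "g \<in> F \<Longrightarrow> f \<in> F \<Longrightarrow> Cod C f = Dom C g
      \<Longrightarrow> \<exists>r q1 q2 e. is_pi C g f r q1 q2 e \<and> r \<in> F"
    and factorization: "f \<in> Arr C
      \<Longrightarrow> \<exists>i p. acyclic_cofibration C F i \<and> p \<in> F \<and> Cod C i = Dom C p \<and> p \<cdot> i = f"
    and acyclic_cofibration_pullback:
      "a \<in> F \<Longrightarrow> b \<in> F \<Longrightarrow> i \<in> hom C (Dom C a) (Dom C b) \<Longrightarrow> b \<cdot> i = a
        \<Longrightarrow> acyclic_cofibration C F i
        \<Longrightarrow> is_pullback C z a p1 p2 \<Longrightarrow> is_pullback C z b q1 q2
        \<Longrightarrow> k \<in> hom C (Dom C p1) (Dom C q1) \<Longrightarrow> q1 \<cdot> k = p1 \<Longrightarrow> q2 \<cdot> k = i \<cdot> p2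
        \<Longrightarrow> acyclic_cofibration C F k"

definition fibrant :: "('o, 'a) cat_data \<Rightarrow> 'a set \<Rightarrow> 'o \<Rightarrow> bool" where
  "fibrant C F X \<longleftrightarrow> (\<exists>t. is_terminal C t \<and> (\<exists>f \<in> hom C X t. f \<in> F))"

text \<open>\<open>B \<rightarrow> P \<rightarrow> B \<times> B\<close> given by \<open>r\<close> and \<open>d\<close> is a path object of \<open>B\<close>, where \<open>B \<times> B\<close> has
  projections \<open>p1\<close> and \<open>p2\<close>.\<close>

definition is_path_object ::
  "('o, 'a) cat_data \<Rightarrow> 'a set \<Rightarrow> 'o \<Rightarrow> 'a \<Rightarrow> 'a \<Rightarrow> 'a \<Rightarrow> 'a \<Rightarrow> bool" where
  "is_path_object C F B p1 p2 r d \<longleftrightarrow>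
     is_product C B B p1 p2 \<and> acyclic_cofibration C F r \<and> d \<in> F \<and>
     Dom C r = B \<and> Cod C r = Dom C d \<and> Cod C d = Dom C p1 \<and>
     p1 \<cdot>\<^bsub>C\<^esub> (d \<cdot>\<^bsub>C\<^esub> r) = Ident C B \<and> p2 \<cdot>\<^bsub>C\<^esub> (d \<cdot>\<^bsub>C\<^esub> r) = Ident C B"

definition homotopic :: "('o, 'a) cat_data \<Rightarrow> 'a set \<Rightarrow> 'a \<Rightarrow> 'a \<Rightarrow> bool" where
  "homotopic C F f g \<longleftrightarrow>
     f \<in> Arr C \<and> g \<in> hom C (Dom C f) (Cod C f) \<and>
     (\<exists>p1 p2 r d. is_path_object C F (Cod C f) p1 p2 r d \<and>
        (\<exists>h \<in> hom C (Dom C f) (Dom C d).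
           p1 \<cdot>\<^bsub>C\<^esub> (d \<cdot>\<^bsub>C\<^esub> h) = f \<and> p2 \<cdot>\<^bsub>C\<^esub> (d \<cdot>\<^bsub>C\<^esub> h) = g))"

definition is_equivalence :: "('o, 'a) cat_data \<Rightarrow> 'a set \<Rightarrow> 'a \<Rightarrow> bool" where
  "is_equivalence C F f \<longleftrightarrow> f \<in> Arr C \<and>
     (\<exists>g \<in> hom C (Cod C f) (Dom C f).
        homotopic C F (g \<cdot>\<^bsub>C\<^esub> f) (Ident C (Dom C f)) \<and>
        homotopic C F (f \<cdot>\<^bsub>C\<^esub> g) (Ident C (Cod C f)))"

definition small_fibrations :: "('o, 'a) cat_data \<Rightarrow> 'a \<Rightarrow> 'a set" where
  "small_fibrations C p = {s. \<exists>u v. is_pullback C p u v s}"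

definition universe :: "('o, 'a) cat_data \<Rightarrow> 'a set \<Rightarrow> 'a \<Rightarrow> bool" where
  "universe C F p \<longleftrightarrow> p \<in> F \<and>
     (\<forall>x \<in> Obj C. Ident C x \<in> small_fibrations C p) \<and>
     (\<forall>f \<in> small_fibrations C p. \<forall>g \<in> small_fibrations C p.
        Cod C f = Dom C g \<longrightarrow> g \<cdot>\<^bsub>C\<^esub> f \<in> small_fibrations C p) \<and>
     (\<forall>f \<in> small_fibrations C p. \<forall>g \<in> small_fibrations C p.
        Cod C f = Dom C g \<longrightarrow>
        (\<exists>r q1 q2 e. is_pi C g f r q1 q2 e \<and> r \<in> small_fibrations C p)) \<and>
     (\<forall>a \<in> small_fibrations C p. \<forall>b \<in> small_fibrations C p.
        \<forall>f \<in> hom C (Dom C a) (Dom C b). b \<cdot>\<^bsub>C\<^esub> f = a \<longrightarrow>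
        (\<exists>i s. acyclic_cofibration C F i \<and> s \<in> small_fibrations C p \<and>
           Cod C i = Dom C s \<and> s \<cdot>\<^bsub>C\<^esub> i = f))"

section \<open>Inverse categories and matching objects\<close>

definition inverse_category :: "('i, 'j) cat_data \<Rightarrow> bool" where
  "inverse_category I \<longleftrightarrow> category I \<and>
     wf {(y, x). x \<in> Obj I \<and> y \<in> Obj I \<and> (\<exists>f \<in> hom I x y. f \<noteq> Ident I x)}"

text \<open>An arrow \<open>(f, h, g)\<close> of the co-slice is \<open>h\<close> regarded as a map \<open>f \<rightarrow> g\<close> under \<open>x\<close>.\<close>

definition coslice :: "('i, 'j) cat_data \<Rightarrow> 'i \<Rightarrow> ('j, 'j \<times> 'j \<times> 'j) cat_data" where
  "coslice I x =
     \<lparr>Obj = {f \<in> Arr I. Dom I f = x},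
      Arr = {(f, h, g). f \<in> Arr I \<and> Dom I f = x \<and> g \<in> Arr I \<and> Dom I g = x \<and>
               h \<in> hom I (Cod I f) (Cod I g) \<and> h \<cdot>\<^bsub>I\<^esub> f = g},
      Dom = (\<lambda>(f, h, g). f),
      Cod = (\<lambda>(f, h, g). g),
      Ident = (\<lambda>f. (f, Ident I (Cod I f), f)),
      Comp = (\<lambda>(f', h', g') (f, h, g). (f, h' \<cdot>\<^bsub>I\<^esub> h, g'))\<rparr>"

definition strict_coslice :: "('i, 'j) cat_data \<Rightarrow> 'i \<Rightarrow> ('j, 'j \<times> 'j \<times> 'j) cat_data" where
  "strict_coslice I x = full_subcategory (coslice I x) (- {Ident I x})"

text \<open>Restriction of diagrams and transformations along the codomain functor
  \<open>strict_coslice I x \<rightarrow> I\<close>.\<close>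

definition under_diagram ::
  "('i, 'j) cat_data \<Rightarrow> 'i \<Rightarrow> ('i, 'j, 'o, 'a) diagram \<Rightarrow> ('j, 'j \<times> 'j \<times> 'j, 'o, 'a) diagram"
  where
  "under_diagram I x A =
     \<lparr>OMap = (\<lambda>f \<in> Obj (strict_coslice I x). OMap A (Cod I f)),
      AMap = (\<lambda>k \<in> Arr (strict_coslice I x). AMap A (fst (snd k)))\<rparr>"

definition under_transf ::
  "('i, 'j) cat_data \<Rightarrow> 'i \<Rightarrow> ('i, 'j, 'o, 'a) transf \<Rightarrow> ('j, 'j \<times> 'j \<times> 'j, 'o, 'a) transf"
  where
  "under_transf I x t =
     \<lparr>Src = under_diagram I x (Src t),
      Tgt = under_diagram I x (Tgt t),
      At = (\<lambda>f \<in> Obj (strict_coslice I x). At t (Cod I f))\<rparr>"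

definition is_matching_object ::
  "('i, 'j) cat_data \<Rightarrow> ('o, 'a) cat_data \<Rightarrow> ('i, 'j, 'o, 'a) diagram \<Rightarrow> 'i \<Rightarrow>
     'o \<Rightarrow> ('j \<Rightarrow> 'a) \<Rightarrow> bool" where
  "is_matching_object I C A x M c \<longleftrightarrow> is_limit (strict_coslice I x) C (under_diagram I x A) M c"

text \<open>\<open>k\<close> is the canonical map from \<open>A\<^sub>x\<close> to the matching object \<open>(M, c)\<close>.\<close>

definition is_matching_map ::
  "('i, 'j) cat_data \<Rightarrow> ('o, 'a) cat_data \<Rightarrow> ('i, 'j, 'o, 'a) diagram \<Rightarrow> 'i \<Rightarrow>
     'o \<Rightarrow> ('j \<Rightarrow> 'a) \<Rightarrow> 'a \<Rightarrow> bool" where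
  "is_matching_map I C A x M c k \<longleftrightarrow>
     is_matching_object I C A x M c \<and> k \<in> hom C (OMap A x) M \<and>
     (\<forall>f \<in> Obj (strict_coslice I x). c f \<cdot>\<^bsub>C\<^esub> k = AMap A f)"

text \<open>\<open>k\<close> is the induced map from \<open>A\<^sub>x\<close> to the pullback of \<open>M\<^sub>x A\<close> and \<open>B\<^sub>x\<close> over \<open>M\<^sub>x B\<close>,
  for \<open>t : A \<rightarrow> B\<close> and some choice of the matching objects and of the pullback.\<close>

definition is_relative_matching_map ::
  "('i, 'j) cat_data \<Rightarrow> ('o, 'a) cat_data \<Rightarrow> ('i, 'j, 'o, 'a) transf \<Rightarrow> 'i \<Rightarrow> 'a \<Rightarrow> bool" where
  "is_relative_matching_map I C t x k \<longleftrightarrow>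
     (\<exists>M c N d m kA kB p1 p2.
        is_lim_map (strict_coslice I x) C (under_transf I x t) M c N d m \<and>
        is_matching_map I C (Src t) x M c kA \<and>
        is_matching_map I C (Tgt t) x N d kB \<and>
        is_pullback C m kB p1 p2 \<and>
        k \<in> hom C (OMap (Src t) x) (Dom C p1) \<and>
        p1 \<cdot>\<^bsub>C\<^esub> k = kA \<and> p2 \<cdot>\<^bsub>C\<^esub> k = At t x)"

section \<open>Reedy fibrations\<close>

text \<open>Used only for classes \<open>K\<close> closed under composition with isomorphisms, for which the choice
  of matching objects and pullbacks is immaterial.\<close>

definition reedy_class ::
  "('i, 'j) cat_data \<Rightarrow> ('o, 'a) cat_data \<Rightarrow> 'a set \<Rightarrow> ('i, 'j, 'o, 'a) transf \<Rightarrow> bool" where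
  "reedy_class I C K t \<longleftrightarrow> is_natural I C t \<and>
     (\<forall>x \<in> Obj I. \<exists>k. is_relative_matching_map I C t x k \<and> k \<in> K)"

definition reedy_fibration ::
  "('i, 'j) cat_data \<Rightarrow> ('o, 'a) cat_data \<Rightarrow> 'a set \<Rightarrow> ('i, 'j, 'o, 'a) transf \<Rightarrow> bool" where
  "reedy_fibration I C F t \<longleftrightarrow> reedy_class I C F t"

definition reedy_acyclic_cofibration ::
  "('i, 'j) cat_data \<Rightarrow> ('o, 'a) cat_data \<Rightarrow> 'a set \<Rightarrow> ('i, 'j, 'o, 'a) transf \<Rightarrow> bool" where
  "reedy_acyclic_cofibration I C F t \<longleftrightarrow> is_natural I C t \<and>
     (\<forall>x \<in> Obj I. acyclic_cofibration C F (At t x))"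

definition levelwise_equivalence ::
  "('i, 'j) cat_data \<Rightarrow> ('o, 'a) cat_data \<Rightarrow> 'a set \<Rightarrow> ('i, 'j, 'o, 'a) transf \<Rightarrow> bool" where
  "levelwise_equivalence I C F t \<longleftrightarrow> is_natural I C t \<and>
     (\<forall>x \<in> Obj I. is_equivalence C F (At t x))"

definition reedy_fibrant ::
  "('i, 'j) cat_data \<Rightarrow> ('o, 'a) cat_data \<Rightarrow> 'a set \<Rightarrow> ('i, 'j, 'o, 'a) diagram \<Rightarrow> bool" where
  "reedy_fibrant I C F A \<longleftrightarrow> is_functor I C A \<and>
     (\<forall>x \<in> Obj I. \<exists>M c k. is_matching_map I C A x M c k \<and> k \<in> F)"

definition reedy_category ::
  "('i, 'j) cat_data \<Rightarrow> ('o, 'a) cat_data \<Rightarrow> 'a set \<Rightarrow>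
     (('i, 'j, 'o, 'a) diagram, ('i, 'j, 'o, 'a) transf) cat_data" where
  "reedy_category I C F = full_subcategory (functor_category I C) {A. reedy_fibrant I C F A}"

definition reedy_fibrations ::
  "('i, 'j) cat_data \<Rightarrow> ('o, 'a) cat_data \<Rightarrow> 'a set \<Rightarrow> ('i, 'j, 'o, 'a) transf set" where
  "reedy_fibrations I C F = {t \<in> Arr (reedy_category I C F). reedy_fibration I C F t}"

definition reedy_small_fibrations ::
  "('i, 'j) cat_data \<Rightarrow> ('o, 'a) cat_data \<Rightarrow> 'a set \<Rightarrow> 'a \<Rightarrow> ('i, 'j, 'o, 'a) transf set" where
  "reedy_small_fibrations I C F p =
     {t \<in> Arr (reedy_category I C F). reedy_class I C (small_fibrations C p) t}"

section \<open>Admissibility\<close>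

definition has_reedy_limits ::
  "('i, 'j) cat_data \<Rightarrow> ('o, 'a) cat_data \<Rightarrow> 'a set \<Rightarrow> bool" where
  "has_reedy_limits J C F \<longleftrightarrow>
     (\<forall>A. reedy_fibrant J C F A \<longrightarrow> (\<exists>L c. is_limit J C A L c \<and> fibrant C F L)) \<and>
     (\<forall>t L c K d l. t \<in> Arr (reedy_category J C F) \<and> is_lim_map J C t L c K d l \<longrightarrow>
        (reedy_fibration J C F t \<longrightarrow> l \<in> F) \<and>
        (levelwise_equivalence J C F t \<longrightarrow> is_equivalence C F l) \<and>
        (reedy_acyclic_cofibration J C F t \<longrightarrow> acyclic_cofibration C F l))"

definition admissible ::
  "('i, 'j) cat_data \<Rightarrow> ('o, 'a) cat_data \<Rightarrow> 'a set \<Rightarrow> bool" where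
  "admissible I C F \<longleftrightarrow> (\<forall>x \<in> Obj I. has_reedy_limits (strict_coslice I x) C F)"

definition admissible_for_universe ::
  "('i, 'j) cat_data \<Rightarrow> ('o, 'a) cat_data \<Rightarrow> 'a set \<Rightarrow> 'a \<Rightarrow> bool" where
  "admissible_for_universe I C F p \<longleftrightarrow> admissible I C F \<and>
     (\<forall>x \<in> Obj I. \<forall>t \<in> reedy_small_fibrations (strict_coslice I x) C F p. \<forall>L c K d l.
        is_lim_map (strict_coslice I x) C t L c K d l \<longrightarrow> l \<in> small_fibrations C p)"

section \<open>The induced universe\<close>

text \<open>The recursive construction determines \<open>q : V\<^sup>~ \<rightarrow> V\<close> only up to the choice of limits,
  pullbacks, products and \<open>\<Pi>\<close>; \<open>induced_fibration I C p q\<close> says that \<open>q\<close> arises from some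
  such choices.  At each \<open>x\<close>:
  \<open>m : M' \<rightarrow> M\<close> is the map of matching objects of \<open>V\<^sup>~\<close> and \<open>V\<close>;
  \<open>w1\<close>, \<open>w2\<close> are the projections of \<open>M' \<times> U\<close>;
  \<open>r : V\<^sub>x \<rightarrow> M\<close> is \<open>\<Pi>\<^sub>m w1\<close>, with counit \<open>e : Q \<rightarrow> M' \<times> U\<close>, where \<open>Q\<close> is the pullback of
  \<open>V\<^sub>x\<close> and \<open>M'\<close> over \<open>M\<close>, with projections \<open>q1\<close>, \<open>q2\<close>;
  the evaluation map is \<open>w2 \<cdot> e : Q \<rightarrow> U\<close>;
  and \<open>k : V\<^sup>~\<^sub>x \<rightarrow> Q\<close> is the pullback of \<open>p\<close> along it.
  That \<open>r\<close> and \<open>q2 \<cdot> k\<close> are the matching maps and \<open>q1 \<cdot> k = q\<^sub>x\<close> expresses that the values at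
  \<open>x\<close> extend the diagrams and the transformation already given on the objects below \<open>x\<close>.\<close>

definition induced_fibration ::
  "('i, 'j) cat_data \<Rightarrow> ('o, 'a) cat_data \<Rightarrow> 'a \<Rightarrow> ('i, 'j, 'o, 'a) transf \<Rightarrow> bool" where
  "induced_fibration I C p q \<longleftrightarrow> is_natural I C q \<and>
     (\<forall>x \<in> Obj I. \<exists>M' c' M c m w1 w2 r q1 q2 e k v.
        is_lim_map (strict_coslice I x) C (under_transf I x q) M' c' M c m \<and>
        is_product C M' (Cod C p) w1 w2 \<and>
        is_pi C m w1 r q1 q2 e \<and>
        is_matching_map I C (Tgt q) x M c r \<and>
        is_pullback C p (w2 \<cdot>\<^bsub>C\<^esub> e) v k \<and>
        q1 \<cdot>\<^bsub>C\<^esub> k = At q x \<and>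
        is_matching_map I C (Src q) x M' c' (q2 \<cdot>\<^bsub>C\<^esub> k))"

end

theory Submission
  imports Defs
begin

text \<open>
  Every construction proceeds one object at a time, along the well-founded relation \<open>y \<prec> x\<close>.  Given a construction
  on the objects below \<open>x\<close>, extending a diagram \<open>E\<close> to \<open>x\<close> amounts to choosing a map
  \<open>E\<^sub>x \<rightarrow> M\<^sub>x E\<close>, and extending a Reedy small fibration \<open>E \<rightarrow> B\<close> amounts to choosing a small fibration
  onto the gap object \<open>M\<^sub>x E \<times>\<^bsub>M\<^sub>x B\<^esub> B\<^sub>x\<close>, where
  \<open>M\<^sub>x E \<rightarrow> M\<^sub>x B\<close> is small by admissibility.

  A map from \<open>B\<^sub>x\<close> to \<open>V\<^sub>x\<close> over \<open>M\<^sub>x V\<close> is a map from the pullback of \<open>M\<^sub>x V\<^sup>~\<close> to \<open>U\<close>.  If \<open>A \<rightarrow> B\<close> is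
  already a pullback of \<open>V\<^sup>~ \<rightarrow> V\<close> below \<open>x\<close>, that pullback is the gap object of \<open>A \<rightarrow> B\<close>, so a
  classifying map of the gap map of \<open>A \<rightarrow> B\<close> in \<open>U\<close> is the same thing as an extension of the
  classifying square to \<open>x\<close>.  Factorizations arise from factoring the gap maps, levelwise acyclic
  cofibrations lift against Reedy fibrations by lifting against the gap maps, and \<open>\<Pi>\<^sub>g f\<close> is obtained
  at \<open>x\<close> as the dependent product, along the pullback of \<open>g\<^sub>x\<close> to the gap object, of a pullback of the gap
  map of \<open>f\<close>.
\<close>

section \<open>Pullbacks and dependent products\<close>

text \<open>Limits, pullbacks and dependent products are given as relations, so every construction
  is determined only up to isomorphism. Whether a matching map is a fibration, or a gap map small,
  is independent of the choices made, because both classes contain the isomorphisms and are closed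
  under composition. The recursions carry a total function of raw data on all objects, of which the
  predicate at \<open>x\<close> constrains only the values at \<open>x\<close> and below; each such
  predicate therefore comes with a congruence rule saying that it ignores all other values. The
  dependent product is the delicate case. Its universal property in the diagram category is not a
  family of independent universal properties in \<open>C\<close>, since a map into it at
  \<open>x\<close> has to restrict to the maps already chosen below \<open>x\<close>. For this
  reason a universal property relative to a compatible family below \<open>x\<close> is proved at
  each stage and kept together with the values of the construction.\<close>

context category
begin

section \<open>Composition in a form suited to rewriting\<close>

lemma in_hom: "f \<in> hom C a b \<longleftrightarrow> f \<in> Arr C \<and> Dom C f = a \<and> Cod C f = b"
  by (simp add: hom_def)

lemma comp_arr [simp]: "\<lbrakk>f \<in> Arr C; g \<in> Arr C; Cod C f = Dom C g\<rbrakk> \<Longrightarrow> g \<cdot> f \<in> Arr C"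
  and dom_comp [simp]: "\<lbrakk>f \<in> Arr C; g \<in> Arr C; Cod C f = Dom C g\<rbrakk> \<Longrightarrow> Dom C (g \<cdot> f) = Dom C f"
  and cod_comp [simp]: "\<lbrakk>f \<in> Arr C; g \<in> Arr C; Cod C f = Dom C g\<rbrakk> \<Longrightarrow> Cod C (g \<cdot> f) = Cod C g"
  using Comp_in_hom[of f "Dom C f" "Cod C f" g "Cod C g"] by (simp_all add: in_hom)

lemma assoc [simp]:
  "\<lbrakk>f \<in> Arr C; g \<in> Arr C; h \<in> Arr C; Cod C f = Dom C g; Cod C g = Dom C h\<rbrakk>
    \<Longrightarrow> (h \<cdot> g) \<cdot> f = h \<cdot> (g \<cdot> f)"
  using Comp_assoc[of f "Dom C f" "Cod C f" g "Cod C g" h "Cod C h"] by (simp add: in_hom)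

text \<open>\<open>assoc\<close> normalizes composites to the right, so an equation for
  \<open>g \<cdot> f\<close> stops matching inside a longer composite. Passing it through
  \<open>THEN reassoc\<close> restates it with a further arrow \<open>z\<close> on the
  right.\<close>

lemma reassoc:
  "\<lbrakk>g \<cdot> f = r; f \<in> Arr C; g \<in> Arr C; Cod C f = Dom C g; z \<in> Arr C; Cod C z = Dom C f\<rbrakk>
    \<Longrightarrow> g \<cdot> (f \<cdot> z) = r \<cdot> z"
  by (metis assoc)

lemma ident_arr [simp]: "a \<in> Obj C \<Longrightarrow> Ident C a \<in> Arr C"
  and ident_dom [simp]: "a \<in> Obj C \<Longrightarrow> Dom C (Ident C a) = a"
  and ident_cod [simp]: "a \<in> Obj C \<Longrightarrow> Cod C (Ident C a) = a"
  using Ident_in_hom[of a] by (simp_all add: in_hom)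

lemma comp_ident [simp]: "\<lbrakk>f \<in> Arr C; Dom C f = a\<rbrakk> \<Longrightarrow> f \<cdot> Ident C a = f"
  using Comp_Ident[of f a "Cod C f"] by (simp add: in_hom)

lemma ident_comp [simp]: "\<lbrakk>f \<in> Arr C; Cod C f = a\<rbrakk> \<Longrightarrow> Ident C a \<cdot> f = f"
  using Ident_Comp[of f "Dom C f" a] by (simp add: in_hom)

lemma dom_obj [simp]: "f \<in> Arr C \<Longrightarrow> Dom C f \<in> Obj C"
  and cod_obj [simp]: "f \<in> Arr C \<Longrightarrow> Cod C f \<in> Obj C"
  by (simp_all add: Dom_in_Obj Cod_in_Obj)

section \<open>Pullback squares and the pasting laws\<close>

lemma pullbackD:
  assumes "is_pullback C f g p q"
  shows "f \<in> Arr C" "g \<in> Arr C" "p \<in> Arr C" "q \<in> Arr C" "Cod C g = Cod C f"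
    "Dom C q = Dom C p" "Cod C p = Dom C f" "Cod C q = Dom C g" "f \<cdot> p = g \<cdot> q"
  using assms unfolding is_pullback_def in_hom by metis+

lemma pullback_univ:
  assumes "is_pullback C f g p q" "a \<in> hom C Z (Dom C f)" "b \<in> hom C Z (Dom C g)" "f \<cdot> a = g \<cdot> b"
  shows "\<exists>!u. u \<in> hom C Z (Dom C p) \<and> p \<cdot> u = a \<and> q \<cdot> u = b"
  using assms unfolding is_pullback_def by blast

lemma pullback_ex:
  assumes "is_pullback C f g p q" "a \<in> Arr C" "b \<in> Arr C" "Dom C a = Z" "Dom C b = Z"
    "Cod C a = Dom C f" "Cod C b = Dom C g" "f \<cdot> a = g \<cdot> b"
  obtains u where "u \<in> Arr C" "Dom C u = Z" "Cod C u = Dom C p" "p \<cdot> u = a" "q \<cdot> u = b"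
proof -
  have "\<exists>!u. u \<in> hom C Z (Dom C p) \<and> p \<cdot> u = a \<and> q \<cdot> u = b"
    by (rule pullback_univ[OF assms(1)]) (use assms in \<open>simp_all add: in_hom\<close>)
  then show thesis using that unfolding in_hom by blast
qed

lemma pullback_eq:
  assumes "is_pullback C f g p q" "u \<in> Arr C" "v \<in> Arr C" "Dom C u = Z" "Dom C v = Z"
    "Cod C u = Dom C p" "Cod C v = Dom C p" "p \<cdot> u = p \<cdot> v" "q \<cdot> u = q \<cdot> v"
  shows "u = v"
proof -
  note P = pullbackD[OF assms(1)]
  have "f \<cdot> (p \<cdot> v) = g \<cdot> (q \<cdot> v)"
    using P assms(2-7) by (simp add: P(9)[THEN reassoc])
  moreover have "p \<cdot> v \<in> hom C Z (Dom C f)" "q \<cdot> v \<in> hom C Z (Dom C g)"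
    using P assms(2-7) by (simp_all add: in_hom)
  ultimately have "\<exists>!w. w \<in> hom C Z (Dom C p) \<and> p \<cdot> w = p \<cdot> v \<and> q \<cdot> w = q \<cdot> v"
    by (intro pullback_univ[OF assms(1)])
  then show ?thesis using assms(2-9) unfolding in_hom by metis
qed

lemma pullbackI:
  assumes "f \<in> Arr C" "g \<in> Arr C" "p \<in> Arr C" "q \<in> Arr C" "Cod C g = Cod C f"
    "Dom C q = Dom C p" "Cod C p = Dom C f" "Cod C q = Dom C g" "f \<cdot> p = g \<cdot> q"
    and ex: "\<And>Z a b. \<lbrakk>a \<in> Arr C; b \<in> Arr C; Dom C a = Z; Dom C b = Z; Cod C a = Dom C f; Cod C b = Dom C g;
      f \<cdot> a = g \<cdot> b\<rbrakk> \<Longrightarrow>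
      \<exists>u. u \<in> Arr C \<and> Dom C u = Z \<and> Cod C u = Dom C p \<and> p \<cdot> u = a \<and> q \<cdot> u = b"
    and eq: "\<And>Z u v. \<lbrakk>u \<in> Arr C; v \<in> Arr C; Dom C u = Z; Dom C v = Z; Cod C u = Dom C p; Cod C v = Dom C p;
      p \<cdot> u = p \<cdot> v; q \<cdot> u = q \<cdot> v\<rbrakk> \<Longrightarrow> u = v"
  shows "is_pullback C f g p q"
  unfolding is_pullback_def in_hom
proof (intro conjI allI impI ballI)
  fix Z a b
  assume a: "a \<in> hom C Z (Dom C f)" and b: "b \<in> hom C Z (Dom C g)" and e: "f \<cdot> a = g \<cdot> b"
  then obtain u where "u \<in> Arr C" "Dom C u = Z" "Cod C u = Dom C p" "p \<cdot> u = a" "q \<cdot> u = b"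
    using ex[of a b] unfolding in_hom by blast
  then show "\<exists>!u. (u \<in> Arr C \<and> Dom C u = Z \<and> Cod C u = Dom C p) \<and> p \<cdot> u = a \<and> q \<cdot> u = b"
    by (intro ex1I[of _ u]) (blast, elim conjE, rule eq, simp_all)
qed (use assms(1-9) in \<open>simp_all (no_asm_simp)\<close>)

lemma pullback_swap:
  assumes "is_pullback C f g p q"
  shows "is_pullback C g f q p"
proof (rule pullbackI)
  note P = pullbackD[OF assms]
  fix Z a b
  assume *: "a \<in> Arr C" "b \<in> Arr C" "Dom C a = Z" "Dom C b = Z" "Cod C a = Dom C g" "Cod C b = Dom C f"
    "g \<cdot> a = f \<cdot> b"
  obtain u where "u \<in> Arr C" "Dom C u = Z" "Cod C u = Dom C p" "p \<cdot> u = b" "q \<cdot> u = a"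
    by (rule pullback_ex[OF assms, of b a]) (use * in simp_all)
  then show "\<exists>u. u \<in> Arr C \<and> Dom C u = Z \<and> Cod C u = Dom C q \<and> q \<cdot> u = a \<and> p \<cdot> u = b"
    using * P by auto
next
  fix Z u v
  assume "u \<in> Arr C" "v \<in> Arr C" "Dom C u = Z" "Dom C v = Z" "Cod C u = Dom C q" "Cod C v = Dom C q"
    "q \<cdot> u = q \<cdot> v" "p \<cdot> u = p \<cdot> v"
  then show "u = v" using pullbackD[OF assms] by - (rule pullback_eq[OF assms], simp_all)
qed (use pullbackD[OF assms] in simp_all)

lemma pullback_paste:
  assumes 1: "is_pullback C f g p q" and 2: "is_pullback C q g' p' q'"
  shows "is_pullback C f (g \<cdot> g') (p \<cdot> p') q'"
proof (rule pullbackI)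
  note P = pullbackD[OF 1] and Q = pullbackD[OF 2]
  show "f \<cdot> (p \<cdot> p') = g \<cdot> g' \<cdot> q'"
    using P Q by (simp add: P(9)[THEN reassoc])
  fix Z a b
  assume *: "a \<in> Arr C" "b \<in> Arr C" "Dom C a = Z" "Dom C b = Z" "Cod C a = Dom C f"
    "Cod C b = Dom C (g \<cdot> g')" "f \<cdot> a = g \<cdot> g' \<cdot> b"
  obtain u where u: "u \<in> Arr C" "Dom C u = Z" "Cod C u = Dom C p" "p \<cdot> u = a" "q \<cdot> u = g' \<cdot> b"
    by (rule pullback_ex[OF 1, of a "g' \<cdot> b"]) (use P Q * in simp_all)
  obtain v where v: "v \<in> Arr C" "Dom C v = Z" "Cod C v = Dom C p'" "p' \<cdot> v = u" "q' \<cdot> v = b"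
    by (rule pullback_ex[OF 2, of u b]) (use P Q * u in simp_all)
  then show "\<exists>u. u \<in> Arr C \<and> Dom C u = Z \<and> Cod C u = Dom C (p \<cdot> p') \<and> p \<cdot> p' \<cdot> u = a \<and> q' \<cdot> u = b"
    using P Q * u by (intro exI[of _ v]) simp
next
  note P = pullbackD[OF 1] and Q = pullbackD[OF 2]
  fix Z u v assume *: "u \<in> Arr C" "v \<in> Arr C" "Dom C u = Z" "Dom C v = Z" "Cod C u = Dom C (p \<cdot> p')"
    "Cod C v = Dom C (p \<cdot> p')" "p \<cdot> p' \<cdot> u = p \<cdot> p' \<cdot> v" "q' \<cdot> u = q' \<cdot> v"
  have "p' \<cdot> u = p' \<cdot> v"
  proof (rule pullback_eq[OF 1])
    show "q \<cdot> (p' \<cdot> u) = q \<cdot> (p' \<cdot> v)"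
      using P Q * by (simp add: Q(9)[THEN reassoc])
  qed (use P Q * in simp_all)
  then show "u = v"
    using P Q * by - (rule pullback_eq[OF 2, of u v], simp_all)
qed (use pullbackD[OF 1] pullbackD[OF 2] in simp_all)

text \<open>Cancellation: the outer rectangle supplies the mediating map, and the first square shows
  that its composite with \<open>p'\<close> is the prescribed one. Squares between gap objects are
  recognized as pullbacks in this way.\<close>

lemma pullback_unpaste:
  assumes 1: "is_pullback C f g p q" and 2: "is_pullback C f (g \<cdot> g') (p \<cdot> p') q'"
    and p': "p' \<in> Arr C" "Dom C p' = Dom C q'" "Cod C p' = Dom C p"
    and g': "g' \<in> Arr C" "Cod C g' = Dom C g" and e: "q \<cdot> p' = g' \<cdot> q'"
  shows "is_pullback C q g' p' q'"
proof (rule pullbackI)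
  note P = pullbackD[OF 1] and Q = pullbackD[OF 2]
  have d: "q' \<in> Arr C" "Cod C q' = Dom C g'" using Q P p' g' by simp_all
  fix Z a b
  assume *: "a \<in> Arr C" "b \<in> Arr C" "Dom C a = Z" "Dom C b = Z" "Cod C a = Dom C q"
    "Cod C b = Dom C g'" "q \<cdot> a = g' \<cdot> b"
  obtain u where u: "u \<in> Arr C" "Dom C u = Z" "Cod C u = Dom C (p \<cdot> p')"
      "p \<cdot> p' \<cdot> u = p \<cdot> a" "q' \<cdot> u = b"
    by (rule pullback_ex[OF 2, of "p \<cdot> a" b]) (use P p' g' * in \<open>simp_all add: P(9)[THEN reassoc]\<close>)
  have "p' \<cdot> u = a"
    by (rule pullback_eq[OF 1]) (use P p' g' u * d in \<open>simp_all add: e[THEN reassoc]\<close>)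
  then show "\<exists>u. u \<in> Arr C \<and> Dom C u = Z \<and> Cod C u = Dom C p' \<and> p' \<cdot> u = a \<and> q' \<cdot> u = b"
    using u * P p' g' by auto
next
  note P = pullbackD[OF 1] and Q = pullbackD[OF 2]
  fix Z u v assume *: "u \<in> Arr C" "v \<in> Arr C" "Dom C u = Z" "Dom C v = Z" "Cod C u = Dom C p'"
    "Cod C v = Dom C p'" "p' \<cdot> u = p' \<cdot> v" "q' \<cdot> u = q' \<cdot> v"
  then show "u = v"
    using P p' g' * by - (rule pullback_eq[OF 2, of u v], simp_all)
qed (use pullbackD[OF 1] pullbackD[OF 2] p' g' e in simp_all)

lemma pullback_ident:
  assumes "f \<in> Arr C"
  shows "is_pullback C (Ident C (Cod C f)) f f (Ident C (Dom C f))"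
proof (rule pullbackI)
  fix Z a b
  assume "a \<in> Arr C" "b \<in> Arr C" "Dom C a = Z" "Dom C b = Z" "Cod C a = Dom C (Ident C (Cod C f))" "Cod C b = Dom C f"
    "Ident C (Cod C f) \<cdot> a = f \<cdot> b"
  then show "\<exists>u. u \<in> Arr C \<and> Dom C u = Z \<and> Cod C u = Dom C f \<and> f \<cdot> u = a \<and>
      Ident C (Dom C f) \<cdot> u = b"
    using assms by (intro exI[of _ b]) simp
qed (use assms in simp_all)

lemma is_isoI:
  assumes "f \<in> Arr C" "g \<in> Arr C" "Dom C g = Cod C f" "Cod C g = Dom C f"
    "g \<cdot> f = Ident C (Dom C f)" "f \<cdot> g = Ident C (Cod C f)"
  shows "is_iso C f"
  unfolding is_iso_def by (intro conjI bexI[of _ g]) (use assms in \<open>simp_all add: in_hom\<close>)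

lemma is_isoE:
  assumes "is_iso C f"
  obtains g where "f \<in> Arr C" "g \<in> Arr C" "Dom C g = Cod C f" "Cod C g = Dom C f"
    "g \<cdot> f = Ident C (Dom C f)" "f \<cdot> g = Ident C (Cod C f)"
proof -
  obtain g where "f \<in> Arr C" "g \<in> hom C (Cod C f) (Dom C f)"
    "g \<cdot> f = Ident C (Dom C f)" "f \<cdot> g = Ident C (Cod C f)"
    using assms unfolding is_iso_def by blast
  then show thesis by (intro that[of g]) (simp_all add: in_hom)
qed

text \<open>Exhibits an isomorphism as a pullback of an identity. Small fibrations contain the
  identities and are stable under pullback, so they contain every isomorphism.\<close>

lemma pullback_iso:
  assumes "is_iso C f"
  shows "is_pullback C (Ident C (Cod C f)) (Ident C (Cod C f)) f f"
proof -
  obtain g where g: "f \<in> Arr C" "g \<in> Arr C" "Dom C g = Cod C f" "Cod C g = Dom C f"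
    "g \<cdot> f = Ident C (Dom C f)" "f \<cdot> g = Ident C (Cod C f)" using assms by (rule is_isoE)
  show ?thesis
  proof (rule pullbackI)
    fix Z a b assume "a \<in> Arr C" "b \<in> Arr C" "Dom C a = Z" "Dom C b = Z" "Cod C a = Dom C (Ident C (Cod C f))"
      "Ident C (Cod C f) \<cdot> a = Ident C (Cod C f) \<cdot> b" "Cod C b = Dom C (Ident C (Cod C f))"
    then show "\<exists>u. u \<in> Arr C \<and> Dom C u = Z \<and> Cod C u = Dom C f \<and> f \<cdot> u = a \<and> f \<cdot> u = b"
      using g by (intro exI[of _ "g \<cdot> a"]) (simp add: g(6)[THEN reassoc])
  next
    fix Z u v assume "u \<in> Arr C" "v \<in> Arr C" "Dom C u = Z" "Dom C v = Z" "Cod C u = Dom C f" "Cod C v = Dom C f"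
        "f \<cdot> u = f \<cdot> v"
    then show "u = v"
      using g by (metis reassoc ident_comp)
  qed (use g in simp_all)
qed

text \<open>Any two maps to a terminal object with the same domain agree, so the commutativity
  condition of the pullback is automatic. The fibration axioms speak only of pullbacks; products and
  their projections are reached through this equivalence.\<close>

lemma product_iff_pullback:
  assumes t: "is_terminal C t"
    and f: "f \<in> Arr C" "Cod C f = t" and g: "g \<in> Arr C" "Cod C g = t"
  shows "is_product C (Dom C f) (Dom C g) p q \<longleftrightarrow> is_pullback C f g p q"
proof -
  have u: "a = b" if "a \<in> Arr C" "b \<in> Arr C" "Dom C a = Dom C b" "Cod C a = t" "Cod C b = t" for a b
  proof -
    have "\<exists>!h. h \<in> hom C (Dom C b) t" using t that by (simp add: is_terminal_def)
    moreover have "a \<in> hom C (Dom C b) t" "b \<in> hom C (Dom C b) t" using that by (simp_all add: in_hom)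
    ultimately show ?thesis by blast
  qed
  have *: "f \<cdot> a = g \<cdot> b" if "a \<in> hom C Z (Dom C f)" "b \<in> hom C Z (Dom C g)" for Z a b
    using that f g by - (rule u, simp_all add: in_hom)
  show ?thesis
  proof
    assume "is_product C (Dom C f) (Dom C g) p q"
    then show "is_pullback C f g p q"
      unfolding is_product_def is_pullback_def using f g
      by (elim conjE, intro conjI) (assumption | simp | (rule *, assumption+) | blast)+
  next
    assume "is_pullback C f g p q"
    then show "is_product C (Dom C f) (Dom C g) p q"
      unfolding is_product_def is_pullback_def using *
      by (elim conjE, intro conjI) (assumption | blast)+
  qed
qed

section \<open>Dependent products, and transport of pullbacks along isomorphisms\<close>

lemma is_piD:
  assumes "is_pi C g f r q1 q2 e"
  shows "g \<in> Arr C" "f \<in> Arr C" "Cod C f = Dom C g" "is_pullback C r g q1 q2" "e \<in> Arr C"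
    "Dom C e = Dom C q1" "Cod C e = Dom C f" "f \<cdot> e = q2"
  using assms by (simp_all add: is_pi_def in_hom)

lemma is_pi_univ:
  assumes "is_pi C g f r q1 q2 e" "is_pullback C h g s1 s2" "k \<in> hom C (Dom C s1) (Dom C f)"
    "f \<cdot> k = s2"
  shows "\<exists>!u. u \<in> hom C (Dom C h) (Dom C r) \<and> r \<cdot> u = h \<and>
           (\<exists>v \<in> hom C (Dom C s1) (Dom C q1). q1 \<cdot> v = u \<cdot> s1 \<and> q2 \<cdot> v = s2 \<and> e \<cdot> v = k)"
  using assms unfolding is_pi_def by (elim conjE allE impE) (intro conjI, assumption+)

lemma is_pi_ex:
  assumes "is_pi C g f r q1 q2 e" "is_pullback C h g s1 s2" "k \<in> Arr C" "Dom C k = Dom C s1"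
    "Cod C k = Dom C f" "f \<cdot> k = s2"
  obtains u v where "u \<in> Arr C" "Dom C u = Dom C h" "Cod C u = Dom C r" "r \<cdot> u = h"
    "v \<in> Arr C" "Dom C v = Dom C s1" "Cod C v = Dom C q1" "q1 \<cdot> v = u \<cdot> s1" "q2 \<cdot> v = s2" "e \<cdot> v = k"
proof -
  have "k \<in> hom C (Dom C s1) (Dom C f)" using assms by (simp add: in_hom)
  then obtain u v where "u \<in> hom C (Dom C h) (Dom C r)" "r \<cdot> u = h" "v \<in> hom C (Dom C s1) (Dom C q1)"
      "q1 \<cdot> v = u \<cdot> s1" "q2 \<cdot> v = s2" "e \<cdot> v = k"
    using is_pi_univ[OF assms(1,2) _ assms(6)] by blast
  then show thesis by (intro that[of u v]) (simp_all add: in_hom)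
qed

text \<open>Uniqueness phrased through transposes: \<open>v\<close> and \<open>v'\<close> are the
  pullbacks of \<open>u\<close> and \<open>u'\<close>, and the common value
  \<open>e \<cdot> v = e \<cdot> v'\<close> takes the place of \<open>k\<close>.\<close>

lemma is_pi_eq:
  assumes "is_pi C g f r q1 q2 e" "is_pullback C h g s1 s2"
    and "u \<in> Arr C" "Dom C u = Dom C h" "Cod C u = Dom C r" "r \<cdot> u = h"
    and "v \<in> Arr C" "Dom C v = Dom C s1" "Cod C v = Dom C q1" "q1 \<cdot> v = u \<cdot> s1" "q2 \<cdot> v = s2"
    and "u' \<in> Arr C" "Dom C u' = Dom C h" "Cod C u' = Dom C r" "r \<cdot> u' = h"
    and "v' \<in> Arr C" "Dom C v' = Dom C s1" "Cod C v' = Dom C q1" "q1 \<cdot> v' = u' \<cdot> s1" "q2 \<cdot> v' = s2"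
    and "e \<cdot> v = e \<cdot> v'"
  shows "u = u'"
proof -
  note P = is_piD[OF assms(1)]
  note Q = pullbackD[OF P(4)]
  let ?P = "\<lambda>u. u \<in> hom C (Dom C h) (Dom C r) \<and> r \<cdot> u = h \<and>
           (\<exists>v \<in> hom C (Dom C s1) (Dom C q1). q1 \<cdot> v = u \<cdot> s1 \<and> q2 \<cdot> v = s2 \<and> e \<cdot> v = e \<cdot> v')"
  have "e \<cdot> v' \<in> hom C (Dom C s1) (Dom C f)" "f \<cdot> (e \<cdot> v') = s2"
    using P Q assms by (simp_all add: in_hom P(8)[THEN reassoc])
  then have "\<exists>!u. ?P u"
    by (rule is_pi_univ[OF assms(1,2)])
  moreover have "?P u" by (intro conjI bexI[of _ v]) (use assms(3-) in \<open>simp_all add: in_hom\<close>)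
  moreover have "?P u'" by (intro conjI bexI[of _ v']) (use assms(3-) in \<open>simp_all add: in_hom\<close>)
  ultimately show ?thesis by blast
qed

text \<open>Each counit is transposed with respect to the other dependent product; the two resulting
  maps are mutually inverse because their composites have the transposes of identities. The
  comparison passes properties from one chosen dependent product to any other.\<close>

lemma is_pi_unique:
  assumes 1: "is_pi C g f r q1 q2 e" and 2: "is_pi C g f r' q1' q2' e'"
  shows "\<exists>a. is_iso C a \<and> Dom C a = Dom C r \<and> Cod C a = Dom C r' \<and> r' \<cdot> a = r"
proof -
  note P = is_piD[OF 1] and P' = is_piD[OF 2]
  note Q = pullbackD[OF P(4)] and Q' = pullbackD[OF P'(4)]
  obtain u v where u: "u \<in> Arr C" "Dom C u = Dom C r" "Cod C u = Dom C r'" "r' \<cdot> u = r"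
    "v \<in> Arr C" "Dom C v = Dom C q1" "Cod C v = Dom C q1'" "q1' \<cdot> v = u \<cdot> q1" "q2' \<cdot> v = q2" "e' \<cdot> v = e"
    by (rule is_pi_ex[OF 2 P(4), of e]) (use P in simp_all)
  obtain u' v' where u': "u' \<in> Arr C" "Dom C u' = Dom C r'" "Cod C u' = Dom C r" "r \<cdot> u' = r'"
    "v' \<in> Arr C" "Dom C v' = Dom C q1'" "Cod C v' = Dom C q1" "q1 \<cdot> v' = u' \<cdot> q1'" "q2 \<cdot> v' = q2'" "e \<cdot> v' = e'"
    by (rule is_pi_ex[OF 1 P'(4), of e']) (use P' in simp_all)
  have "u' \<cdot> u = Ident C (Dom C r)"
    by (rule is_pi_eq[OF 1 P(4), where v = "v' \<cdot> v" and v' = "Ident C (Dom C q1)"])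
      (use P Q P' Q' u u' in \<open>simp_all add: u'(4,8,9,10)[THEN reassoc]\<close>)
  moreover have "u \<cdot> u' = Ident C (Dom C r')"
    by (rule is_pi_eq[OF 2 P'(4), where v = "v \<cdot> v'" and v' = "Ident C (Dom C q1')"])
      (use P Q P' Q' u u' in \<open>simp_all add: u(4,8,9,10)[THEN reassoc]\<close>)
  ultimately have "is_iso C u" using u u' by (intro is_isoI[of u u']) simp_all
  then show ?thesis using u by blast
qed

text \<open>Since \<open>b\<close> can be cancelled, the two cospans have the same commuting
  squares. This moves a gap square from one matching object of the target to another.\<close>

lemma pullback_comp_iso:
  assumes 1: "is_pullback C f g p q" and b: "is_iso C b" "Dom C b = Cod C f"
  shows "is_pullback C (b \<cdot> f) (b \<cdot> g) p q"
proof (rule pullbackI)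
  obtain b' where b': "b \<in> Arr C" "b' \<in> Arr C" "Dom C b' = Cod C b" "Cod C b' = Dom C b"
    "b' \<cdot> b = Ident C (Dom C b)" using b(1) by (rule is_isoE)
  note P = pullbackD[OF 1]
  show "b \<cdot> f \<cdot> p = b \<cdot> g \<cdot> q" "b \<cdot> f \<in> Arr C" "b \<cdot> g \<in> Arr C" "p \<in> Arr C" "q \<in> Arr C"
    "Cod C (b \<cdot> g) = Cod C (b \<cdot> f)" "Dom C q = Dom C p" "Cod C p = Dom C (b \<cdot> f)" "Cod C q = Dom C (b \<cdot> g)"
    using P b b' by simp_all
  fix Z u v
  assume *: "u \<in> Arr C" "v \<in> Arr C" "Dom C u = Z" "Dom C v = Z" "Cod C u = Dom C (b \<cdot> f)"
    "Cod C v = Dom C (b \<cdot> g)" "b \<cdot> f \<cdot> u = b \<cdot> g \<cdot> v"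
  have d: "Dom C (b \<cdot> f) = Dom C f" "Dom C (b \<cdot> g) = Dom C g" using P b b' by simp_all
  note * = *[unfolded d]
  have "b' \<cdot> (b \<cdot> f \<cdot> u) = b' \<cdot> (b \<cdot> g \<cdot> v)" using *(7) by simp
  then have e: "f \<cdot> u = g \<cdot> v"
    using P b b'(1-4) *(1-6) by (simp add: b'(5)[THEN reassoc])
  obtain w where "w \<in> Arr C" "Dom C w = Z" "Cod C w = Dom C p" "p \<cdot> w = u" "q \<cdot> w = v"
    by (rule pullback_ex[OF 1 _ _ _ _ _ _ e, where Z = Z]) (use * in simp_all)
  then show "\<exists>w. w \<in> Arr C \<and> Dom C w = Z \<and> Cod C w = Dom C p \<and> p \<cdot> w = u \<and> q \<cdot> w = v" by metis
qed (rule pullback_eq[OF 1])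

lemma pullback_precomp_iso:
  assumes 1: "is_pullback C f g p q" and a: "is_iso C a" "Cod C a = Dom C p"
  shows "is_pullback C f g (p \<cdot> a) (q \<cdot> a)"
proof (rule pullbackI)
  obtain a' where a': "a \<in> Arr C" "a' \<in> Arr C" "Dom C a' = Cod C a" "Cod C a' = Dom C a"
    "a' \<cdot> a = Ident C (Dom C a)" "a \<cdot> a' = Ident C (Cod C a)" using a(1) by (rule is_isoE)
  note P = pullbackD[OF 1]
  show "f \<in> Arr C" "g \<in> Arr C" "p \<cdot> a \<in> Arr C" "q \<cdot> a \<in> Arr C"
    "Cod C g = Cod C f" "Dom C (q \<cdot> a) = Dom C (p \<cdot> a)" "Cod C (p \<cdot> a) = Dom C f" "Cod C (q \<cdot> a) = Dom C g"
    using P a'(1) a(2) by simp_all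
  show "f \<cdot> (p \<cdot> a) = g \<cdot> (q \<cdot> a)" using P a'(1) a(2) by (simp add: P(9)[THEN reassoc])
  have d: "Dom C (p \<cdot> a) = Dom C a" using P a' a by simp
  fix Z u v
  assume *: "u \<in> Arr C" "v \<in> Arr C" "Dom C u = Z" "Dom C v = Z" "Cod C u = Dom C f"
    "Cod C v = Dom C g" "f \<cdot> u = g \<cdot> v"
  obtain w where w: "w \<in> Arr C" "Dom C w = Z" "Cod C w = Dom C p" "p \<cdot> w = u" "q \<cdot> w = v"
    by (rule pullback_ex[OF 1 _ _ _ _ _ _ *(7), where Z = Z]) (use * in simp_all)
  then show "\<exists>w. w \<in> Arr C \<and> Dom C w = Z \<and> Cod C w = Dom C (p \<cdot> a) \<and> p \<cdot> a \<cdot> w = u \<and> q \<cdot> a \<cdot> w = v"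
    unfolding d using a'(1-4) a(2) P by (intro exI[of _ "a' \<cdot> w"]) (simp add: a'(6)[THEN reassoc])
next
  obtain a' where a': "a \<in> Arr C" "a' \<in> Arr C" "Dom C a' = Cod C a" "Cod C a' = Dom C a"
    "a' \<cdot> a = Ident C (Dom C a)" "a \<cdot> a' = Ident C (Cod C a)" using a(1) by (rule is_isoE)
  note P = pullbackD[OF 1]
  have d: "Dom C (p \<cdot> a) = Dom C a" using P a' a by simp
  fix Z u v
  assume *: "u \<in> Arr C" "v \<in> Arr C" "Dom C u = Z" "Dom C v = Z" "Cod C u = Dom C (p \<cdot> a)"
    "Cod C v = Dom C (p \<cdot> a)" "p \<cdot> a \<cdot> u = p \<cdot> a \<cdot> v" "q \<cdot> a \<cdot> u = q \<cdot> a \<cdot> v"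
  note * = *[unfolded d]
  have "a \<cdot> u = a \<cdot> v"
    by (rule pullback_eq[OF 1, where Z = Z]) (use * a'(1) a(2) P in simp_all)
  then have "a' \<cdot> (a \<cdot> u) = a' \<cdot> (a \<cdot> v)" by simp
  then show "u = v" using * a'(1-4) by (simp add: a'(5)[THEN reassoc])
qed

lemma pullback_unique:
  assumes 1: "is_pullback C f g p q" and 2: "is_pullback C f g p' q'"
  obtains a where "is_iso C a" "Dom C a = Dom C p'" "Cod C a = Dom C p" "p \<cdot> a = p'" "q \<cdot> a = q'"
proof -
  note P = pullbackD[OF 1] and P' = pullbackD[OF 2]
  obtain a where a: "a \<in> Arr C" "Dom C a = Dom C p'" "Cod C a = Dom C p" "p \<cdot> a = p'" "q \<cdot> a = q'"
    by (rule pullback_ex[OF 1 _ _ _ _ _ _ P'(9), where Z = "Dom C p'"]) (use P' in simp_all)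
  obtain b where b: "b \<in> Arr C" "Dom C b = Dom C p" "Cod C b = Dom C p'" "p' \<cdot> b = p" "q' \<cdot> b = q"
    by (rule pullback_ex[OF 2 _ _ _ _ _ _ P(9), where Z = "Dom C p"]) (use P in simp_all)
  have "a \<cdot> b = Ident C (Dom C p)"
    by (rule pullback_eq[OF 1, where Z = "Dom C p"]) (use a(1-3) b P in \<open>simp_all add: a(4,5)[THEN reassoc]\<close>)
  moreover have "b \<cdot> a = Ident C (Dom C p')"
    by (rule pullback_eq[OF 2, where Z = "Dom C p'"]) (use a b(1-3) P' in \<open>simp_all add: b(4,5)[THEN reassoc]\<close>)
  ultimately have "is_iso C a" using a b by (intro is_isoI[of a b]) simp_all
  then show thesis using that a by simp
qed

lemma is_piI:
  assumes "g \<in> Arr C" "f \<in> Arr C" "Cod C f = Dom C g" "is_pullback C r g q1 q2" "e \<in> Arr C"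
    "Dom C e = Dom C q1" "Cod C e = Dom C f" "f \<cdot> e = q2"
    and ex: "\<And>h s1 s2 k. \<lbrakk>is_pullback C h g s1 s2; k \<in> Arr C; Dom C k = Dom C s1; Cod C k = Dom C f; f \<cdot> k = s2\<rbrakk> \<Longrightarrow>
      \<exists>u v. u \<in> Arr C \<and> Dom C u = Dom C h \<and> Cod C u = Dom C r \<and> r \<cdot> u = h \<and>
        v \<in> Arr C \<and> Dom C v = Dom C s1 \<and> Cod C v = Dom C q1 \<and> q1 \<cdot> v = u \<cdot> s1 \<and> q2 \<cdot> v = s2 \<and> e \<cdot> v = k"
    and eq: "\<And>h s1 s2 u u' v v'. \<lbrakk>is_pullback C h g s1 s2;
       u \<in> Arr C; Dom C u = Dom C h; Cod C u = Dom C r; r \<cdot> u = h;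
       v \<in> Arr C; Dom C v = Dom C s1; Cod C v = Dom C q1; q1 \<cdot> v = u \<cdot> s1; q2 \<cdot> v = s2;
       u' \<in> Arr C; Dom C u' = Dom C h; Cod C u' = Dom C r; r \<cdot> u' = h;
       v' \<in> Arr C; Dom C v' = Dom C s1; Cod C v' = Dom C q1; q1 \<cdot> v' = u' \<cdot> s1; q2 \<cdot> v' = s2;
       e \<cdot> v = e \<cdot> v'\<rbrakk> \<Longrightarrow> u = u'"
  shows "is_pi C g f r q1 q2 e"
  unfolding is_pi_def
proof (intro conjI allI impI)
  show "e \<in> hom C (Dom C q1) (Dom C f)" using assms by (simp add: in_hom)
  fix h s1 s2 k
  assume "is_pullback C h g s1 s2 \<and> k \<in> hom C (Dom C s1) (Dom C f) \<and> f \<cdot> k = s2"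
  then have h: "is_pullback C h g s1 s2" and k: "k \<in> Arr C" "Dom C k = Dom C s1" "Cod C k = Dom C f" "f \<cdot> k = s2"
    by (simp_all add: in_hom)
  show "\<exists>!u. u \<in> hom C (Dom C h) (Dom C r) \<and> r \<cdot> u = h \<and>
           (\<exists>v \<in> hom C (Dom C s1) (Dom C q1). q1 \<cdot> v = u \<cdot> s1 \<and> q2 \<cdot> v = s2 \<and> e \<cdot> v = k)" (is "\<exists>!u. ?P u")
  proof (rule ex_ex1I)
    obtain u v where "u \<in> Arr C" "Dom C u = Dom C h" "Cod C u = Dom C r" "r \<cdot> u = h"
        "v \<in> Arr C" "Dom C v = Dom C s1" "Cod C v = Dom C q1" "q1 \<cdot> v = u \<cdot> s1" "q2 \<cdot> v = s2" "e \<cdot> v = k"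
      using ex[OF h k] by (elim exE conjE)
    then show "\<exists>u. ?P u" by (intro exI[of _ u] conjI bexI[of _ v]) (simp_all add: in_hom)
  next
    fix u u' assume u: "?P u" and u': "?P u'"
    from u obtain v where v: "v \<in> hom C (Dom C s1) (Dom C q1)" "q1 \<cdot> v = u \<cdot> s1" "q2 \<cdot> v = s2" "e \<cdot> v = k" by blast
    from u' obtain v' where v': "v' \<in> hom C (Dom C s1) (Dom C q1)" "q1 \<cdot> v' = u' \<cdot> s1" "q2 \<cdot> v' = s2" "e \<cdot> v' = k"
        by blast
    show "u = u'" by (rule eq[OF h, of u v u' v']) (use u u' v v' in \<open>simp_all add: in_hom\<close>)
  qed
qed (use assms(1-4,8) in simp_all)

end

section \<open>Matching objects over an inverse category\<close>

lemma Obj_strict_coslice: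
  "f \<in> Obj (strict_coslice I x) \<longleftrightarrow> f \<in> Arr I \<and> Dom I f = x \<and> f \<noteq> Ident I x"
  by (auto simp: strict_coslice_def full_subcategory_def coslice_def)

lemma strict_coslice_simps [simp]:
  "(f, h, g) \<in> Arr (strict_coslice I x) \<longleftrightarrow>
     f \<in> Obj (strict_coslice I x) \<and> g \<in> Obj (strict_coslice I x) \<and>
     h \<in> hom I (Cod I f) (Cod I g) \<and> h \<cdot>\<^bsub>I\<^esub> f = g"
  "Dom (strict_coslice I x) (f, h, g) = f"
  "Cod (strict_coslice I x) (f, h, g) = g"
  "Ident (strict_coslice I x) f = (f, Ident I (Cod I f), f)"
  "(f', h', g') \<cdot>\<^bsub>strict_coslice I x\<^esub> (f, h, g) = (f, h' \<cdot>\<^bsub>I\<^esub> h, g')"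
  by (auto simp: strict_coslice_def full_subcategory_def coslice_def)

text \<open>An arrow of the strict coslice is a triple whose middle component is an arrow of
  \<open>I\<close> satisfying one equation, so the cone condition can be read in \<open>I\<close>.
  This keeps the triples out of most later arguments.\<close>

lemma under_diagram_cone_iff:
  "is_cone (strict_coslice I x) C (under_diagram I x A) L c \<longleftrightarrow>
     L \<in> Obj C \<and> (\<forall>f \<in> Obj (strict_coslice I x). c f \<in> hom C L (OMap A (Cod I f))) \<and>
     (\<forall>f \<in> Obj (strict_coslice I x). \<forall>g \<in> Obj (strict_coslice I x). \<forall>h \<in> hom I (Cod I f) (Cod I g).
        h \<cdot>\<^bsub>I\<^esub> f = g \<longrightarrow> AMap A h \<cdot>\<^bsub>C\<^esub> c f = c g)"
  (is "?l \<longleftrightarrow> ?r")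
proof
  assume l: ?l
  have "AMap A h \<cdot>\<^bsub>C\<^esub> c f = c g"
    if "f \<in> Obj (strict_coslice I x)" "g \<in> Obj (strict_coslice I x)"
      "h \<in> hom I (Cod I f) (Cod I g)" "h \<cdot>\<^bsub>I\<^esub> f = g" for f g h
  proof -
    have k: "(f, h, g) \<in> Arr (strict_coslice I x)" using that by simp
    then have "AMap (under_diagram I x A) (f, h, g) \<cdot>\<^bsub>C\<^esub> c f = c g"
      using l unfolding is_cone_def by (metis strict_coslice_simps(2,3))
    then show ?thesis using k by (simp add: under_diagram_def)
  qed
  with l show ?r unfolding is_cone_def under_diagram_def by simp
next
  assume ?r
  then show ?l unfolding is_cone_def under_diagram_def by auto
qed

locale inverse_diagrams = category C + I: category I
  for C :: "('o, 'a) cat_data" (structure) and I :: "('i, 'j) cat_data" +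
  assumes inverse: "inverse_category I"
begin

section \<open>Well-founded induction and recursion over the index category\<close>

abbreviation out :: "'i \<Rightarrow> 'j set" where
  "out x \<equiv> Obj (strict_coslice I x)"

definition prec :: "'i \<Rightarrow> 'i \<Rightarrow> bool" where
  "prec y x \<longleftrightarrow> (\<exists>f \<in> out x. Cod I f = y)"

lemma prec_obj: "prec y x \<Longrightarrow> y \<in> Obj I" "prec y x \<Longrightarrow> x \<in> Obj I"
  unfolding prec_def by (metis I.cod_obj I.dom_obj Obj_strict_coslice)+

lemma outD: "f \<in> out x \<Longrightarrow> f \<in> Arr I" "f \<in> out x \<Longrightarrow> Dom I f = x"
  by (simp_all add: Obj_strict_coslice)

lemma out_prec: "f \<in> out x \<Longrightarrow> prec (Cod I f) x"
  unfolding prec_def by blast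

lemma wf_prec: "wf {(y, x). prec y x}"
proof -
  have "{(y, x). prec y x} \<subseteq>
      {(y, x). x \<in> Obj I \<and> y \<in> Obj I \<and> (\<exists>f \<in> hom I x y. f \<noteq> Ident I x)}"
  proof (rule subrelI)
    fix y x assume a: "(y, x) \<in> {(y, x). prec y x}"
    have p: "prec y x" using a by simp
    obtain f where f: "f \<in> out x" "Cod I f = y" using p unfolding prec_def by metis
    have e: "f \<in> hom I x y" "f \<noteq> Ident I x"
      using f Obj_strict_coslice[of f I x] by (simp_all add: I.in_hom)
    have o: "y \<in> Obj I" "x \<in> Obj I" using prec_obj[OF p] by auto
    show "(y, x) \<in> {(y, x). x \<in> Obj I \<and> y \<in> Obj I \<and> (\<exists>f \<in> hom I x y. f \<noteq> Ident I x)}"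
      using e o by blast
  qed
  moreover have "wf {(y, x). x \<in> Obj I \<and> y \<in> Obj I \<and> (\<exists>f \<in> hom I x y. f \<noteq> Ident I x)}"
    using inverse by (simp add: inverse_category_def)
  ultimately show ?thesis by (rule wf_subset[rotated])
qed

lemma prec_induct [consumes 1, case_names less]:
  assumes "x \<in> Obj I" and "\<And>x. \<lbrakk>x \<in> Obj I; \<And>y. prec y x \<Longrightarrow> Q y\<rbrakk> \<Longrightarrow> Q x"
  shows "Q x"
  using assms(1)
proof (induction x rule: wf_induct_rule[OF wf_prec])
  case (1 x)
  then show ?case using assms(2)[of x] prec_obj by blast
qed

lemma not_prec_self [simp]: "\<not> prec x x"
  using wf_not_refl[OF wf_prec] by blast

text \<open>If the composite were an identity, a nonidentity \<open>h\<close> would lead back to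
  \<open>x\<close> and close a cycle of length two in \<open>prec\<close>, while an identity
  \<open>h\<close> would make \<open>f\<close> itself an identity. Hence postcomposition acts on the
  index set of the matching object.\<close>

lemma out_comp:
  assumes "f \<in> out x" "h \<in> Arr I" "Dom I h = Cod I f"
  shows "h \<cdot>\<^bsub>I\<^esub> f \<in> out x"
proof -
  have "h \<cdot>\<^bsub>I\<^esub> f \<noteq> Ident I x"
  proof
    assume e: "h \<cdot>\<^bsub>I\<^esub> f = Ident I x"
    then have c: "Cod I h = x" using assms by (metis I.cod_comp I.ident_cod I.dom_obj Obj_strict_coslice)
    show False
    proof (cases "h = Ident I (Cod I f)")
      case True
      have "h \<cdot>\<^bsub>I\<^esub> f = f" unfolding True using outD[OF assms(1)] by simp
      then show False using e assms(1) unfolding Obj_strict_coslice by simp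
    next
      case False
      have "h \<in> out (Cod I f)" using assms False by (simp add: Obj_strict_coslice)
      then have "prec x (Cod I f)" using out_prec[of h] by (simp add: c)
      moreover have "prec (Cod I f) x" using assms(1) by (rule out_prec)
      ultimately show False using wf_not_sym[OF wf_prec, of x "Cod I f"] by simp
    qed
  qed
  then show ?thesis using assms by (simp add: Obj_strict_coslice)
qed

lemma prec_trans: "prec z y \<Longrightarrow> prec y x \<Longrightarrow> prec z x"
proof -
  assume "prec z y" "prec y x"
  then obtain h f where h: "h \<in> out y" "Cod I h = z" and f: "f \<in> out x" "Cod I f = y"
    unfolding prec_def by blast
  note h' = outD[OF h(1)] and f' = outD[OF f(1)]
  then have "h \<cdot>\<^bsub>I\<^esub> f \<in> out x" "Cod I (h \<cdot>\<^bsub>I\<^esub> f) = z" using out_comp[OF f(1), of h] h f h' f' by simp_all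
  then show ?thesis unfolding prec_def by blast
qed

text \<open>Recursion along \<open>prec\<close> with a choice at each step, for a predicate on total
  functions. By \<open>cong\<close> the predicate at \<open>x\<close> sees only the values at
  \<open>x\<close> and below, so values chosen at different objects fit together in one function. In
  the applications \<open>'b\<close> is an arrow or a tuple of all raw data at one object.\<close>

lemma prec_recursion:
  fixes Q :: "('i \<Rightarrow> 'b) \<Rightarrow> 'i \<Rightarrow> bool"
  assumes cong: "\<And>g g' x. \<lbrakk>x \<in> Obj I; \<And>y. y = x \<or> prec y x \<Longrightarrow> g y = g' y; Q g x\<rbrakk> \<Longrightarrow> Q g' x"
    and step: "\<And>g x. \<lbrakk>x \<in> Obj I; \<And>y. prec y x \<Longrightarrow> Q g y\<rbrakk> \<Longrightarrow> \<exists>r. Q (g(x := r)) x"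
  shows "\<exists>g. \<forall>x \<in> Obj I. Q g x"
proof -
  define P where "P f x r \<longleftrightarrow> (x \<in> Obj I \<longrightarrow> Q (f(x := r)) x)" for f x r
  have "\<exists>f. \<forall>x. P f x (f x)"
  proof (rule dependent_wf_choice[OF wf_prec])
    fix f g :: "'i \<Rightarrow> 'b" and x r
    assume "\<And>z. (z, x) \<in> {(y, x). prec y x} \<Longrightarrow> f z = g z"
    then have "f(x := r) = g(x := r) \<or> (\<forall>y. y = x \<or> prec y x \<longrightarrow> (f(x := r)) y = (g(x := r)) y)" by auto
    then show "P f x r = P g x r"
      unfolding P_def using cong[of x "f(x := r)" "g(x := r)"] cong[of x "g(x := r)" "f(x := r)"] by metis
  next
    fix x and f :: "'i \<Rightarrow> 'b"
    assume "\<And>y. (y, x) \<in> {(y, x). prec y x} \<Longrightarrow> P f y (f y)"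
    then have "Q f y" if "prec y x" for y using that prec_obj unfolding P_def by (simp add: fun_upd_triv)
    then show "\<exists>r. P f x r" unfolding P_def using step[of x f] by blast
  qed
  then show ?thesis unfolding P_def by (simp add: fun_upd_triv) blast
qed

text \<open>The share of functoriality carried by the arrows out of \<open>x\<close>. All of these
  end at \<open>x\<close> or below it, so a diagram that is only meaningful up to \<open>x\<close>
  can already satisfy it.\<close>

definition fun_at :: "('i, 'j, 'o, 'a) diagram \<Rightarrow> 'i \<Rightarrow> bool" where
  "fun_at A x \<longleftrightarrow> OMap A x \<in> Obj C \<and>
     (\<forall>f \<in> Arr I. Dom I f = x \<longrightarrow> AMap A f \<in> hom C (OMap A x) (OMap A (Cod I f))) \<and>
     AMap A (Ident I x) = Ident C (OMap A x) \<and>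
     (\<forall>f \<in> Arr I. \<forall>g \<in> Arr I. Dom I f = x \<and> Cod I f = Dom I g \<longrightarrow>
        AMap A (g \<cdot>\<^bsub>I\<^esub> f) = AMap A g \<cdot> AMap A f)"

definition nat_at :: "('i, 'j, 'o, 'a) transf \<Rightarrow> 'i \<Rightarrow> bool" where
  "nat_at t x \<longleftrightarrow> At t x \<in> hom C (OMap (Src t) x) (OMap (Tgt t) x) \<and>
     (\<forall>f \<in> Arr I. Dom I f = x \<longrightarrow>
        At t (Cod I f) \<cdot> AMap (Src t) f = AMap (Tgt t) f \<cdot> At t x)"

lemma fun_atD:
  assumes "fun_at A x"
  shows "OMap A x \<in> Obj C" "AMap A (Ident I x) = Ident C (OMap A x)"
    "\<lbrakk>f \<in> Arr I; Dom I f = x\<rbrakk> \<Longrightarrow> AMap A f \<in> Arr C"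
    "\<lbrakk>f \<in> Arr I; Dom I f = x\<rbrakk> \<Longrightarrow> Dom C (AMap A f) = OMap A x"
    "\<lbrakk>f \<in> Arr I; Dom I f = x\<rbrakk> \<Longrightarrow> Cod C (AMap A f) = OMap A (Cod I f)"
    "\<lbrakk>f \<in> Arr I; g \<in> Arr I; Dom I f = x; Cod I f = Dom I g\<rbrakk> \<Longrightarrow> AMap A (g \<cdot>\<^bsub>I\<^esub> f) = AMap A g \<cdot> AMap A f"
  using assms by (simp_all add: fun_at_def in_hom)

lemma nat_atD:
  assumes "nat_at t x"
  shows "At t x \<in> Arr C" "Dom C (At t x) = OMap (Src t) x" "Cod C (At t x) = OMap (Tgt t) x"
    "\<lbrakk>f \<in> Arr I; Dom I f = x\<rbrakk> \<Longrightarrow> At t (Cod I f) \<cdot> AMap (Src t) f = AMap (Tgt t) f \<cdot> At t x"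
  using assms by (simp_all add: nat_at_def in_hom)

lemma is_functor_iff:
  "is_functor I C A \<longleftrightarrow>
     OMap A \<in> extensional (Obj I) \<and> AMap A \<in> extensional (Arr I) \<and> (\<forall>x \<in> Obj I. fun_at A x)"
proof (intro iffI conjI ballI)
  fix x assume "is_functor I C A" "x \<in> Obj I"
  then show "fun_at A x" unfolding is_functor_def fun_at_def PiE_def by (auto simp: in_hom)
next
  assume r: "OMap A \<in> extensional (Obj I) \<and> AMap A \<in> extensional (Arr I) \<and> (\<forall>x \<in> Obj I. fun_at A x)"
  then have D: "fun_at A (Dom I f)" if "f \<in> Arr I" for f using that by simp
  show "is_functor I C A"
    unfolding is_functor_def PiE_def
    using r fun_atD(1,2) fun_atD(3-6)[OF D] by (auto simp: in_hom)
qed (auto simp: is_functor_def PiE_def)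

lemma is_natural_iff:
  "is_natural I C t \<longleftrightarrow> is_functor I C (Src t) \<and> is_functor I C (Tgt t) \<and>
     At t \<in> extensional (Obj I) \<and> (\<forall>x \<in> Obj I. nat_at t x)"
proof (intro iffI conjI ballI)
  fix x assume "is_natural I C t" "x \<in> Obj I"
  then show "nat_at t x" unfolding is_natural_def nat_at_def PiE_def by (auto simp: in_hom)
next
  assume r: "is_functor I C (Src t) \<and> is_functor I C (Tgt t) \<and>
     At t \<in> extensional (Obj I) \<and> (\<forall>x \<in> Obj I. nat_at t x)"
  then have D: "nat_at t (Dom I f)" if "f \<in> Arr I" for f using that by simp
  show "is_natural I C t"
    unfolding is_natural_def PiE_def
    using r nat_atD(1-3) nat_atD(4)[OF D] by (auto simp: in_hom)
qed (auto simp: is_natural_def PiE_def)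

section \<open>Matching objects, matching maps and extension by one object\<close>

lemma matching_objectD:
  assumes "is_matching_object I C A x M c"
  shows "M \<in> Obj C"
    "f \<in> out x \<Longrightarrow> c f \<in> Arr C" "f \<in> out x \<Longrightarrow> Dom C (c f) = M"
    "f \<in> out x \<Longrightarrow> Cod C (c f) = OMap A (Cod I f)"
    "\<lbrakk>f \<in> out x; h \<in> Arr I; Dom I h = Cod I f\<rbrakk> \<Longrightarrow> AMap A h \<cdot> c f = c (h \<cdot>\<^bsub>I\<^esub> f)"
proof -
  note * = conjunct1[OF assms[unfolded is_matching_object_def is_limit_def], unfolded under_diagram_cone_iff]
  show "M \<in> Obj C"
    "f \<in> out x \<Longrightarrow> c f \<in> Arr C" "f \<in> out x \<Longrightarrow> Dom C (c f) = M"
    "f \<in> out x \<Longrightarrow> Cod C (c f) = OMap A (Cod I f)"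
    using * unfolding in_hom by blast+
  show "AMap A h \<cdot> c f = c (h \<cdot>\<^bsub>I\<^esub> f)" if "f \<in> out x" "h \<in> Arr I" "Dom I h = Cod I f"
  proof -
    have "h \<in> hom I (Cod I f) (Cod I (h \<cdot>\<^bsub>I\<^esub> f))"
      using that outD[OF that(1)] by (simp add: I.in_hom)
    then show ?thesis using * out_comp[OF that] that(1) by blast
  qed
qed

lemma cone_atI:
  assumes "Z \<in> Obj C" "\<And>f. f \<in> out x \<Longrightarrow> d f \<in> Arr C" "\<And>f. f \<in> out x \<Longrightarrow> Dom C (d f) = Z"
    "\<And>f. f \<in> out x \<Longrightarrow> Cod C (d f) = OMap A (Cod I f)"
    "\<And>f h. \<lbrakk>f \<in> out x; h \<in> Arr I; Dom I h = Cod I f\<rbrakk> \<Longrightarrow> AMap A h \<cdot> d f = d (h \<cdot>\<^bsub>I\<^esub> f)"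
  shows "is_cone (strict_coslice I x) C (under_diagram I x A) Z d"
  unfolding under_diagram_cone_iff
proof (intro conjI ballI impI)
  fix f g h assume "f \<in> out x" "h \<in> hom I (Cod I f) (Cod I g)" "h \<cdot>\<^bsub>I\<^esub> f = g"
  then show "AMap A h \<cdot> d f = d g" using assms(5)[of f h] unfolding I.in_hom by blast
qed (use assms(1-4) in_hom in auto)

lemma matching_object_ex:
  assumes "is_matching_object I C A x M c"
    "Z \<in> Obj C" "\<And>f. f \<in> out x \<Longrightarrow> d f \<in> Arr C" "\<And>f. f \<in> out x \<Longrightarrow> Dom C (d f) = Z"
    "\<And>f. f \<in> out x \<Longrightarrow> Cod C (d f) = OMap A (Cod I f)"
    "\<And>f h. \<lbrakk>f \<in> out x; h \<in> Arr I; Dom I h = Cod I f\<rbrakk> \<Longrightarrow> AMap A h \<cdot> d f = d (h \<cdot>\<^bsub>I\<^esub> f)"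
  shows "\<exists>u. u \<in> Arr C \<and> Dom C u = Z \<and> Cod C u = M \<and> (\<forall>f \<in> out x. c f \<cdot> u = d f)"
proof -
  have "is_cone (strict_coslice I x) C (under_diagram I x A) Z d"
    by (rule cone_atI) (fact assms)+
  then obtain u where "u \<in> hom C Z M" "\<forall>f \<in> out x. c f \<cdot> u = d f"
    using assms(1) unfolding is_matching_object_def is_limit_def by blast
  then show ?thesis by (intro exI[of _ u]) (simp add: in_hom)
qed

text \<open>The common composites with the projections form a cone, of which both maps are
  factorizations. Functoriality of \<open>A\<close> below \<open>x\<close> enters when the cone law
  is checked for \<open>c f \<cdot> v\<close>.\<close>

lemma matching_object_eq:
  assumes "is_matching_object I C A x M c" "\<And>y. prec y x \<Longrightarrow> fun_at A y"
    "u \<in> Arr C" "v \<in> Arr C" "Dom C u = Z" "Dom C v = Z" "Cod C u = M" "Cod C v = M"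
    "\<And>f. f \<in> out x \<Longrightarrow> c f \<cdot> u = c f \<cdot> v"
  shows "u = v"
proof -
  note * = matching_objectD[OF assms(1)]
  have "is_cone (strict_coslice I x) C (under_diagram I x A) Z (\<lambda>f. c f \<cdot> v)"
  proof (rule cone_atI)
    show "Z \<in> Obj C" using assms(4,6) by auto
    fix f h
    assume f: "f \<in> out x" "h \<in> Arr I" "Dom I h = Cod I f"
    show "AMap A h \<cdot> (c f \<cdot> v) = c (h \<cdot>\<^bsub>I\<^esub> f) \<cdot> v"
      using *(2-4)[OF f(1)] *(5)[OF f] fun_atD[OF assms(2)[OF out_prec[OF f(1)]]] f(2,3) assms(4,6,8)
        out_comp[OF f] *(2-4)[OF out_comp[OF f]]
      by (simp add: *(5)[OF f, THEN reassoc])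
  qed (use * assms(4,6,8) in \<open>simp_all\<close>)
  moreover have "u \<in> hom C Z M" "v \<in> hom C Z M" using assms by (simp_all add: in_hom)
  ultimately show ?thesis
    using assms(1,9) unfolding is_matching_object_def is_limit_def by metis
qed

abbreviation lim_at where
  "lim_at t x \<equiv> is_lim_map (strict_coslice I x) C (under_transf I x t)"

lemma matching_mapD:
  assumes "is_matching_map I C A x M c k"
  shows "is_matching_object I C A x M c" "k \<in> Arr C" "Dom C k = OMap A x" "Cod C k = M"
    "f \<in> out x \<Longrightarrow> c f \<cdot> k = AMap A f"
  using assms by (simp_all add: is_matching_map_def in_hom)

lemma matching_mapI:
  assumes "is_matching_object I C A x M c" "k \<in> Arr C" "Dom C k = OMap A x" "Cod C k = M"
    "\<And>f. f \<in> out x \<Longrightarrow> c f \<cdot> k = AMap A f"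
  shows "is_matching_map I C A x M c k"
  using assms by (simp add: is_matching_map_def in_hom)

lemma matching_map_exists:
  assumes A: "fun_at A x" and M: "is_matching_object I C A x M c"
  obtains k where "is_matching_map I C A x M c k"
proof -
  have "\<exists>k. k \<in> Arr C \<and> Dom C k = OMap A x \<and> Cod C k = M \<and> (\<forall>f \<in> out x. c f \<cdot> k = AMap A f)"
  proof (rule matching_object_ex[OF M, where d = "AMap A"])
    fix f h assume "f \<in> out x" "h \<in> Arr I" "Dom I h = Cod I f"
    then show "AMap A h \<cdot> AMap A f = AMap A (h \<cdot>\<^bsub>I\<^esub> f)"
      using fun_atD(6)[OF A, of f h] outD[of f x] by simp
  qed (use fun_atD(1,3-5)[OF A] outD[of _ x] in simp_all)
  then show thesis using that M by (metis matching_mapI)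
qed

lemma lim_mapD:
  assumes "lim_at t x M c N d m"
  shows "is_matching_object I C (Src t) x M c" "is_matching_object I C (Tgt t) x N d"
    "m \<in> Arr C" "Dom C m = M" "Cod C m = N"
    "f \<in> out x \<Longrightarrow> d f \<cdot> m = At t (Cod I f) \<cdot> c f"
  using assms by (simp_all add: is_lim_map_def is_matching_object_def under_transf_def in_hom)

lemma lim_mapI:
  assumes "is_matching_object I C (Src t) x M c" "is_matching_object I C (Tgt t) x N d"
    "m \<in> Arr C" "Dom C m = M" "Cod C m = N"
    "\<And>f. f \<in> out x \<Longrightarrow> d f \<cdot> m = At t (Cod I f) \<cdot> c f"
  shows "lim_at t x M c N d m"
  using assms by (simp add: is_lim_map_def is_matching_object_def under_transf_def in_hom)

lemma lim_map_exists:
  assumes M: "is_matching_object I C (Src t) x M c" and N: "is_matching_object I C (Tgt t) x N d"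
    and A: "\<And>y. prec y x \<Longrightarrow> fun_at (Src t) y" and B: "\<And>y. prec y x \<Longrightarrow> fun_at (Tgt t) y"
    and t: "\<And>y. prec y x \<Longrightarrow> nat_at t y"
  obtains m where "lim_at t x M c N d m"
proof -
  note c = matching_objectD[OF M]
  have "\<exists>m. m \<in> Arr C \<and> Dom C m = M \<and> Cod C m = N \<and> (\<forall>f \<in> out x. d f \<cdot> m = At t (Cod I f) \<cdot> c f)"
  proof (rule matching_object_ex[OF N, where d = "\<lambda>f. At t (Cod I f) \<cdot> c f"])
    fix f h assume f: "f \<in> out x" "h \<in> Arr I" "Dom I h = Cod I f"
    have p: "prec (Cod I f) x" "prec (Cod I h) x"
      using out_prec[OF f(1)] out_prec[OF out_comp[OF f]] outD[OF f(1)] f by simp_all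
    show "AMap (Tgt t) h \<cdot> (At t (Cod I f) \<cdot> c f) = At t (Cod I (h \<cdot>\<^bsub>I\<^esub> f)) \<cdot> c (h \<cdot>\<^bsub>I\<^esub> f)"
      using c(2-4)[OF f(1)] nat_atD(1-3)[OF t[OF p(1)]] nat_atD(1-3)[OF t[OF p(2)]]
        fun_atD(3-5)[OF A[OF p(1)] f(2,3)] fun_atD(3-5)[OF B[OF p(1)] f(2,3)] f outD[OF f(1)]
      by (simp add: nat_atD(4)[OF t[OF p(1)] f(2,3), THEN reassoc] c(5)[OF f, symmetric])
  qed (use c(1-4) nat_atD[OF t[OF out_prec]] in simp_all)
  then show thesis using that M N by (metis lim_mapI)
qed

lemma matching_object_iso:
  assumes M: "is_matching_object I C A x M c" and N: "is_matching_object I C A x N d"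
    and A: "\<And>y. prec y x \<Longrightarrow> fun_at A y"
  obtains a where "is_iso C a" "Dom C a = M" "Cod C a = N" "\<And>f. f \<in> out x \<Longrightarrow> d f \<cdot> a = c f"
proof -
  note c = matching_objectD[OF M] and d = matching_objectD[OF N]
  have "\<exists>a. a \<in> Arr C \<and> Dom C a = M \<and> Cod C a = N \<and> (\<forall>f \<in> out x. d f \<cdot> a = c f)"
    by (rule matching_object_ex[OF N]) (use c in simp_all)
  then obtain a where a: "a \<in> Arr C" "Dom C a = M" "Cod C a = N" "\<And>f. f \<in> out x \<Longrightarrow> d f \<cdot> a = c f"
    by metis
  have "\<exists>b. b \<in> Arr C \<and> Dom C b = N \<and> Cod C b = M \<and> (\<forall>f \<in> out x. c f \<cdot> b = d f)"
    by (rule matching_object_ex[OF M]) (use d in simp_all)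
  then obtain b where b: "b \<in> Arr C" "Dom C b = N" "Cod C b = M" "\<And>f. f \<in> out x \<Longrightarrow> c f \<cdot> b = d f"
    by metis
  have "b \<cdot> a = Ident C M"
  proof (rule matching_object_eq[OF M A])
    fix f assume f: "f \<in> out x"
    show "c f \<cdot> (b \<cdot> a) = c f \<cdot> Ident C M"
      using c(1) c(2-4)[OF f] d(2-4)[OF f] a b(1-3) b(4)[OF f] by (simp add: b(4)[OF f, THEN reassoc] a(4)[OF f])
  qed (use a b c in simp_all)
  moreover have "a \<cdot> b = Ident C N"
  proof (rule matching_object_eq[OF N A])
    fix f assume f: "f \<in> out x"
    show "d f \<cdot> (a \<cdot> b) = d f \<cdot> Ident C N"
      using d(1) c(2-4)[OF f] d(2-4)[OF f] a b(1-3) b(4)[OF f] by (simp add: a(4)[OF f, THEN reassoc])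
  qed (use a b d in simp_all)
  ultimately have "is_iso C a" using a b by (intro is_isoI[of a b]) simp_all
  then show thesis using a that by simp
qed

text \<open>With the arrows out of \<open>x\<close> defined through \<open>k\<close>, compatibility
  with a further arrow below \<open>x\<close> is the cone law for \<open>c\<close>. The identity
  lies outside \<open>out x\<close> and is prescribed separately.\<close>

lemma fun_at_extend:
  assumes x: "x \<in> Obj I" and A: "\<And>y. prec y x \<Longrightarrow> fun_at A y" and M: "is_matching_object I C A x M c"
    and k: "k \<in> Arr C" "Dom C k = OMap A x" "Cod C k = M"
    and e: "\<And>f. f \<in> out x \<Longrightarrow> AMap A f = c f \<cdot> k" "AMap A (Ident I x) = Ident C (OMap A x)"
  shows "fun_at A x" "is_matching_map I C A x M c k"
proof -
  note c = matching_objectD[OF M]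
  have o: "OMap A x \<in> Obj C" using dom_obj[of k] k by simp
  have f: "AMap A f \<in> Arr C \<and> Dom C (AMap A f) = OMap A x \<and> Cod C (AMap A f) = OMap A (Cod I f)"
    if "f \<in> Arr I" "Dom I f = x" for f
  proof (cases "f = Ident I x")
    case True
    then show ?thesis using e(2) x o by simp
  next
    case False
    then have "f \<in> out x" using that by (simp add: Obj_strict_coslice)
    then show ?thesis using e(1) c k by simp
  qed
  have "AMap A (g \<cdot>\<^bsub>I\<^esub> f) = AMap A g \<cdot> AMap A f"
    if "f \<in> Arr I" "g \<in> Arr I" "Dom I f = x" "Cod I f = Dom I g" for f g
  proof (cases "f = Ident I x")
    case True
    then have "Dom I g = x" using that x by simp
    then show ?thesis using e(2) x o f[of g] that True by simp
  next
    case False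
    then have o: "f \<in> out x" using that by (simp add: Obj_strict_coslice)
    then have p: "prec (Cod I f) x" by (rule out_prec)
    note c5 = c(5)[OF o that(2) that(4)[symmetric]]
    have "AMap A (g \<cdot>\<^bsub>I\<^esub> f) = c (g \<cdot>\<^bsub>I\<^esub> f) \<cdot> k"
      using that by (intro e(1) out_comp o) simp_all
    then show ?thesis
      using c5[symmetric] e(1)[OF o] fun_atD[OF A[OF p]] that c(2-4)[OF o] k by simp
  qed
  with o f e show "fun_at A x" unfolding fun_at_def in_hom by blast
  show "is_matching_map I C A x M c k" using M k e(1) by (intro matching_mapI) simp_all
qed

text \<open>Composing the single equation over matching objects with the projection
  \<open>d f\<close> yields the naturality square of every nonidentity \<open>f\<close> out of
  \<open>x\<close>.\<close>

lemma nat_at_extend: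
  assumes x: "x \<in> Obj I" and A: "fun_at (Src t) x" and B: "fun_at (Tgt t) x"
    and m: "lim_at t x M c N d m"
    and kA: "is_matching_map I C (Src t) x M c kA" and kB: "is_matching_map I C (Tgt t) x N d kB"
    and tx: "At t x \<in> Arr C" "Dom C (At t x) = OMap (Src t) x" "Cod C (At t x) = OMap (Tgt t) x"
    and t: "\<And>y. prec y x \<Longrightarrow> nat_at t y"
    and e: "kB \<cdot> At t x = m \<cdot> kA"
  shows "nat_at t x"
proof -
  note m' = lim_mapD[OF m]
  have "At t (Cod I f) \<cdot> AMap (Src t) f = AMap (Tgt t) f \<cdot> At t x" if f: "f \<in> Arr I" "Dom I f = x" for f
  proof (cases "f = Ident I x")
    case True
    then show ?thesis using fun_atD(2)[OF A] fun_atD(2)[OF B] x tx by simp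
  next
    case False
    then have o: "f \<in> out x" using f by (simp add: Obj_strict_coslice)
    note c = matching_objectD(2-4)[OF m'(1) o] and d = matching_objectD(2-4)[OF m'(2) o]
    have "AMap (Tgt t) f \<cdot> At t x = d f \<cdot> (kB \<cdot> At t x)"
      using matching_mapD(2-4)[OF kB] matching_mapD(5)[OF kB o, symmetric] d tx by simp
    also have "\<dots> = At t (Cod I f) \<cdot> AMap (Src t) f"
      using matching_mapD(2-4)[OF kA] matching_mapD(5)[OF kA o] c d m'(3-5) m'(6)[OF o]
        nat_atD(1-3)[OF t[OF out_prec[OF o]]]
      by (simp add: e m'(6)[OF o, THEN reassoc])
    finally show ?thesis by simp
  qed
  then show ?thesis using tx by (simp add: nat_at_def in_hom)
qed

text \<open>Converse of the extension step: the projections of the target's matching object are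
  jointly monic, and after each of them the equation is a naturality square.\<close>

lemma nat_at_matching:
  assumes t: "\<And>y. prec y x \<or> y = x \<Longrightarrow> nat_at t y"
    and B: "\<And>y. prec y x \<Longrightarrow> fun_at (Tgt t) y"
    and m: "lim_at t x M c N d m"
    and kA: "is_matching_map I C (Src t) x M c kA" and kB: "is_matching_map I C (Tgt t) x N d kB"
  shows "kB \<cdot> At t x = m \<cdot> kA"
proof (rule matching_object_eq[OF lim_mapD(2)[OF m] B])
  note m' = lim_mapD[OF m]
  have tx: "nat_at t x" using t by simp
  fix f assume o: "f \<in> out x"
  note c = matching_objectD(2-4)[OF m'(1) o] and d = matching_objectD(2-4)[OF m'(2) o]
  have "d f \<cdot> (kB \<cdot> At t x) = AMap (Tgt t) f \<cdot> At t x"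
    using matching_mapD(2-4)[OF kB] matching_mapD(5)[OF kB o, symmetric] d nat_atD(1-3)[OF tx] by simp
  also have "\<dots> = d f \<cdot> (m \<cdot> kA)"
      using matching_mapD(2-4)[OF kA] matching_mapD(5)[OF kA o] c d m'(3-5) m'(6)[OF o]
        nat_atD(1-3)[OF t[OF disjI1[OF out_prec[OF o]]]] nat_atD(4)[OF tx outD[OF o]]
      by (simp add: m'(6)[OF o, THEN reassoc])
  finally show "d f \<cdot> (kB \<cdot> At t x) = d f \<cdot> (m \<cdot> kA)" .
qed (use lim_mapD(3-5)[OF m] matching_mapD(2-4)[OF kA] matching_mapD(2-4)[OF kB] nat_atD(1-3)[OF t, of x] in simp_all)

text \<open>Limits commute with pullbacks. Functoriality, naturality and the pullback squares are
  assumed only below \<open>x\<close>, so the statement can be used in the middle of a recursion,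
  when the four diagrams are known only there.\<close>

lemma lim_pullback:
  assumes eq: "Tgt v = Src q" "Src v = Src s" "Tgt s = Src u" "Tgt q = Tgt u"
    and mq: "lim_at q x M' c' M c mq" and mu: "lim_at u x N d M c mu"
    and mv: "lim_at v x K e M' c' mv" and ms: "lim_at s x K e N d ms"
    and fnc: "\<And>y. prec y x \<Longrightarrow> fun_at (Src q) y" "\<And>y. prec y x \<Longrightarrow> fun_at (Tgt q) y"
      "\<And>y. prec y x \<Longrightarrow> fun_at (Src u) y" "\<And>y. prec y x \<Longrightarrow> fun_at (Src v) y"
    and nat: "\<And>y. prec y x \<Longrightarrow> nat_at v y" "\<And>y. prec y x \<Longrightarrow> nat_at s y"
    and pb: "\<And>y. prec y x \<Longrightarrow> is_pullback C (At q y) (At u y) (At v y) (At s y)"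
  shows "is_pullback C mq mu mv ms"
proof (rule pullbackI)
  note q = lim_mapD[OF mq] and u = lim_mapD[OF mu] and v = lim_mapD[OF mv] and s = lim_mapD[OF ms]
  have P: "f \<in> out x \<Longrightarrow> is_pullback C (At q (Cod I f)) (At u (Cod I f)) (At v (Cod I f)) (At s (Cod I f))" for f
    by (rule pb[OF out_prec])
  note arr = q(3-5) u(3-5) v(3-5) s(3-5)
  note D = matching_objectD(2-4)[OF q(1)] matching_objectD(2-4)[OF q(2)]
    matching_objectD(2-4)[OF u(1)] matching_objectD(2-4)[OF v(1)]
  note N = nat_atD(1-3)[OF nat(1)[OF out_prec]] nat_atD(1-3)[OF nat(2)[OF out_prec]]
  show "mq \<cdot> mv = mu \<cdot> ms"
  proof (rule matching_object_eq[OF q(2) fnc(2)])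
    fix f assume o: "f \<in> out x"
    note P' = pullbackD[OF P[OF o]]
    show "c f \<cdot> (mq \<cdot> mv) = c f \<cdot> (mu \<cdot> ms)"
      using arr D[OF o] P' q(6)[OF o] u(6)[OF o] v(6)[OF o] s(6)[OF o] N[OF o] eq
      by (simp add: q(6)[OF o, THEN reassoc] u(6)[OF o, THEN reassoc] P'(9)[THEN reassoc])
  qed (use arr in simp_all)
  show "mq \<in> Arr C" "mu \<in> Arr C" "mv \<in> Arr C" "ms \<in> Arr C" "Cod C mu = Cod C mq"
    "Dom C ms = Dom C mv" "Cod C mv = Dom C mq" "Cod C ms = Dom C mu" using arr by simp_all
  fix Z a b
  assume ab: "a \<in> Arr C" "b \<in> Arr C" "Dom C a = Z" "Dom C b = Z" "Cod C a = Dom C mq" "Cod C b = Dom C mu"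
    "mq \<cdot> a = mu \<cdot> b"
  \<comment> \<open>A compatible pair over the matching objects is projected to each index
    \<open>f\<close> and mediated there by the levelwise pullback.\<close>
  have "\<exists>w. w \<in> Arr C \<and> Dom C w = Z \<and> Cod C w = OMap (Src v) (Cod I f) \<and>
      At v (Cod I f) \<cdot> w = c' f \<cdot> a \<and> At s (Cod I f) \<cdot> w = d f \<cdot> b" if o: "f \<in> out x" for f
  proof -
    note P' = pullbackD[OF P[OF o]]
    have "c f \<cdot> (mq \<cdot> a) = c f \<cdot> (mu \<cdot> b)" using ab by simp
    then have e: "At q (Cod I f) \<cdot> (c' f \<cdot> a) = At u (Cod I f) \<cdot> (d f \<cdot> b)"
      using arr D[OF o] P' q(6)[OF o] u(6)[OF o] N[OF o] eq ab(1-6)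
      by (simp add: q(6)[OF o, THEN reassoc] u(6)[OF o, THEN reassoc])
    obtain w where "w \<in> Arr C" "Dom C w = Z" "Cod C w = Dom C (At v (Cod I f))"
        "At v (Cod I f) \<cdot> w = c' f \<cdot> a" "At s (Cod I f) \<cdot> w = d f \<cdot> b"
      by (rule pullback_ex[OF P[OF o] _ _ _ _ _ _ e, where Z = Z])
         (use arr D[OF o] P' N[OF o] eq ab(1-6) in simp_all)
    then show ?thesis using N[OF o] by auto
  qed
  then obtain w where w: "\<And>f. f \<in> out x \<Longrightarrow> w f \<in> Arr C" "\<And>f. f \<in> out x \<Longrightarrow> Dom C (w f) = Z"
      "\<And>f. f \<in> out x \<Longrightarrow> Cod C (w f) = OMap (Src v) (Cod I f)"
      "\<And>f. f \<in> out x \<Longrightarrow> At v (Cod I f) \<cdot> w f = c' f \<cdot> a" "\<And>f. f \<in> out x \<Longrightarrow> At s (Cod I f) \<cdot> w f = d f \<cdot> b"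
    by metis
  have "\<exists>r. r \<in> Arr C \<and> Dom C r = Z \<and> Cod C r = K \<and> (\<forall>f \<in> out x. e f \<cdot> r = w f)"
  proof (rule matching_object_ex[OF v(1), where d = w])
    fix f h assume f: "f \<in> out x" "h \<in> Arr I" "Dom I h = Cod I f"
    note o = out_comp[OF f]
    have cod: "Cod I (h \<cdot>\<^bsub>I\<^esub> f) = Cod I h" using f outD[OF f(1)] by simp
    note p = out_prec[OF f(1)]
    note simps = w(1-5)[OF f(1)] w(1-5)[OF o, unfolded cod] D[OF f(1)] D[OF o, unfolded cod]
      N[OF f(1)] N[OF o, unfolded cod] eq fun_atD(3-5)[OF fnc(4)[OF p] f(2,3)]
      fun_atD(3-5)[OF fnc(1)[OF p] f(2,3)] fun_atD(3-5)[OF fnc(3)[OF p] f(2,3)] ab(1-6) arr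
      nat_atD(4)[OF nat(1)[OF p] f(2,3)] nat_atD(4)[OF nat(2)[OF p] f(2,3)]
      matching_objectD(5)[OF q(1) f] matching_objectD(5)[OF u(1) f]
    \<comment> \<open>Uniqueness in the pullback at \<open>Cod I h\<close> turns naturality of
      \<open>v\<close> and \<open>s\<close> into the cone law for the family
      \<open>w\<close>.\<close>
    show "AMap (Src v) h \<cdot> w f = w (h \<cdot>\<^bsub>I\<^esub> f)"
    proof (rule pullback_eq[OF P[OF o, unfolded cod]])
      show "At v (Cod I h) \<cdot> (AMap (Src v) h \<cdot> w f) = At v (Cod I h) \<cdot> w (h \<cdot>\<^bsub>I\<^esub> f)"
        using simps nat_atD(4)[OF nat(1)[OF p] f(2,3), THEN reassoc, of "w f"]
          matching_objectD(5)[OF q(1) f, THEN reassoc, of a]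
        by simp
      show "At s (Cod I h) \<cdot> (AMap (Src v) h \<cdot> w f) = At s (Cod I h) \<cdot> w (h \<cdot>\<^bsub>I\<^esub> f)"
        using simps nat_atD(4)[OF nat(2)[OF p] f(2,3), THEN reassoc, of "w f"]
          matching_objectD(5)[OF u(1) f, THEN reassoc, of b]
        by simp
    qed (use simps in simp_all)
  qed (use w ab in auto)
  then obtain r where r: "r \<in> Arr C" "Dom C r = Z" "Cod C r = K" "\<And>f. f \<in> out x \<Longrightarrow> e f \<cdot> r = w f"
    by metis
  have "mv \<cdot> r = a"
  proof (rule matching_object_eq[OF q(1) fnc(1)])
    fix f assume o: "f \<in> out x"
    show "c' f \<cdot> (mv \<cdot> r) = c' f \<cdot> a"
      using arr D[OF o] N[OF o] eq r(1-3) r(4)[OF o] w(4)[OF o] by (simp add: v(6)[OF o, THEN reassoc])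
  qed (use arr r ab in simp_all)
  moreover have "ms \<cdot> r = b"
  proof (rule matching_object_eq[OF u(1) fnc(3)])
    fix f assume o: "f \<in> out x"
    show "d f \<cdot> (ms \<cdot> r) = d f \<cdot> b"
      using arr D[OF o] N[OF o] eq r(1-3) r(4)[OF o] w(5)[OF o] by (simp add: s(6)[OF o, THEN reassoc])
  qed (use arr r ab in simp_all)
  ultimately show "\<exists>u. u \<in> Arr C \<and> Dom C u = Z \<and> Cod C u = Dom C mv \<and> mv \<cdot> u = a \<and> ms \<cdot> u = b"
    using r arr by auto
next
  note q = lim_mapD[OF mq] and u = lim_mapD[OF mu] and v = lim_mapD[OF mv] and s = lim_mapD[OF ms]
  note arr = q(3-5) u(3-5) v(3-5) s(3-5)
  note D = matching_objectD(2-4)[OF q(1)] matching_objectD(2-4)[OF q(2)]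
    matching_objectD(2-4)[OF u(1)] matching_objectD(2-4)[OF v(1)]
  note N = nat_atD(1-3)[OF nat(1)[OF out_prec]] nat_atD(1-3)[OF nat(2)[OF out_prec]]
  fix Z a b
  assume ab: "a \<in> Arr C" "b \<in> Arr C" "Dom C a = Z" "Dom C b = Z" "Cod C a = Dom C mv" "Cod C b = Dom C mv"
    "mv \<cdot> a = mv \<cdot> b" "ms \<cdot> a = ms \<cdot> b"
  show "a = b"
  proof (rule matching_object_eq[OF v(1) fnc(4)])
    fix f assume o: "f \<in> out x"
    show "e f \<cdot> a = e f \<cdot> b"
    proof (rule pullback_eq[OF pb[OF out_prec[OF o]]])
      have "c' f \<cdot> (mv \<cdot> a) = c' f \<cdot> (mv \<cdot> b)" "d f \<cdot> (ms \<cdot> a) = d f \<cdot> (ms \<cdot> b)" using ab by simp_all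
      then show "At v (Cod I f) \<cdot> (e f \<cdot> a) = At v (Cod I f) \<cdot> (e f \<cdot> b)"
        "At s (Cod I f) \<cdot> (e f \<cdot> a) = At s (Cod I f) \<cdot> (e f \<cdot> b)"
        using arr D[OF o] N[OF o] eq ab(1-6)
        by (simp_all add: v(6)[OF o, THEN reassoc] s(6)[OF o, THEN reassoc])
    qed (use arr D[OF o] N[OF o] eq ab(1-6) in simp_all)
  qed (use arr ab in simp_all)
qed

text \<open>The strict coslice under \<open>f\<close> inside the strict coslice under
  \<open>x\<close> is the strict coslice of \<open>I\<close> under \<open>Cod I f\<close>. The Reedy
  conditions in admissibility concern diagrams on a strict coslice, so their matching objects are
  limits over this iterated one.\<close>

lemma Obj_double_coslice:
  assumes f: "f \<in> out x"
  shows "Obj (strict_coslice (strict_coslice I x) f) = (\<lambda>h. (f, h, h \<cdot>\<^bsub>I\<^esub> f)) ` out (Cod I f)" (is "?l = ?r")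
proof (intro equalityI subsetI)
  fix k assume "k \<in> ?l"
  then have k: "k \<in> Arr (strict_coslice I x)" "Dom (strict_coslice I x) k = f" "k \<noteq> (f, Ident I (Cod I f), f)"
    by (simp_all add: Obj_strict_coslice)
  obtain f' h g where kk: "k = (f', h, g)" by (cases k)
  then have h: "f' = f" "h \<in> Arr I" "Dom I h = Cod I f" "g = h \<cdot>\<^bsub>I\<^esub> f"
    using k(1,2) by (auto simp: I.in_hom)
  have "h \<noteq> Ident I (Cod I f)"
  proof
    assume "h = Ident I (Cod I f)"
    then show False using k(3) kk h outD[OF f] by simp
  qed
  then show "k \<in> ?r" using kk h by (intro image_eqI[of _ _ h]) (simp_all add: Obj_strict_coslice)
next
  fix k assume "k \<in> ?r"
  then obtain h where h: "k = (f, h, h \<cdot>\<^bsub>I\<^esub> f)" "h \<in> out (Cod I f)" by auto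
  note h' = outD[OF h(2)]
  have "h \<noteq> Ident I (Cod I f)" using h(2) unfolding Obj_strict_coslice by simp
  then show "k \<in> ?l" using h(1) h' f outD[OF f] out_comp[OF f h']
    by (simp add: Obj_strict_coslice[of _ "strict_coslice I x"] I.in_hom)
qed

text \<open>Arrows correspond as well as objects: a factorization of \<open>h'\<close> through
  \<open>h\<close> gives one after composition with \<open>f\<close>, and conversely equality of
  composites in the coslice compares middle components, which returns the factorization in
  \<open>I\<close>.\<close>

lemma double_coslice_cone_iff:
  assumes f: "f \<in> out x"
  shows "is_cone (strict_coslice (strict_coslice I x) f) C (under_diagram (strict_coslice I x) f (under_diagram I x A)) L c
     \<longleftrightarrow> is_cone (strict_coslice I (Cod I f)) C (under_diagram I (Cod I f) A) L (\<lambda>h. c (f, h, h \<cdot>\<^bsub>I\<^esub> f))"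
proof -
  have 1: "OMap (under_diagram I x A) (h \<cdot>\<^bsub>I\<^esub> f) = OMap A (Cod I h)" if "h \<in> out (Cod I f)" for h
    using out_comp[OF f outD[OF that]] outD[OF that] outD[OF f] by (simp add: under_diagram_def)
  have 2: "(\<forall>k \<in> hom (strict_coslice I x) (Cod (strict_coslice I x) (f, h, h \<cdot>\<^bsub>I\<^esub> f))
          (Cod (strict_coslice I x) (f, h', h' \<cdot>\<^bsub>I\<^esub> f)).
        k \<cdot>\<^bsub>strict_coslice I x\<^esub> (f, h, h \<cdot>\<^bsub>I\<^esub> f) = (f, h', h' \<cdot>\<^bsub>I\<^esub> f)
          \<longrightarrow> AMap (under_diagram I x A) k \<cdot> d = e) \<longleftrightarrow>
      (\<forall>k \<in> hom I (Cod I h) (Cod I h'). k \<cdot>\<^bsub>I\<^esub> h = h' \<longrightarrow> AMap A k \<cdot> d = e)" (is "?a = ?b")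
    if h: "h \<in> out (Cod I f)" and h': "h' \<in> out (Cod I f)" for h h' d e
  proof
    note H = outD[OF h] outD[OF h'] outD[OF f] out_comp[OF f outD[OF h]] out_comp[OF f outD[OF h']]
    {
      assume a: ?a
      show ?b
      proof (intro ballI impI)
        fix k assume k: "k \<in> hom I (Cod I h) (Cod I h')" "k \<cdot>\<^bsub>I\<^esub> h = h'"
        have e: "k \<cdot>\<^bsub>I\<^esub> (h \<cdot>\<^bsub>I\<^esub> f) = h' \<cdot>\<^bsub>I\<^esub> f"
          using k H by (simp add: I.in_hom I.reassoc[OF k(2)])
        have m: "(h \<cdot>\<^bsub>I\<^esub> f, k, h' \<cdot>\<^bsub>I\<^esub> f) \<in> Arr (strict_coslice I x)"
          using k H e by (simp add: I.in_hom)
        then have "AMap (under_diagram I x A) (h \<cdot>\<^bsub>I\<^esub> f, k, h' \<cdot>\<^bsub>I\<^esub> f) \<cdot> d = e"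
          using a[rule_format, of "(h \<cdot>\<^bsub>I\<^esub> f, k, h' \<cdot>\<^bsub>I\<^esub> f)"] k by (simp add: hom_def[of "strict_coslice I x"])
        then show "AMap A k \<cdot> d = e" using m by (simp add: under_diagram_def)
      qed
    }
    {
      assume b: ?b
      show ?a
      proof (intro ballI impI)
        fix k assume k: "k \<in> hom (strict_coslice I x) (Cod (strict_coslice I x) (f, h, h \<cdot>\<^bsub>I\<^esub> f))
            (Cod (strict_coslice I x) (f, h', h' \<cdot>\<^bsub>I\<^esub> f))"
          "k \<cdot>\<^bsub>strict_coslice I x\<^esub> (f, h, h \<cdot>\<^bsub>I\<^esub> f) = (f, h', h' \<cdot>\<^bsub>I\<^esub> f)"
        obtain r l s where kk: "k = (r, l, s)" by (cases k)
        have l: "r = h \<cdot>\<^bsub>I\<^esub> f" "s = h' \<cdot>\<^bsub>I\<^esub> f" "l \<cdot>\<^bsub>I\<^esub> h = h'"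
          using k unfolding kk hom_def[of "strict_coslice I x"] by (simp_all del: strict_coslice_simps(1))
        have m: "(r, l, s) \<in> Arr (strict_coslice I x)"
          using k(1) unfolding kk hom_def[of "strict_coslice I x"] mem_Collect_eq by (elim conjE)
        then have "l \<in> hom I (Cod I h) (Cod I h')"
          using H l(1,2) by (simp add: I.in_hom)
        then have "AMap A l \<cdot> d = e" using b l(3) by simp
        then show "AMap (under_diagram I x A) k \<cdot> d = e"
          using m kk by (simp add: under_diagram_def del: strict_coslice_simps(1))
      qed
    }
  qed
  show ?thesis
    unfolding under_diagram_cone_iff[of "strict_coslice I x"] under_diagram_cone_iff[of I]
      Obj_double_coslice[OF f] ball_simps(9)
    using 1 2 by (simp cong: ball_cong)
qed

text \<open>The cones are the same up to reindexing, hence so is the limit;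
  \<open>fst (snd k)\<close> recovers the arrow of \<open>I\<close> from an object of the iterated
  coslice.\<close>

lemma double_coslice_limit:
  assumes f: "f \<in> out x" and M: "is_matching_object I C A (Cod I f) M c"
  shows "is_matching_object (strict_coslice I x) C (under_diagram I x A) f M (\<lambda>k. c (fst (snd k)))"
  unfolding is_matching_object_def is_limit_def double_coslice_cone_iff[OF f] Obj_double_coslice[OF f] ball_simps(9)
  using M unfolding is_matching_object_def is_limit_def by simp

section \<open>Restriction of diagrams and transformations to a strict coslice\<close>

lemma under_diagram_functor:
  assumes A: "\<And>y. prec y x \<Longrightarrow> fun_at A y"
  shows "is_functor (strict_coslice I x) C (under_diagram I x A)"
proof -
  let ?J = "strict_coslice I x"
  have ar: "AMap (under_diagram I x A) (f, h, g) = AMap A h" "f \<in> out x" "h \<in> Arr I" "Dom I h = Cod I f"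
    "Cod I g = Cod I h" "g \<in> out x" "h \<cdot>\<^bsub>I\<^esub> f = g"
    if "(f, h, g) \<in> Arr ?J" for f h g
    using that by (simp add: under_diagram_def) (use that in \<open>simp_all add: I.in_hom\<close>)
  have ob: "OMap (under_diagram I x A) f = OMap A (Cod I f)" if "f \<in> out x" for f
    using that by (simp add: under_diagram_def)
  note D = fun_atD[OF A[OF out_prec[OF ar(2)]]]
  show ?thesis
    unfolding is_functor_def PiE_def
  proof (intro conjI ballI IntI impI)
    show "OMap (under_diagram I x A) \<in> Obj ?J \<rightarrow> Obj C"
      using fun_atD(1)[OF A[OF out_prec]] by (simp add: under_diagram_def)
    show "AMap (under_diagram I x A) \<in> Arr ?J \<rightarrow> Arr C"
    proof
      fix k assume k: "k \<in> Arr ?J"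
      obtain f h g where kk: "k = (f, h, g)" by (cases k)
      note k = k[unfolded kk]
      show "AMap (under_diagram I x A) k \<in> Arr C"
        unfolding kk ar(1)[OF k] by (rule D(3)[OF k ar(3,4)[OF k]])
    qed
    fix k assume k: "k \<in> Arr ?J"
    obtain f h g where kk: "k = (f, h, g)" by (cases k)
    note k = k[unfolded kk]
    show "AMap (under_diagram I x A) k \<in> hom C (OMap (under_diagram I x A) (Dom ?J k)) (OMap (under_diagram I x A) (Cod ?J k))"
      unfolding kk ar(1)[OF k] strict_coslice_simps ob[OF ar(2)[OF k]] ob[OF ar(6)[OF k]] in_hom
      using D(3-5)[OF k ar(3,4)[OF k]] ar(5)[OF k] by simp
    fix k' assume k': "k' \<in> Arr ?J" and c: "Cod ?J k = Dom ?J k'"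
    obtain f' h' g' where kk': "k' = (f', h', g')" by (cases k')
    have g: "f' = g" using c kk kk' by simp
    note k' = k'[unfolded kk' g]
    note a = ar[OF k] and a' = ar[OF k'] and o = outD[OF ar(2)[OF k]]
    have m: "(f, h' \<cdot>\<^bsub>I\<^esub> h, g') \<in> Arr ?J"
      using a(2-5) a'(2-6) a'(7)[symmetric] a(7)[symmetric] o by (simp add: I.in_hom)
    show "AMap (under_diagram I x A) (k' \<cdot>\<^bsub>?J\<^esub> k) = AMap (under_diagram I x A) k' \<cdot> AMap (under_diagram I x A) k"
      unfolding kk kk' g strict_coslice_simps a(1) a'(1) ar(1)[OF m]
      using D(6)[OF k, of h h'] a(3-5) a'(3,4) by simp
  next
    fix f assume f: "f \<in> Obj ?J"
    have m: "(f, Ident I (Cod I f), f) \<in> Arr ?J" using f outD[OF f] by (simp add: I.in_hom)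
    show "AMap (under_diagram I x A) (Ident ?J f) = Ident C (OMap (under_diagram I x A) f)"
      unfolding strict_coslice_simps ob[OF f] ar(1)[OF m] by (rule fun_atD(2)[OF A[OF out_prec[OF f]]])
  qed (simp_all add: under_diagram_def)
qed

lemma under_transf_natural:
  assumes A: "\<And>y. prec y x \<Longrightarrow> fun_at (Src t) y" and B: "\<And>y. prec y x \<Longrightarrow> fun_at (Tgt t) y"
    and t: "\<And>y. prec y x \<Longrightarrow> nat_at t y"
  shows "is_natural (strict_coslice I x) C (under_transf I x t)"
proof -
  let ?J = "strict_coslice I x"
  have T: "f \<in> out x \<Longrightarrow> nat_at t (Cod I f)" for f by (rule t[OF out_prec])
  show ?thesis
    unfolding is_natural_def PiE_def
  proof (intro conjI ballI IntI)
    show "is_functor ?J C (Src (under_transf I x t))" "is_functor ?J C (Tgt (under_transf I x t))"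
      using under_diagram_functor[OF A] under_diagram_functor[OF B] by (simp_all add: under_transf_def)
    show "At (under_transf I x t) \<in> Obj ?J \<rightarrow> Arr C" using nat_atD(1)[OF T] by (simp add: under_transf_def)
    show "At (under_transf I x t) f \<in> hom C (OMap (Src (under_transf I x t)) f) (OMap (Tgt (under_transf I x t)) f)"
      if "f \<in> Obj ?J" for f
      using nat_atD(1-3)[OF T[OF that]] that by (simp add: under_transf_def under_diagram_def in_hom)
    fix k assume k: "k \<in> Arr ?J"
    obtain f h g where kk: "k = (f, h, g)" by (cases k)
    have h: "h \<in> Arr I" "Dom I h = Cod I f" "f \<in> out x" "g \<in> out x" "Cod I g = Cod I h"
      using k unfolding kk by (simp_all add: I.in_hom)
    show "At (under_transf I x t) (Cod ?J k) \<cdot> AMap (Src (under_transf I x t)) k =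
        AMap (Tgt (under_transf I x t)) k \<cdot> At (under_transf I x t) (Dom ?J k)"
      using k h nat_atD(4)[OF T[OF h(3)] h(1,2)] unfolding kk by (simp add: under_transf_def under_diagram_def)
  qed (simp add: under_transf_def)
qed

lemma double_coslice_matching_map:
  assumes f: "f \<in> out x" and M: "is_matching_map I C A (Cod I f) M c k"
  shows "is_matching_map (strict_coslice I x) C (under_diagram I x A) f M (\<lambda>k. c (fst (snd k))) k"
proof -
  have "AMap (under_diagram I x A) (f, h, h \<cdot>\<^bsub>I\<^esub> f) = AMap A h" if "h \<in> out (Cod I f)" for h
    using out_comp[OF f outD[OF that]] outD[OF that] outD[OF f] f by (simp add: under_diagram_def I.in_hom)
  then show ?thesis
    using double_coslice_limit[OF f matching_mapD(1)[OF M]] matching_mapD(2-5)[OF M] f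
    unfolding is_matching_map_def Obj_double_coslice[OF f] ball_simps(9) in_hom
    by (simp add: under_diagram_def)
qed

lemma double_coslice_lim_map:
  assumes f: "f \<in> out x" and M: "lim_at t (Cod I f) M c N d m"
  shows "is_lim_map (strict_coslice (strict_coslice I x) f) C (under_transf (strict_coslice I x) f (under_transf I x t))
    M (\<lambda>k. c (fst (snd k))) N (\<lambda>k. d (fst (snd k))) m"
proof -
  have "h \<cdot>\<^bsub>I\<^esub> f \<in> out x \<and> Cod I (h \<cdot>\<^bsub>I\<^esub> f) = Cod I h" if "h \<in> out (Cod I f)" for h
    using out_comp[OF f outD[OF that]] outD[OF that] outD[OF f] by simp
  then show ?thesis
    using double_coslice_limit[OF f lim_mapD(1)[OF M]] double_coslice_limit[OF f lim_mapD(2)[OF M]]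
        lim_mapD(3-6)[OF M]
    unfolding is_lim_map_def is_matching_object_def in_hom
    by (simp add: under_transf_def Obj_double_coslice[OF f])
qed

text \<open>Every ingredient of a gap map transfers to the restricted transformation with the same
  arrows, so smallness of gap maps below \<open>x\<close> becomes smallness over the strict
  coslice.\<close>

lemma double_coslice_relative_matching_map:
  assumes f: "f \<in> out x" and k: "is_relative_matching_map I C t (Cod I f) k"
  shows "is_relative_matching_map (strict_coslice I x) C (under_transf I x t) f k"
proof -
  obtain M c N d m kA kB p1 p2 where
    *: "lim_at t (Cod I f) M c N d m" "is_matching_map I C (Src t) (Cod I f) M c kA"
      "is_matching_map I C (Tgt t) (Cod I f) N d kB" "is_pullback C m kB p1 p2"
      "k \<in> hom C (OMap (Src t) (Cod I f)) (Dom C p1)" "p1 \<cdot> k = kA" "p2 \<cdot> k = At t (Cod I f)"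
    using k unfolding is_relative_matching_map_def by metis
  have e: "Src (under_transf I x t) = under_diagram I x (Src t)"
      "Tgt (under_transf I x t) = under_diagram I x (Tgt t)"
      "At (under_transf I x t) f = At t (Cod I f)"
      "OMap (under_diagram I x (Src t)) f = OMap (Src t) (Cod I f)"
    using f by (simp_all add: under_transf_def under_diagram_def)
  show ?thesis
    unfolding is_relative_matching_map_def e
    using double_coslice_lim_map[OF f *(1)] double_coslice_matching_map[OF f *(2)]
      double_coslice_matching_map[OF f *(3)] *(4-7) by metis
qed

text \<open>The recursions require that each local condition at \<open>x\<close> depends on a diagram only through its
  values at \<open>x\<close> and at the objects below \<open>x\<close>.\<close>

definition agree :: "('i, 'j, 'o, 'a) diagram \<Rightarrow> ('i, 'j, 'o, 'a) diagram \<Rightarrow> 'i \<Rightarrow> bool" where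
  "agree A B y \<longleftrightarrow> OMap A y = OMap B y \<and> (\<forall>f \<in> Arr I. Dom I f = y \<longrightarrow> AMap A f = AMap B f)"

lemma agree_sym: "agree A B y \<Longrightarrow> agree B A y"
  by (simp add: agree_def)

lemma fun_at_cong:
  assumes "\<And>y. prec y x \<or> y = x \<Longrightarrow> agree A B y" "x \<in> Obj I" "fun_at A x"
  shows "fun_at B x"
proof -
  have e: "OMap A (Cod I f) = OMap B (Cod I f)" "(\<And>g. \<lbrakk>g \<in> Arr I; Dom I g = Cod I f\<rbrakk> \<Longrightarrow> AMap A g = AMap B g)"
    if "f \<in> Arr I" "Dom I f = x" for f
  proof -
    have "prec (Cod I f) x \<or> Cod I f = x"
      using that assms(2) out_prec[of f x] by (cases "f = Ident I x") (simp_all add: Obj_strict_coslice)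
    from assms(1)[OF this] show "OMap A (Cod I f) = OMap B (Cod I f)"
      "(\<And>g. \<lbrakk>g \<in> Arr I; Dom I g = Cod I f\<rbrakk> \<Longrightarrow> AMap A g = AMap B g)" by (simp_all add: agree_def)
  qed
  have x: "OMap A x = OMap B x" "\<And>f. \<lbrakk>f \<in> Arr I; Dom I f = x\<rbrakk> \<Longrightarrow> AMap A f = AMap B f"
    using assms(1)[of x] by (simp_all add: agree_def)
  show ?thesis
    using assms(2) fun_atD(1-5)[OF assms(3)] e x fun_atD(6)[OF assms(3)] unfolding fun_at_def in_hom
    by simp
qed

lemma under_diagram_cong:
  assumes "\<And>y. prec y x \<Longrightarrow> agree A B y"
  shows "under_diagram I x A = under_diagram I x B"
proof -
  have "AMap A (fst (snd k)) = AMap B (fst (snd k))" if "k \<in> Arr (strict_coslice I x)" for k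
  proof -
    obtain f h g where kk: "k = (f, h, g)" by (cases k)
    show ?thesis using that assms[OF out_prec[of f x]] unfolding kk by (simp add: I.in_hom agree_def)
  qed
  moreover have "OMap A (Cod I f) = OMap B (Cod I f)" if "f \<in> out x" for f
    using assms[OF out_prec[OF that]] by (simp add: agree_def)
  ultimately show ?thesis unfolding under_diagram_def by (simp cong: restrict_cong)
qed

lemma matching_map_cong:
  assumes "\<And>y. prec y x \<or> y = x \<Longrightarrow> agree A B y" "is_matching_map I C A x M c k"
  shows "is_matching_map I C B x M c k"
proof -
  have "AMap A f = AMap B f" if "f \<in> out x" for f
    using assms(1)[of x] outD[OF that] by (simp add: agree_def)
  moreover have "under_diagram I x A = under_diagram I x B" using assms(1) by (intro under_diagram_cong) simp
  moreover have "OMap A x = OMap B x" using assms(1)[of x] by (simp add: agree_def)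
  ultimately show ?thesis
    using assms(2) unfolding is_matching_map_def is_matching_object_def by simp
qed

lemma lim_at_cong:
  assumes "\<And>y. prec y x \<Longrightarrow> agree (Src t) (Src s) y" "\<And>y. prec y x \<Longrightarrow> agree (Tgt t) (Tgt s) y"
    "\<And>y. prec y x \<Longrightarrow> At t y = At s y"
  shows "lim_at t x = lim_at s x"
proof -
  have "under_transf I x t = under_transf I x s"
    unfolding under_transf_def using under_diagram_cong[OF assms(1)] under_diagram_cong[OF assms(2)]
      assms(3)[OF out_prec] by (simp cong: restrict_cong)
  then show ?thesis by simp
qed

lemma nat_at_cong:
  assumes "\<And>y. prec y x \<or> y = x \<Longrightarrow> agree (Src t) (Src s) y" "\<And>y. prec y x \<or> y = x \<Longrightarrow> agree (Tgt t) (Tgt s) y"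
    "\<And>y. prec y x \<or> y = x \<Longrightarrow> At t y = At s y" "x \<in> Obj I" "nat_at t x"
  shows "nat_at s x"
proof -
  have e: "At t (Cod I f) = At s (Cod I f)" if "f \<in> Arr I" "Dom I f = x" for f
    using that assms(3,4) out_prec[of f x] by (cases "f = Ident I x") (simp_all add: Obj_strict_coslice)
  have "agree (Src t) (Src s) x" "agree (Tgt t) (Tgt s) x" "At t x = At s x" using assms(1-3)[of x] by simp_all
  then show ?thesis using e assms(5) unfolding nat_at_def by (simp add: agree_def)
qed

text \<open>The arrow data are indexed by the domain: \<open>a x\<close> is consulted only on arrows
  out of \<open>x\<close>. Changing the raw data at one object therefore leaves the arrows out of
  all other objects untouched.\<close>

definition mk_dia :: "('i \<Rightarrow> 'o) \<Rightarrow> ('i \<Rightarrow> 'j \<Rightarrow> 'a) \<Rightarrow> ('i, 'j, 'o, 'a) diagram" where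
  "mk_dia X a = \<lparr>OMap = (\<lambda>x \<in> Obj I. X x), AMap = (\<lambda>f \<in> Arr I. a (Dom I f) f)\<rparr>"

definition mk_tr :: "('i, 'j, 'o, 'a) diagram \<Rightarrow> ('i, 'j, 'o, 'a) diagram \<Rightarrow> ('i \<Rightarrow> 'a) \<Rightarrow> ('i, 'j, 'o, 'a) transf" where
  "mk_tr A B t = \<lparr>Src = A, Tgt = B, At = (\<lambda>x \<in> Obj I. t x)\<rparr>"

lemma mk_dia_simps [simp]:
  "x \<in> Obj I \<Longrightarrow> OMap (mk_dia X a) x = X x"
  "f \<in> Arr I \<Longrightarrow> AMap (mk_dia X a) f = a (Dom I f) f"
  by (simp_all add: mk_dia_def)

lemma mk_tr_simps [simp]:
  "Src (mk_tr A B t) = A" "Tgt (mk_tr A B t) = B" "x \<in> Obj I \<Longrightarrow> At (mk_tr A B t) x = t x"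
  by (simp_all add: mk_tr_def)

lemma mk_dia_agree: "\<lbrakk>X y = X' y; a y = a' y; y \<in> Obj I\<rbrakk> \<Longrightarrow> agree (mk_dia X a) (mk_dia X' a') y"
  by (simp add: agree_def)

lemma mk_dia_functor: "(\<And>x. x \<in> Obj I \<Longrightarrow> fun_at (mk_dia X a) x) \<Longrightarrow> is_functor I C (mk_dia X a)"
  unfolding is_functor_iff by (simp add: mk_dia_def)

lemma mk_tr_natural:
  "\<lbrakk>is_functor I C A; is_functor I C B; \<And>x. x \<in> Obj I \<Longrightarrow> nat_at (mk_tr A B t) x\<rbrakk>
    \<Longrightarrow> is_natural I C (mk_tr A B t)"
  unfolding is_natural_iff by (simp add: mk_tr_def)

end

section \<open>Reedy small fibrations\<close>

locale reedy_universe = tt_fibration_category C F + inverse_diagrams C I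
  for C :: "('o, 'a) cat_data" (structure) and F :: "'a set" and I :: "('i, 'j) cat_data" +
  fixes p :: 'a
  assumes univ: "universe C F p" and adm: "admissible_for_universe I C F p"
begin

section \<open>Small fibrations of \<open>C\<close> and independence of choices\<close>

abbreviation S :: "'a set" where "S \<equiv> small_fibrations C p"

lemma small_arr: "s \<in> S \<Longrightarrow> s \<in> Arr C"
  unfolding small_fibrations_def using pullbackD(4) by blast

lemma small_fib: "s \<in> S \<Longrightarrow> s \<in> F"
  using univ fib_pullback unfolding small_fibrations_def universe_def by blast

lemma F_arr: "s \<in> F \<Longrightarrow> s \<in> Arr C"
  using fib_arr by blast

lemma small_pullback: "\<lbrakk>s \<in> S; is_pullback C s g a b\<rbrakk> \<Longrightarrow> b \<in> S"
  unfolding small_fibrations_def using pullback_paste by blast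

lemma p_pullback: "s \<in> S \<Longrightarrow> \<exists>u v. is_pullback C p u v s"
  unfolding small_fibrations_def by blast

lemma p_fib: "p \<in> F"
  using univ unfolding universe_def by blast

lemma small_comp: "\<lbrakk>f \<in> S; g \<in> S; Cod C f = Dom C g\<rbrakk> \<Longrightarrow> g \<cdot> f \<in> S"
  using univ unfolding universe_def by blast

lemma small_ident: "x \<in> Obj C \<Longrightarrow> Ident C x \<in> S"
  using univ unfolding universe_def by blast

lemma small_iso: "is_iso C f \<Longrightarrow> f \<in> S"
  using small_pullback[OF small_ident pullback_iso] is_isoE[of f] cod_obj by metis

lemma fib_pullbackE:
  assumes "f \<in> F" "g \<in> Arr C" "Cod C f = Cod C g"
  obtains a b where "is_pullback C f g a b"
  using fib_pullback_exists[OF assms] by blast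

definition fib_at :: "('i, 'j, 'o, 'a) diagram \<Rightarrow> 'i \<Rightarrow> bool" where
  "fib_at A x \<longleftrightarrow> (\<exists>M c k. is_matching_map I C A x M c k \<and> k \<in> F)"

definition obj_at :: "('i, 'j, 'o, 'a) diagram \<Rightarrow> 'i \<Rightarrow> bool" where
  "obj_at A x \<longleftrightarrow> fun_at A x \<and> fib_at A x"

definition rs_at :: "('i, 'j, 'o, 'a) transf \<Rightarrow> 'i \<Rightarrow> bool" where
  "rs_at t x \<longleftrightarrow> nat_at t x \<and> (\<exists>k. is_relative_matching_map I C t x k \<and> k \<in> S)"

lemma obj_fun: "obj_at A x \<Longrightarrow> fun_at A x"
  by (simp add: obj_at_def)

lemma rs_nat: "rs_at t x \<Longrightarrow> nat_at t x"
  by (simp add: rs_at_def)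

lemma matching_map_unique:
  assumes M: "is_matching_map I C A x M c k" and M': "is_matching_map I C A x N d l"
    and A: "\<And>y. prec y x \<Longrightarrow> fun_at A y"
    and a: "a \<in> Arr C" "Dom C a = M" "Cod C a = N" "\<And>f. f \<in> out x \<Longrightarrow> d f \<cdot> a = c f"
  shows "l = a \<cdot> k"
proof (rule matching_object_eq[OF matching_mapD(1)[OF M'] A])
  note k = matching_mapD[OF M] and l = matching_mapD[OF M']
  fix f assume f: "f \<in> out x"
  show "d f \<cdot> l = d f \<cdot> (a \<cdot> k)"
    using k(2-4) l(2-4) a k(5)[OF f] l(5)[OF f] matching_objectD(2-4)[OF l(1) f] f
    by (simp add: a(4)[OF f, THEN reassoc])
qed (use matching_mapD(2-4)[OF M] matching_mapD(2-4)[OF M'] a in simp_all)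

text \<open>Two matching objects are isomorphic compatibly with their cones, and isomorphisms are
  fibrations. So fibrancy at \<open>x\<close>, stated for some choice, holds for every
  choice.\<close>

lemma matching_map_fib:
  assumes x: "fib_at A x" and A: "\<And>y. prec y x \<Longrightarrow> fun_at A y" and M: "is_matching_map I C A x M c k"
  shows "k \<in> F"
proof -
  obtain M' c' k' where 1: "is_matching_map I C A x M' c' k'" "k' \<in> F"
    using x unfolding fib_at_def by blast
  obtain a where a: "is_iso C a" "Dom C a = M'" "Cod C a = M" "\<And>f. f \<in> out x \<Longrightarrow> c f \<cdot> a = c' f"
    using matching_object_iso[OF matching_mapD(1)[OF 1(1)] matching_mapD(1)[OF M] A] by metis
  have "k = a \<cdot> k'" by (rule matching_map_unique[OF 1(1) M A]) (use a fib_iso[OF a(1)] F_arr in simp_all)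
  then show ?thesis using fib_comp[OF 1(2) fib_iso[OF a(1)]] a matching_mapD(4)[OF 1(1)] by simp
qed

text \<open>Makes admissibility applicable to a diagram that is known to be Reedy fibrant only below
  \<open>x\<close>; this is the source of all matching objects in the recursions.\<close>

lemma under_reedy_fibrant:
  assumes A: "\<And>y. prec y x \<Longrightarrow> obj_at A y"
  shows "reedy_fibrant (strict_coslice I x) C F (under_diagram I x A)"
  unfolding reedy_fibrant_def
proof (intro conjI ballI)
  show "is_functor (strict_coslice I x) C (under_diagram I x A)"
    using under_diagram_functor obj_fun[OF A] by blast
  fix f assume f: "f \<in> out x"
  obtain M c k where "is_matching_map I C A (Cod I f) M c k" "k \<in> F"
    using A[OF out_prec[OF f]] unfolding obj_at_def fib_at_def by blast
  then show "\<exists>M c k. is_matching_map (strict_coslice I x) C (under_diagram I x A) f M c k \<and> k \<in> F"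
    using double_coslice_matching_map[OF f] by blast
qed

lemma matching_object_exists:
  assumes x: "x \<in> Obj I" and A: "\<And>y. prec y x \<Longrightarrow> obj_at A y"
  obtains M c where "is_matching_object I C A x M c"
proof -
  have "has_reedy_limits (strict_coslice I x) C F"
    using adm x unfolding admissible_for_universe_def admissible_def by blast
  then show thesis using that under_reedy_fibrant[OF A]
    unfolding has_reedy_limits_def is_matching_object_def by metis
qed

text \<open>The restriction to the strict coslice is a Reedy small fibration there, so the clause of
  admissibility that concerns the universe applies. It makes dependent products along
  \<open>m\<close> available and the projection from the gap object small.\<close>

lemma lim_map_small:
  assumes x: "x \<in> Obj I" and A: "\<And>y. prec y x \<Longrightarrow> obj_at (Src t) y" "\<And>y. prec y x \<Longrightarrow> obj_at (Tgt t) y"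
    and t: "\<And>y. prec y x \<Longrightarrow> rs_at t y" and m: "lim_at t x M c N d m"
  shows "m \<in> S"
proof -
  let ?J = "strict_coslice I x" and ?t = "under_transf I x t"
  have n: "is_natural ?J C ?t"
    by (rule under_transf_natural) (use A obj_fun t rs_nat in blast)+
  have "reedy_class ?J C S ?t"
    unfolding reedy_class_def
  proof (intro conjI n ballI)
    fix f assume f: "f \<in> out x"
    then show "\<exists>k. is_relative_matching_map ?J C ?t f k \<and> k \<in> S"
      using double_coslice_relative_matching_map[OF f] t[OF out_prec[OF f]] unfolding rs_at_def by blast
  qed
  moreover have "?t \<in> Arr (reedy_category ?J C F)"
    using n under_reedy_fibrant[OF A(1)] under_reedy_fibrant[OF A(2)]
    by (simp add: reedy_category_def full_subcategory_def functor_category_def under_transf_def)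
  ultimately have "?t \<in> reedy_small_fibrations ?J C F p" unfolding reedy_small_fibrations_def by simp
  then show ?thesis using adm x m unfolding admissible_for_universe_def by blast
qed

text \<open>\<open>Dom C g1\<close> is the gap object, with \<open>g1\<close> to the matching object
  of the source and \<open>g2\<close> to the value of the target. The source and the transformation
  enter only below \<open>x\<close>, so the square exists before the source has a value at
  \<open>x\<close>.\<close>

definition gap_square where
  "gap_square t x M c N d m kB g1 g2 \<longleftrightarrow> lim_at t x M c N d m \<and>
     is_matching_map I C (Tgt t) x N d kB \<and> is_pullback C m kB g1 g2"

definition gap_map where
  "gap_map t x M c N d m kA kB g1 g2 k \<longleftrightarrow> gap_square t x M c N d m kB g1 g2 \<and>
     is_matching_map I C (Src t) x M c kA \<and> k \<in> Arr C \<and> Dom C k = OMap (Src t) x \<and> Cod C k = Dom C g1 \<and>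
     g1 \<cdot> k = kA \<and> g2 \<cdot> k = At t x"

lemma relative_matching_map_iff:
  "is_relative_matching_map I C t x k \<longleftrightarrow> (\<exists>M c N d m kA kB g1 g2. gap_map t x M c N d m kA kB g1 g2 k)"
  unfolding is_relative_matching_map_def gap_map_def gap_square_def in_hom
  by (rule iffI; elim exE conjE) (intro exI conjI, assumption+)+

lemma gap_squareE:
  assumes x: "x \<in> Obj I" and A: "\<And>y. prec y x \<Longrightarrow> obj_at (Src t) y"
    and B: "\<And>y. prec y x \<or> y = x \<Longrightarrow> obj_at (Tgt t) y"
    and t: "\<And>y. prec y x \<Longrightarrow> nat_at t y"
  obtains M c N d m kB g1 g2 where "gap_square t x M c N d m kB g1 g2" "kB \<in> F" "g1 \<in> F"
proof -
  have Bx: "obj_at (Tgt t) x" and B': "\<And>y. prec y x \<Longrightarrow> obj_at (Tgt t) y" using B by simp_all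
  obtain M c where M: "is_matching_object I C (Src t) x M c" by (rule matching_object_exists[OF x A])
  obtain N d where N: "is_matching_object I C (Tgt t) x N d" by (rule matching_object_exists[OF x B'])
  obtain m where m: "lim_at t x M c N d m" by (rule lim_map_exists[OF M N obj_fun[OF A] obj_fun[OF B'] t])
  obtain kB where kB: "is_matching_map I C (Tgt t) x N d kB" by (rule matching_map_exists[OF obj_fun[OF Bx] N])
  have F: "kB \<in> F" by (rule matching_map_fib[OF _ obj_fun[OF B'] kB]) (use Bx in \<open>simp add: obj_at_def\<close>)
  obtain g2 g1 where g: "is_pullback C kB m g2 g1"
    by (rule fib_pullbackE[OF F, of m]) (use lim_mapD(3,5)[OF m] matching_mapD(4)[OF kB] in simp_all)
  show thesis
    by (rule that[of M c N d m kB g1 g2])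
      (use m kB F pullback_swap[OF g] fib_pullback[OF F g] in \<open>simp_all add: gap_square_def\<close>)
qed

lemma gap_squareD:
  assumes "gap_square t x M c N d m kB g1 g2"
  shows "lim_at t x M c N d m" "is_matching_map I C (Tgt t) x N d kB" "is_pullback C m kB g1 g2"
  using assms by (simp_all add: gap_square_def)

lemma gap_mapD:
  assumes "gap_map t x M c N d m kA kB g1 g2 k"
  shows "gap_square t x M c N d m kB g1 g2" "is_matching_map I C (Src t) x M c kA"
    "k \<in> Arr C" "Dom C k = OMap (Src t) x" "Cod C k = Dom C g1" "g1 \<cdot> k = kA" "g2 \<cdot> k = At t x"
  using assms by (simp_all add: gap_map_def)

lemma gap_map_exists:
  assumes A: "fun_at (Src t) x" and B: "\<And>y. prec y x \<Longrightarrow> fun_at (Tgt t) y"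
    and t: "\<And>y. prec y x \<or> y = x \<Longrightarrow> nat_at t y" and g: "gap_square t x M c N d m kB g1 g2"
  obtains kA k where "gap_map t x M c N d m kA kB g1 g2 k"
proof -
  note g' = gap_squareD[OF g] and P = pullbackD[OF gap_squareD(3)[OF g]]
  have tx: "nat_at t x" using t by simp
  obtain kA where kA: "is_matching_map I C (Src t) x M c kA"
    by (rule matching_map_exists[OF A lim_mapD(1)[OF g'(1)]])
  have e: "kB \<cdot> At t x = m \<cdot> kA" by (rule nat_at_matching[OF t B g'(1) kA g'(2)])
  obtain k where "k \<in> Arr C" "Dom C k = OMap (Src t) x" "Cod C k = Dom C g1" "g1 \<cdot> k = kA" "g2 \<cdot> k = At t x"
    by (rule pullback_ex[OF g'(3) _ _ _ _ _ _ e[symmetric], where Z = "OMap (Src t) x"])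
      (use matching_mapD(2-4)[OF kA] matching_mapD(2-4)[OF g'(2)] nat_atD(1-3)[OF tx] lim_mapD(3-5)[OF g'(1)] in simp_all)
  then show thesis using that[of kA k] g kA by (simp add: gap_map_def)
qed

text \<open>The comparison \<open>j\<close> of two gap objects is a pullback of the isomorphism
  \<open>a\<close> between the matching objects of the source, hence small; the given gap map is the
  small one followed by \<open>j\<close>.\<close>

lemma gap_map_small:
  assumes t: "rs_at t x" and A: "\<And>y. prec y x \<Longrightarrow> fun_at (Src t) y" and B: "\<And>y. prec y x \<Longrightarrow> fun_at (Tgt t) y"
    and n: "\<And>y. prec y x \<Longrightarrow> nat_at t y"
    and k: "gap_map t x M c N d m kA kB g1 g2 k"
  shows "k \<in> S"
proof -
  obtain k' where "is_relative_matching_map I C t x k'" and k'S: "k' \<in> S" using t unfolding rs_at_def by blast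
  then obtain M' c' N' d' m' kA' kB' h1 h2 where k': "gap_map t x M' c' N' d' m' kA' kB' h1 h2 k'"
    unfolding relative_matching_map_iff by (elim exE)
  note K = gap_mapD[OF k] and K' = gap_mapD[OF k']
  note G = gap_squareD[OF K(1)] and G' = gap_squareD[OF K'(1)]
  note L = lim_mapD[OF G(1)] and L' = lim_mapD[OF G'(1)]
  note P = pullbackD[OF G(3)] and P' = pullbackD[OF G'(3)]
  obtain a where a: "is_iso C a" "Dom C a = M'" "Cod C a = M" "\<And>f. f \<in> out x \<Longrightarrow> c f \<cdot> a = c' f"
    using matching_object_iso[OF L'(1) L(1) A] by metis
  obtain b where b: "is_iso C b" "Dom C b = N'" "Cod C b = N" "\<And>f. f \<in> out x \<Longrightarrow> d f \<cdot> b = d' f"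
    using matching_object_iso[OF L'(2) L(2) B] by metis
  have ab: "a \<in> Arr C" "b \<in> Arr C" using a b fib_iso F_arr by simp_all
  have kA: "kA = a \<cdot> kA'" by (rule matching_map_unique[OF K'(2) K(2) A]) (use a ab in simp_all)
  have kB: "kB = b \<cdot> kB'" by (rule matching_map_unique[OF G'(2) G(2) B]) (use b ab in simp_all)
  have m: "m \<cdot> a = b \<cdot> m'"
  proof (rule matching_object_eq[OF L(2) B])
    fix f assume f: "f \<in> out x"
    show "d f \<cdot> (m \<cdot> a) = d f \<cdot> (b \<cdot> m')"
      using L(3-5) L'(3-5) ab a(2,3) b(2,3) matching_objectD(2-4)[OF L(2) f] matching_objectD(2-4)[OF L(1) f]
        nat_atD(1-3)[OF n[OF out_prec[OF f]]] a(4)[OF f] L'(6)[OF f]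
      by (simp add: L(6)[OF f, THEN reassoc] b(4)[OF f, THEN reassoc])
  qed (use L(3-5) L'(3-5) ab a(2,3) b(2,3) in simp_all)
  \<comment> \<open>Transported along \<open>b\<close>, the second gap object becomes a pullback of
    \<open>kB\<close> along \<open>m \<cdot> a\<close>; cancelling against the first gap square
    presents \<open>j\<close> as a pullback of \<open>a\<close>.\<close>
  have "is_pullback C (b \<cdot> m') (b \<cdot> kB') h1 h2"
    by (rule pullback_comp_iso[OF G'(3) b(1)]) (use b(2) L'(5) in simp)
  then have 1: "is_pullback C kB (m \<cdot> a) h2 h1" unfolding kB[symmetric] m[symmetric] by (rule pullback_swap)
  note Q = pullbackD[OF 1]
  have e: "m \<cdot> (a \<cdot> h1) = kB \<cdot> h2"
    using Q(9)[symmetric] ab a(2,3) L(3-5) P'(3,7) L'(4) by simp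
  obtain j where j: "j \<in> Arr C" "Dom C j = Dom C h1" "Cod C j = Dom C g1" "g1 \<cdot> j = a \<cdot> h1" "g2 \<cdot> j = h2"
    by (rule pullback_ex[OF G(3) _ _ _ _ _ _ e, where Z = "Dom C h1"])
      (use ab a(2,3) L(3-5) P' L'(3-5) P matching_mapD(3)[OF G(2)] matching_mapD(3)[OF G'(2)] in simp_all)
  have "is_pullback C g1 a j h1"
    by (rule pullback_unpaste[OF pullback_swap[OF G(3)]])
      (use 1 j ab a(2,3) L(3-5) P in simp_all)
  then have jS: "j \<in> S" using small_pullback[OF small_iso[OF a(1)] pullback_swap] by blast
  have "k = j \<cdot> k'"
  proof (rule pullback_eq[OF G(3)])
    show "g1 \<cdot> k = g1 \<cdot> (j \<cdot> k')"
      using K(3-6) K'(3-6) j P P' ab a(2,3) L(3-5) L'(3-5) kA by (simp add: j(4)[THEN reassoc])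
    show "g2 \<cdot> k = g2 \<cdot> (j \<cdot> k')"
      using K(3-7) K'(3-7) j P P' by (simp add: j(5)[THEN reassoc])
  qed (use K(3-5) K'(3-5) j P P' in simp_all)
  then show ?thesis using small_comp[OF k'S jS] K'(5) j(2) by simp
qed

text \<open>The gap map of the extension is \<open>s\<close> itself. Reedy fibrancy of the source at
  \<open>x\<close> follows because its matching map is \<open>g1 \<cdot> s\<close>, where
  \<open>g1\<close> is a pullback of the fibration \<open>kB\<close>.\<close>

lemma rs_extend:
  assumes x: "x \<in> Obj I" and B: "\<And>y. prec y x \<or> y = x \<Longrightarrow> obj_at (Tgt t) y"
    and A: "\<And>y. prec y x \<Longrightarrow> obj_at (Src t) y" and t: "\<And>y. prec y x \<Longrightarrow> nat_at t y"
    and g: "gap_square t x M c N d m kB g1 g2"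
    and s: "s \<in> S" "Cod C s = Dom C g1" "OMap (Src t) x = Dom C s"
      "\<And>f. f \<in> out x \<Longrightarrow> AMap (Src t) f = c f \<cdot> (g1 \<cdot> s)"
      "AMap (Src t) (Ident I x) = Ident C (OMap (Src t) x)"
      "At t x = g2 \<cdot> s"
  shows "obj_at (Src t) x" "rs_at t x" "gap_map t x M c N d m (g1 \<cdot> s) kB g1 g2 s"
proof -
  note G = gap_squareD[OF g]
  note L = lim_mapD[OF G(1)] and P = pullbackD[OF G(3)]
  have Bx: "fun_at (Tgt t) x" "fib_at (Tgt t) x" and B': "\<And>y. prec y x \<Longrightarrow> fun_at (Tgt t) y"
    using B by (simp_all add: obj_at_def)
  note sa = small_arr[OF s(1)]
  note ar = P sa s(2,3) L(3-5)
  have gs: "g1 \<cdot> s \<in> Arr C" "Dom C (g1 \<cdot> s) = OMap (Src t) x" "Cod C (g1 \<cdot> s) = M"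
    using ar by simp_all
  note X = fun_at_extend[OF x obj_fun[OF A] L(1) gs s(4,5)]
  have kB: "kB \<in> F" by (rule matching_map_fib[OF Bx(2) B' G(2)])
  have "g1 \<in> F" by (rule fib_pullback[OF kB pullback_swap[OF G(3)]])
  then have "g1 \<cdot> s \<in> F" using fib_comp[OF small_fib[OF s(1)]] s(2) by simp
  with X show "obj_at (Src t) x" unfolding obj_at_def fib_at_def by blast
  have n: "nat_at t x"
    by (rule nat_at_extend[OF x X(1) Bx(1) G(1) X(2) G(2) _ _ _ t])
      (use ar s(2,3,6) matching_mapD(2-4)[OF G(2)] in \<open>simp_all add: P(9)[THEN reassoc]\<close>)
  show gm: "gap_map t x M c N d m (g1 \<cdot> s) kB g1 g2 s"
    using g X(2) ar s(6) by (simp add: gap_map_def)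
  show "rs_at t x" using n gm s(1) unfolding rs_at_def relative_matching_map_iff by blast
qed

lemma gap_square_small:
  assumes x: "x \<in> Obj I" and A: "\<And>y. prec y x \<Longrightarrow> obj_at (Src t) y" "\<And>y. prec y x \<Longrightarrow> obj_at (Tgt t) y"
    and t: "\<And>y. prec y x \<Longrightarrow> rs_at t y" and g: "gap_square t x M c N d m kB g1 g2"
  shows "m \<in> S" "g2 \<in> S"
proof -
  show m: "m \<in> S" by (rule lim_map_small[OF x A t gap_squareD(1)[OF g]])
  show "g2 \<in> S" by (rule small_pullback[OF m gap_squareD(3)[OF g]])
qed

lemma rs_gap_mapE:
  assumes x: "x \<in> Obj I" and A: "\<And>y. prec y x \<or> y = x \<Longrightarrow> obj_at (Src t) y"
    "\<And>y. prec y x \<or> y = x \<Longrightarrow> obj_at (Tgt t) y"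
    and t: "\<And>y. prec y x \<or> y = x \<Longrightarrow> rs_at t y"
  obtains M c N d m kA kB g1 g2 k where "gap_map t x M c N d m kA kB g1 g2 k"
    "m \<in> S" "kA \<in> F" "kB \<in> F" "g1 \<in> F" "g2 \<in> S" "k \<in> S"
proof -
  have A': "\<And>y. prec y x \<Longrightarrow> obj_at (Src t) y" "\<And>y. prec y x \<Longrightarrow> obj_at (Tgt t) y" "\<And>y. prec y x \<Longrightarrow> rs_at t y"
    "fib_at (Src t) x" "fun_at (Src t) x" "rs_at t x"
    using A t by (simp_all add: obj_at_def)
  obtain M c N d m kB g1 g2 where g: "gap_square t x M c N d m kB g1 g2" "kB \<in> F" "g1 \<in> F"
    by (rule gap_squareE[OF x A'(1) A(2) rs_nat[OF A'(3)]])
  obtain kA k where k: "gap_map t x M c N d m kA kB g1 g2 k"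
    by (rule gap_map_exists[OF A'(5) obj_fun[OF A'(2)] rs_nat[OF t] g(1)])
  have "k \<in> S" by (rule gap_map_small[OF A'(6) obj_fun[OF A'(1)] obj_fun[OF A'(2)] rs_nat[OF A'(3)] k])
  moreover have "kA \<in> F" by (rule matching_map_fib[OF A'(4) obj_fun[OF A'(1)] gap_mapD(2)[OF k]])
  ultimately show thesis using that k g gap_square_small[OF x A'(1-3) g(1)] by blast
qed

text \<open>The component factors as the gap map followed by \<open>g2\<close>, which is small as a
  pullback of the map of matching objects.\<close>

lemma rs_at_small:
  assumes x: "x \<in> Obj I" and A: "\<And>y. prec y x \<or> y = x \<Longrightarrow> obj_at (Src t) y"
    "\<And>y. prec y x \<or> y = x \<Longrightarrow> obj_at (Tgt t) y"
    and t: "\<And>y. prec y x \<or> y = x \<Longrightarrow> rs_at t y"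
  shows "At t x \<in> S"
proof -
  obtain M c N d m kA kB g1 g2 k where k: "gap_map t x M c N d m kA kB g1 g2 k" "g2 \<in> S" "k \<in> S"
    by (rule rs_gap_mapE[OF x A t])
  note P = pullbackD[OF gap_squareD(3)[OF gap_mapD(1)[OF k(1)]]]
  show ?thesis using small_comp[OF k(3,2)] gap_mapD(5,7)[OF k(1)] P by simp
qed

section \<open>Stability of Reedy small fibrations under pullback, composition and
  identities\<close>

lemma prec_cod:
  assumes "f \<in> Arr I" "Dom I f = x"
  shows "prec (Cod I f) x \<or> Cod I f = x"
proof (cases "f = Ident I x")
  case True
  then show ?thesis using assms I.dom_obj[OF assms(1)] by simp
next
  case False
  then show ?thesis using assms out_prec[of f x] by (simp add: Obj_strict_coslice)
qed

text \<open>The gap map of \<open>s\<close> is a pullback of the gap map of \<open>q\<close>.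
  Fibrancy of \<open>Src s\<close> is proved in the same induction, since the gap square of
  \<open>s\<close> at \<open>x\<close> requires the matching object of \<open>Src s\<close>, which
  admissibility provides only for Reedy fibrant restrictions.\<close>

lemma rs_pullback:
  assumes eq: "Tgt v = Src q" "Src v = Src s" "Tgt s = Src u" "Tgt q = Tgt u"
    and ob: "\<And>x. x \<in> Obj I \<Longrightarrow> obj_at (Src q) x" "\<And>x. x \<in> Obj I \<Longrightarrow> obj_at (Tgt q) x"
      "\<And>x. x \<in> Obj I \<Longrightarrow> obj_at (Src u) x" "\<And>x. x \<in> Obj I \<Longrightarrow> fun_at (Src v) x"
    and rs: "\<And>x. x \<in> Obj I \<Longrightarrow> rs_at q x" and nu: "\<And>x. x \<in> Obj I \<Longrightarrow> nat_at u x"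
    and nv: "\<And>x. x \<in> Obj I \<Longrightarrow> nat_at v x" and ns: "\<And>x. x \<in> Obj I \<Longrightarrow> nat_at s x"
    and pb: "\<And>x. x \<in> Obj I \<Longrightarrow> is_pullback C (At q x) (At u x) (At v x) (At s x)"
    and x: "x \<in> Obj I"
  shows "obj_at (Src s) x \<and> rs_at s x"
  using x
proof (induction x rule: prec_induct)
  case (less x)
  note x = less(1)
  have o: "y \<in> Obj I" if "prec y x \<or> y = x" for y using that prec_obj x by blast
  have o': "y \<in> Obj I" if "prec y x" for y using that prec_obj by blast
  note IH = less(2)[THEN conjunct1] less(2)[THEN conjunct2]
  obtain M' c' M c mq kA t1 t2 where q: "gap_square q x M' c' M c mq kA t1 t2"
    by (rule gap_squareE[OF x ob(1)[OF o'] ob(2)[OF o] rs_nat[OF rs[OF o']]])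
  note fq = obj_fun[OF ob(1)[OF o']] obj_fun[OF ob(2)[OF o']]
  obtain kA' gq where gq: "gap_map q x M' c' M c mq kA' kA t1 t2 gq"
    by (rule gap_map_exists[OF obj_fun[OF ob(1)[OF x]] fq(2) rs_nat[OF rs[OF o]] q])
  have gqS: "gq \<in> S" by (rule gap_map_small[OF rs[OF x] fq rs_nat[OF rs[OF o']] gq])
  obtain K e N d ms kB s1 s2 where s: "gap_square s x K e N d ms kB s1 s2" and kB: "kB \<in> F" and s1: "s1 \<in> F"
    by (rule gap_squareE[of x s, OF x IH(1)  _ ns[OF o']]) (use eq(3) ob(3)[OF o] in simp_all)
  have fs: "fun_at (Src s) x" "\<And>y. prec y x \<Longrightarrow> fun_at (Tgt s) y"
    using ob(4)[OF x] obj_fun[OF ob(3)[OF o']] eq(2,3) by simp_all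
  obtain kP gs where gs: "gap_map s x K e N d ms kP kB s1 s2 gs"
    by (rule gap_map_exists[OF fs ns[OF o] s])
  note Q = gap_squareD[OF q] and T = gap_squareD[OF s]
  note LQ = lim_mapD[OF Q(1)] and LT = lim_mapD[OF T(1)]
  note GQ = gap_mapD[OF gq] and GS = gap_mapD[OF gs]
  obtain mu where mu: "lim_at u x N d M c mu"
    by (rule lim_map_exists[OF _ _ obj_fun[OF ob(3)[OF o']] _ nu[OF o']])
      (use LQ(2) LT(2) eq fq in simp_all)
  obtain mv where mv: "lim_at v x K e M' c' mv"
    by (rule lim_map_exists[OF _ _ ob(4)[OF o'] _ nv[OF o']])
      (use LQ(1) LT(1) eq fq in simp_all)
  note LU = lim_mapD[OF mu] and LV = lim_mapD[OF mv]
  have 1: "is_pullback C mq mu mv ms"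
    by (rule lim_pullback[OF eq Q(1) mu mv T(1) fq obj_fun[OF ob(3)[OF o']] ob(4)[OF o'] nv[OF o'] ns[OF o'] pb[OF o']])
  have eu: "kA \<cdot> At u x = mu \<cdot> kB"
    by (rule nat_at_matching[OF nu[OF o] _ mu]) (use fq(2) Q(2) T(2) eq in simp_all)
  have ev: "kA' \<cdot> At v x = mv \<cdot> kP"
    by (rule nat_at_matching[OF nv[OF o] _ mv]) (use fq(1) GQ(2) GS(2) eq in simp_all)
  \<comment> \<open>Pasting the limit square with the gap square of \<open>s\<close>; cancelling the
    gap square of \<open>q\<close> then shows that \<open>w\<close>, the map of gap objects, is a
    pullback of \<open>At u x\<close> along \<open>t2\<close>.\<close>
  have 2: "is_pullback C mq (kA \<cdot> At u x) (mv \<cdot> s1) s2"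
    unfolding eu by (rule pullback_paste[OF 1 T(3)])
  note PQ = pullbackD[OF Q(3)] and PT = pullbackD[OF T(3)] and P1 = pullbackD[OF 1] and Px = pullbackD[OF pb[OF x]]
  have kd: "kA \<in> Arr C" "Dom C kA = OMap (Tgt u) x" "Cod C kA = M" "kB \<in> Arr C" "Dom C kB = OMap (Src u) x"
      "Cod C kB = N"
    using matching_mapD(2-4)[OF Q(2)] matching_mapD(2-4)[OF T(2)] eq by simp_all
  note nx = nat_atD(1-3)[OF nu[OF x]] nat_atD(1-3)[OF nv[OF x]] nat_atD(1-3)[OF ns[OF x]]
      nat_atD(1-3)[OF rs_nat[OF rs[OF x]]]
  have e2: "mq \<cdot> (mv \<cdot> s1) = kA \<cdot> (At u x \<cdot> s2)"
    using pullbackD(9)[OF 2] kd nx PT(3,4,6,7,8) LU(3-5) LV(3-5) LT(4) by simp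
  obtain w where w: "w \<in> Arr C" "Dom C w = Dom C s1" "Cod C w = Dom C t1" "t1 \<cdot> w = mv \<cdot> s1" "t2 \<cdot> w = At u x \<cdot> s2"
    by (rule pullback_ex[OF Q(3) _ _ _ _ _ _ e2, where Z = "Dom C s1"])
      (use kd nx PT(3,4,6,7,8) LU(3-5) LV(3-5) LT(3-5) LQ(3-5) in simp_all)
  have 3: "is_pullback C t2 (At u x) w s2"
    by (rule pullback_unpaste[OF Q(3)])
      (use 2 w PT(6) nx kd PQ(8) in \<open>simp_all\<close>)
  have 4: "is_pullback C (At u x) (t2 \<cdot> gq) (s2 \<cdot> gs) (At v x)"
    unfolding GQ(7) GS(7) by (rule pullback_swap[OF pb[OF x]])
  have e4: "w \<cdot> gs = gq \<cdot> At v x"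
  proof (rule pullback_eq[OF Q(3)])
    show "t1 \<cdot> (w \<cdot> gs) = t1 \<cdot> (gq \<cdot> At v x)"
      using w(1-3) GQ(3-5) GS(3-5) PQ(3,4,6) PT(3,4,6,7) nx eq LV(3-5) LT(4) ev
      by (simp add: w(4)[THEN reassoc] GS(6) GQ(6)[THEN reassoc])
    show "t2 \<cdot> (w \<cdot> gs) = t2 \<cdot> (gq \<cdot> At v x)"
      using w(1-3) GQ(3-5) GS(3-5) PQ(3,4,6) PT(3,4,6,8) nx eq Px(9) kd
      by (simp add: w(5)[THEN reassoc] GS(7) GQ(7)[THEN reassoc])
  qed (use w GQ(3-5) GS(3-5) PQ(3,4,6) PT(3,4,6) nx eq in simp_all)
  \<comment> \<open>The given levelwise square factors through the gap objects as this square
    followed by square \<open>3\<close>, so cancellation applies.\<close>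
  have "is_pullback C w gq gs (At v x)"
    by (rule pullback_unpaste[OF pullback_swap[OF 3] 4])
      (use e4 w GQ(3-5) GS(3-5) PQ(6) PT(6) nx eq in simp_all)
  then have S: "gs \<in> S" using small_pullback[OF gqS] pullback_swap by blast
  then have "kP \<in> F" using fib_comp[OF small_fib[OF S] s1] GS(5,6) by simp
  then have "obj_at (Src s) x" using GS(2) fs(1) unfolding obj_at_def fib_at_def by blast
  moreover have "rs_at s x" using S gs ns[OF x] unfolding rs_at_def relative_matching_map_iff by blast
  ultimately show ?case by blast
qed

text \<open>The gap map of the composite is \<open>r \<cdot> k\<close>, where \<open>k\<close> is
  the gap map of \<open>t\<close> and \<open>r\<close>, between the gap objects of \<open>t\<close>
  and of the composite, is a pullback of the gap map \<open>k'\<close> of \<open>s\<close>.\<close>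

lemma rs_comp:
  assumes eq: "Tgt t = Src s" "Src st = Src t" "Tgt st = Tgt s"
    and st: "\<And>y. prec y x \<or> y = x \<Longrightarrow> At st y = At s y \<cdot> At t y"
    and n: "\<And>y. prec y x \<or> y = x \<Longrightarrow> nat_at st y"
    and x: "x \<in> Obj I" and A: "\<And>y. prec y x \<or> y = x \<Longrightarrow> obj_at (Src t) y"
    and B: "\<And>y. prec y x \<or> y = x \<Longrightarrow> obj_at (Tgt t) y" and D: "\<And>y. prec y x \<or> y = x \<Longrightarrow> obj_at (Tgt s) y"
    and rt: "\<And>y. prec y x \<or> y = x \<Longrightarrow> rs_at t y" and rs: "\<And>y. prec y x \<or> y = x \<Longrightarrow> rs_at s y"
  shows "rs_at st x"
proof -
  note A' = A[OF disjI1] and B' = B[OF disjI1] and D' = D[OF disjI1]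
  have Bs: "\<And>y. prec y x \<Longrightarrow> obj_at (Src s) y" using B' eq by simp
  obtain M c N d mt kB g1 g2 where gt: "gap_square t x M c N d mt kB g1 g2"
    by (rule gap_squareE[OF x A' B rs_nat[OF rt[OF disjI1]]])
  \<comment> \<open>Only the target side of this square is kept; the gap square of \<open>s\<close>
    is rebuilt over the matching object \<open>N\<close> chosen for \<open>t\<close>, so that both
    share the matching map \<open>kB\<close>.\<close>
  obtain N' d' K e m' kD h1 h2 where gs0: "gap_square s x N' d' K e m' kD h1 h2"
    by (rule gap_squareE[OF x Bs D rs_nat[OF rs[OF disjI1]]])
  note Gt = gap_squareD[OF gt]
  note Lt = lim_mapD[OF Gt(1)]
  have N: "is_matching_object I C (Src s) x N d" using Lt(2) eq by simp
  note L0 = lim_mapD[OF gap_squareD(1)[OF gs0]]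
  obtain ms where ms: "lim_at s x N d K e ms"
    by (rule lim_map_exists[OF N L0(2) obj_fun[OF Bs] obj_fun[OF D'] rs_nat[OF rs[OF disjI1]]])
  note kD = gap_squareD(2)[OF gs0]
  have kDF: "kD \<in> F"
    by (rule matching_map_fib[OF _ obj_fun[OF D'] kD]) (use D[of x] in \<open>simp add: obj_at_def\<close>)
  note Ls = lim_mapD[OF ms] and kD' = matching_mapD[OF kD]
  obtain h2 h1 where h: "is_pullback C kD ms h2 h1"
    by (rule fib_pullbackE[OF kDF, of ms]) (use Ls kD' in simp_all)
  have gs: "gap_square s x N d K e ms kD h1 h2" using ms kD pullback_swap[OF h] by (simp add: gap_square_def)
  obtain l2 l1 where l: "is_pullback C kD (ms \<cdot> mt) l2 l1"
    by (rule fib_pullbackE[OF kDF, of "ms \<cdot> mt"]) (use Ls Lt kD' in simp_all)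
  have mst: "lim_at st x M c K e (ms \<cdot> mt)"
  proof (rule lim_mapI)
    fix f assume f: "f \<in> out x"
    show "e f \<cdot> (ms \<cdot> mt) = At st (Cod I f) \<cdot> c f"
      using Ls(3-5) Lt(3-5) st[of "Cod I f"] out_prec[OF f] nat_atD(1-3)[OF rs_nat[OF rt], of "Cod I f"]
        nat_atD(1-3)[OF rs_nat[OF rs], of "Cod I f"] matching_objectD(2-4)[OF Ls(2) f]
        matching_objectD(2-4)[OF Lt(2) f] matching_objectD(2-4)[OF Lt(1) f] eq Lt(6)[OF f]
      by (simp add: Ls(6)[OF f, THEN reassoc])
  qed (use Ls Lt eq in simp_all)
  have gst: "gap_square st x M c K e (ms \<cdot> mt) kD l1 l2"
    using mst kD pullback_swap[OF l] eq by (simp add: gap_square_def)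
  obtain kA k where kt: "gap_map t x M c N d mt kA kB g1 g2 k"
    by (rule gap_map_exists[OF _ obj_fun[OF B'] rs_nat[OF rt] gt]) (use A obj_fun in blast)
  obtain kB' k' where ks: "gap_map s x N d K e ms kB' kD h1 h2 k'"
    by (rule gap_map_exists[OF _ obj_fun[OF D'] rs_nat[OF rs] gs]) (use B eq obj_fun in metis)
  have kS: "k \<in> S" by (rule gap_map_small[OF _ obj_fun[OF A'] obj_fun[OF B'] rs_nat[OF rt[OF disjI1]] kt])
      (use rt in simp)
  have kS': "k' \<in> S" by (rule gap_map_small[OF _ obj_fun[OF Bs] obj_fun[OF D'] rs_nat[OF rs[OF disjI1]] ks])
      (use rs in simp)
  note Kt = gap_mapD[OF kt] and Ks = gap_mapD[OF ks]
  have "kB' = Ident C N \<cdot> kB"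
    by (rule matching_map_unique[of "Src s" x N d kB N d])
        (use Gt(2) Ks(2) eq obj_fun[OF Bs] matching_objectD[OF N] in simp_all)
  then have kB': "kB' = kB" using matching_mapD(2-4)[OF Gt(2)] by simp
  note Ph = pullbackD[OF h] and Pl = pullbackD[OF l] and Pg = pullbackD[OF Gt(3)]
  note ar = Ls(3-5) Lt(3-5) kD'(2-4) matching_mapD(2-4)[OF Gt(2)]
  have dm: "Dom C (ms \<cdot> mt) = M" using ar by simp
  have e1: "kD \<cdot> l2 = ms \<cdot> (mt \<cdot> l1)" using Pl ar by simp
  \<comment> \<open>\<open>j\<close> maps the gap object of the composite to that of
    \<open>s\<close>; by cancellation it is a pullback of \<open>mt\<close>.\<close>
  obtain j where j: "j \<in> Arr C" "Dom C j = Dom C l1" "Cod C j = Dom C h2" "h2 \<cdot> j = l2" "h1 \<cdot> j = mt \<cdot> l1"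
    by (rule pullback_ex[OF h _ _ _ _ _ _ e1, where Z = "Dom C l1"]) (use Pl(3,4,6,7,8) ar dm in simp_all)
  have 1: "is_pullback C h1 mt j l1"
    by (rule pullback_unpaste[OF h]) (use l j ar Ph in simp_all)
  have e2: "h1 \<cdot> (k' \<cdot> g2) = mt \<cdot> g1"
    using Ks(3-6) kB' Ph(3,4,6) Pg ar eq by (simp add: Ks(6)[THEN reassoc])
  obtain r where r: "r \<in> Arr C" "Dom C r = Dom C g1" "Cod C r = Dom C j" "j \<cdot> r = k' \<cdot> g2" "l1 \<cdot> r = g1"
    by (rule pullback_ex[OF 1 _ _ _ _ _ _ e2, where Z = "Dom C g1"])
      (use Ks(3-5) Ph(3,4,6) Pg ar eq in simp_all)
  have "is_pullback C j k' r g2"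
  proof (rule pullback_unpaste[OF pullback_swap[OF 1]])
    show "is_pullback C mt (h1 \<cdot> k') (l1 \<cdot> r) g2" unfolding r(5) Ks(6) kB' by (rule Gt(3))
  qed (use r j Ks(3-5) Pg Ph in simp_all)
  then have rS: "r \<in> S" using small_pullback[OF kS'] pullback_swap by blast
  have "gap_map st x M c K e (ms \<cdot> mt) kA kD l1 l2 (r \<cdot> k)"
    unfolding gap_map_def
  proof (intro conjI)
    show "is_matching_map I C (Src st) x M c kA" using Kt(2) eq by simp
    show "l1 \<cdot> (r \<cdot> k) = kA" using r j Kt(3-6) Pl by (simp add: r(5)[THEN reassoc])
    have "l2 \<cdot> (r \<cdot> k) = h2 \<cdot> (j \<cdot> (r \<cdot> k))"
      using r(1-3) j(1-3) Kt(3-5) Ph(3,4,6) Pl(6) by (simp add: j(4)[THEN reassoc])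
    also have "\<dots> = At st x"
      using r(1-3) j(1-3) Kt(3-5) Ph(3,4,6) Pg(3,4,6,8) Ks(3-5) st[of x] eq ar
        nat_atD(1-3)[OF rs_nat[OF rt], of x]
      by (simp add: r(4)[THEN reassoc] Kt(7) Ks(7)[THEN reassoc])
    finally show "l2 \<cdot> (r \<cdot> k) = At st x" .
  qed (use gst r j Kt eq in simp_all)
  moreover have "r \<cdot> k \<in> S" using small_comp[OF kS rS] Kt(5) r(2) by simp
  ultimately show ?thesis using n[of x] unfolding rs_at_def relative_matching_map_iff by blast
qed

text \<open>Over the identity of the matching object, the gap object can be chosen to be the value
  of \<open>A\<close> at \<open>x\<close>, and then the gap map is an identity.\<close>

lemma rs_ident:
  assumes eq: "Src t = A" "Tgt t = A" and t: "\<And>y. prec y x \<or> y = x \<Longrightarrow> At t y = Ident C (OMap A y)"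
    and x: "x \<in> Obj I" and A: "\<And>y. prec y x \<or> y = x \<Longrightarrow> obj_at A y"
  shows "rs_at t x"
proof -
  note A' = A[OF disjI1]
  have fx: "fun_at A x" using A[of x] by (simp add: obj_at_def)
  note D = fun_atD[OF fx]
  obtain M c where M: "is_matching_object I C A x M c" by (rule matching_object_exists[OF x A'])
  obtain k where k: "is_matching_map I C A x M c k" by (rule matching_map_exists[OF fx M])
  note k' = matching_mapD[OF k] and c = matching_objectD[OF M]
  have l: "lim_at t x M c M c (Ident C M)"
  proof (rule lim_mapI)
    fix f assume f: "f \<in> out x"
    show "c f \<cdot> Ident C M = At t (Cod I f) \<cdot> c f"
      using c(2-4)[OF f] t[of "Cod I f"] out_prec[OF f] by simp
  qed (use eq M c in simp_all)
  have "nat_at t x"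
    unfolding nat_at_def in_hom
    using eq t[of x] D prec_cod t by auto
  moreover have "gap_map t x M c M c (Ident C M) k k k (Ident C (OMap A x)) (Ident C (OMap A x))"
    using l k k'(2-4) eq D(1) t[of x] pullback_ident[OF k'(2)] by (simp add: gap_map_def gap_square_def)
  ultimately show ?thesis
    using small_ident[OF D(1)] unfolding rs_at_def relative_matching_map_iff by blast
qed

text \<open>The action of a levelwise pullback on arrows. When \<open>q1\<close> and
  \<open>q2\<close> are pullback projections the arrow is unique, so \<open>SOME\<close> is
  harmless; its value depends only on data at the two ends of \<open>f\<close> and on the action of
  \<open>P\<close> and \<open>A\<close> on \<open>f\<close>, which makes it stable in
  recursions.\<close>

definition pb_arr where
  "pb_arr P A q1 q2 f = (SOME w. w \<in> Arr C \<and> Dom C w = Dom C (q1 (Dom I f)) \<and> Cod C w = Dom C (q1 (Cod I f)) \<and>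
     q1 (Cod I f) \<cdot> w = AMap P f \<cdot> q1 (Dom I f) \<and> q2 (Cod I f) \<cdot> w = AMap A f \<cdot> q2 (Dom I f))"

lemma pb_arr:
  assumes r: "nat_at r x" and g: "nat_at g x" and eq: "Tgt r = Tgt g"
    and fn: "fun_at (Src r) x" "fun_at (Src g) x" "fun_at (Tgt r) x"
    and f: "f \<in> Arr I" "Dom I f = x"
    and pb: "\<And>y. prec y x \<or> y = x \<Longrightarrow> is_pullback C (At r y) (At g y) (q1 y) (q2 y)"
    and rg: "nat_at r (Cod I f)" "nat_at g (Cod I f)"
  defines "w \<equiv> pb_arr (Src r) (Src g) q1 q2 f"
  shows "w \<in> Arr C" "Dom C w = Dom C (q1 x)" "Cod C w = Dom C (q1 (Cod I f))"
     "q1 (Cod I f) \<cdot> w = AMap (Src r) f \<cdot> q1 x" "q2 (Cod I f) \<cdot> w = AMap (Src g) f \<cdot> q2 x"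
proof -
  have px: "is_pullback C (At r x) (At g x) (q1 x) (q2 x)"
    and pf: "is_pullback C (At r (Cod I f)) (At g (Cod I f)) (q1 (Cod I f)) (q2 (Cod I f))"
    using pb[of x] pb[OF prec_cod[OF f]] by simp_all
  note Px = pullbackD[OF px] and Pf = pullbackD[OF pf]
  note D = fun_atD(3-5)[OF fn(1) f] fun_atD(3-5)[OF fn(2) f] fun_atD(3-5)[OF fn(3) f]
  note n = nat_atD(1-3)[OF r] nat_atD(1-3)[OF g] nat_atD(1-3)[OF rg(1)] nat_atD(1-3)[OF rg(2)]
  note n4 = nat_atD(4)[OF r f] nat_atD(4)[OF g f]
  have e: "At r (Cod I f) \<cdot> (AMap (Src r) f \<cdot> q1 x) = At g (Cod I f) \<cdot> (AMap (Src g) f \<cdot> q2 x)"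
    using Px(3,4,6,7,8) Px(9) D n eq by (simp add: n4[THEN reassoc])
  obtain w' where "w' \<in> Arr C" "Dom C w' = Dom C (q1 x)" "Cod C w' = Dom C (q1 (Cod I f))"
     "q1 (Cod I f) \<cdot> w' = AMap (Src r) f \<cdot> q1 x" "q2 (Cod I f) \<cdot> w' = AMap (Src g) f \<cdot> q2 x"
    by (rule pullback_ex[OF pf _ _ _ _ _ _ e, where Z = "Dom C (q1 x)"])
      (use Px(3,4,6,7,8) D n in simp_all)
  then have "\<exists>w. w \<in> Arr C \<and> Dom C w = Dom C (q1 x) \<and> Cod C w = Dom C (q1 (Cod I f)) \<and>
     q1 (Cod I f) \<cdot> w = AMap (Src r) f \<cdot> q1 x \<and> q2 (Cod I f) \<cdot> w = AMap (Src g) f \<cdot> q2 x" by metis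
  from someI_ex[OF this] show "w \<in> Arr C" "Dom C w = Dom C (q1 x)" "Cod C w = Dom C (q1 (Cod I f))"
     "q1 (Cod I f) \<cdot> w = AMap (Src r) f \<cdot> q1 x" "q2 (Cod I f) \<cdot> w = AMap (Src g) f \<cdot> q2 x"
    unfolding w_def pb_arr_def f(2) by simp_all
qed

text \<open>Functoriality follows from uniqueness in the pullback at the codomain, and naturality of
  the projections is the defining property of \<open>pb_arr\<close>. \<open>Q\<close> is prescribed
  only at \<open>x\<close> and below.\<close>

lemma pb_fun_at:
  assumes x: "x \<in> Obj I" and r: "\<And>y. prec y x \<or> y = x \<Longrightarrow> nat_at r y" and g: "\<And>y. prec y x \<or> y = x \<Longrightarrow> nat_at g y"
    and eq: "Tgt r = Tgt g"
    and fn: "\<And>y. prec y x \<or> y = x \<Longrightarrow> fun_at (Src r) y" "\<And>y. prec y x \<or> y = x \<Longrightarrow> fun_at (Src g) y"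
      "\<And>y. prec y x \<or> y = x \<Longrightarrow> fun_at (Tgt r) y"
    and pb: "\<And>y. prec y x \<or> y = x \<Longrightarrow> is_pullback C (At r y) (At g y) (q1 y) (q2 y)"
    and Q: "\<And>y. prec y x \<or> y = x \<Longrightarrow> OMap Q y = Dom C (q1 y)"
      "\<And>f. \<lbrakk>f \<in> Arr I; prec (Dom I f) x \<or> Dom I f = x\<rbrakk> \<Longrightarrow> AMap Q f = pb_arr (Src r) (Src g) q1 q2 f"
  shows "fun_at Q x" "\<lbrakk>Src t = Q; Tgt t = Src r; \<And>y. prec y x \<or> y = x \<Longrightarrow> At t y = q1 y\<rbrakk> \<Longrightarrow> nat_at t x"
    "\<lbrakk>Src t = Q; Tgt t = Src g; \<And>y. prec y x \<or> y = x \<Longrightarrow> At t y = q2 y\<rbrakk> \<Longrightarrow> nat_at t x"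
proof -
  have lt: "prec z x \<or> z = x" if "prec z y \<or> z = y" "prec y x \<or> y = x" for y z using that prec_trans by blast
  have cod: "prec (Cod I f) x \<or> Cod I f = x" if "f \<in> Arr I" "prec (Dom I f) x \<or> Dom I f = x" for f
    using lt[OF prec_cod[OF that(1) refl] that(2)] .
  have W: "AMap Q f \<in> Arr C" "Dom C (AMap Q f) = Dom C (q1 (Dom I f))" "Cod C (AMap Q f) = Dom C (q1 (Cod I f))"
     "q1 (Cod I f) \<cdot> AMap Q f = AMap (Src r) f \<cdot> q1 (Dom I f)"
         "q2 (Cod I f) \<cdot> AMap Q f = AMap (Src g) f \<cdot> q2 (Dom I f)"
    if f: "f \<in> Arr I" "prec (Dom I f) x \<or> Dom I f = x" for f
    unfolding Q(2)[OF f]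
    by (rule pb_arr[OF r[OF f(2)] g[OF f(2)] eq fn[OF f(2)] f(1) refl pb[OF lt[OF _ f(2)]] r[OF cod[OF f]] g[OF cod[OF f]]], assumption)+
  have P: "is_pullback C (At r x) (At g x) (q1 x) (q2 x)" and nx: "nat_at r x" "nat_at g x"
    and fx: "fun_at (Src r) x" "fun_at (Src g) x" using pb r g fn by simp_all
  note P' = pullbackD[OF P] and n' = nat_atD(1-3)[OF nx(1)] nat_atD(1-3)[OF nx(2)]
  have o: "Dom C (q1 x) \<in> Obj C" using P'(3) by simp
  have id: "AMap Q (Ident I x) = Ident C (Dom C (q1 x))"
    by (rule pullback_eq[OF P, where Z = "Dom C (q1 x)"])
      (use W[of "Ident I x"] x o P'(3,4,6,7,8) n' fun_atD(2)[OF fx(1)] fun_atD(2)[OF fx(2)] in simp_all)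
  have cmp: "AMap Q (h \<cdot>\<^bsub>I\<^esub> f) = AMap Q h \<cdot> AMap Q f"
    if f: "f \<in> Arr I" "h \<in> Arr I" "Dom I f = x" "Cod I f = Dom I h" for f h
  proof -
    have d: "prec (Dom I f) x \<or> Dom I f = x" "prec (Dom I h) x \<or> Dom I h = x"
      "prec (Dom I (h \<cdot>\<^bsub>I\<^esub> f)) x \<or> Dom I (h \<cdot>\<^bsub>I\<^esub> f) = x"
      using f prec_cod[of f x] by simp_all
    note Wf = W[OF f(1) d(1)] and Wh = W[OF f(2) d(2)] and Wc = W[OF _ d(3)]
    have fh: "fun_at (Src r) (Dom I h)" "fun_at (Src g) (Dom I h)" using d fn by simp_all
    have ph: "is_pullback C (At r (Dom I h)) (At g (Dom I h)) (q1 (Dom I h)) (q2 (Dom I h))"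
      using pb[OF d(2)] .
    note Ph = pullbackD[OF ph]
    have nh: "nat_at r (Dom I h)" "nat_at g (Dom I h)" using r g d by simp_all
    have pc: "is_pullback C (At r (Cod I h)) (At g (Cod I h)) (q1 (Cod I h)) (q2 (Cod I h))"
      by (rule pb[OF cod[OF f(2) d(2)]])
    note F = fun_atD(3-6)[OF fx(1), of f] fun_atD(3-6)[OF fx(2), of f] fun_atD(3-5)[OF fh(1) f(2) refl]
        fun_atD(3-5)[OF fh(2) f(2) refl]
    show ?thesis
    proof (rule pullback_eq[OF pc])
      show "q1 (Cod I h) \<cdot> AMap Q (h \<cdot>\<^bsub>I\<^esub> f) = q1 (Cod I h) \<cdot> (AMap Q h \<cdot> AMap Q f)"
        using f Wf Wh(1-3) Wc(4) F P'(3,4,6,7,8) Ph(3,4,6,7,8) n' nat_atD(1-3)[OF nh(1)] pullbackD(3)[OF pc]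
        by (simp add: Wh(4)[THEN reassoc])
      show "q2 (Cod I h) \<cdot> AMap Q (h \<cdot>\<^bsub>I\<^esub> f) = q2 (Cod I h) \<cdot> (AMap Q h \<cdot> AMap Q f)"
        using f Wf Wh(1-3) Wc(5) F P'(3,4,6,7,8) Ph(3,4,6,7,8) n' nat_atD(1-3)[OF nh(2)] pullbackD(4,6)[OF pc]
        by (simp add: Wh(5)[THEN reassoc])
    qed (use f Wf Wh Wc in simp_all)
  qed
  show "fun_at Q x"
    unfolding fun_at_def in_hom
    using Q(1) o id cmp W prec_cod by auto
  show "nat_at t x" if "Src t = Q" "Tgt t = Src r" "\<And>y. prec y x \<or> y = x \<Longrightarrow> At t y = q1 y"
    unfolding nat_at_def in_hom
    using that(1,2) that(3)[of x] that(3)[OF prec_cod] Q(1)[of x] P'(3,7) n' W(4) by simp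
  show "nat_at t x" if "Src t = Q" "Tgt t = Src g" "\<And>y. prec y x \<or> y = x \<Longrightarrow> At t y = q2 y"
    unfolding nat_at_def in_hom
    using that(1,2) that(3)[of x] that(3)[OF prec_cod] Q(1)[of x] P'(4,6,8) n' W(5) by simp
qed

section \<open>The category of Reedy fibrant diagrams\<close>

abbreviation R :: "(('i, 'j, 'o, 'a) diagram, ('i, 'j, 'o, 'a) transf) cat_data" where
  "R \<equiv> reedy_category I C F"

abbreviation RS :: "('i, 'j, 'o, 'a) transf set" where
  "RS \<equiv> reedy_small_fibrations I C F p"

lemma reedy_fibrant_iff: "reedy_fibrant I C F A \<longleftrightarrow> is_functor I C A \<and> (\<forall>x \<in> Obj I. obj_at A x)"
  unfolding reedy_fibrant_def obj_at_def fib_at_def is_functor_iff by blast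

lemma R_simps [simp]:
  "Dom R = Src" "Cod R = Tgt"
  "Ident R A = \<lparr>Src = A, Tgt = A, At = (\<lambda>x \<in> Obj I. Ident C (OMap A x))\<rparr>"
  "s \<cdot>\<^bsub>R\<^esub> t = \<lparr>Src = Src t, Tgt = Tgt s, At = (\<lambda>x \<in> Obj I. At s x \<cdot> At t x)\<rparr>"
  by (simp_all add: reedy_category_def full_subcategory_def functor_category_def)

lemma R_obj: "A \<in> Obj R \<longleftrightarrow> is_functor I C A \<and> (\<forall>x \<in> Obj I. obj_at A x)"
  by (auto simp add: reedy_category_def full_subcategory_def functor_category_def reedy_fibrant_iff)

lemma R_arr: "t \<in> Arr R \<longleftrightarrow> is_natural I C t \<and> Src t \<in> Obj R \<and> Tgt t \<in> Obj R"
  unfolding R_obj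
  by (auto simp add: reedy_category_def full_subcategory_def functor_category_def reedy_fibrant_iff is_natural_iff)

lemma R_arrD:
  assumes "t \<in> Arr R"
  shows "x \<in> Obj I \<Longrightarrow> nat_at t x" "x \<in> Obj I \<Longrightarrow> obj_at (Src t) x" "x \<in> Obj I \<Longrightarrow> obj_at (Tgt t) x"
    "x \<in> Obj I \<Longrightarrow> fun_at (Src t) x" "x \<in> Obj I \<Longrightarrow> fun_at (Tgt t) x"
    "is_functor I C (Src t)" "is_functor I C (Tgt t)" "At t \<in> extensional (Obj I)"
    "x \<in> Obj I \<Longrightarrow> At t x \<in> Arr C" "x \<in> Obj I \<Longrightarrow> Dom C (At t x) = OMap (Src t) x"
    "x \<in> Obj I \<Longrightarrow> Cod C (At t x) = OMap (Tgt t) x"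
  using assms unfolding R_arr R_obj is_natural_iff nat_at_def in_hom obj_at_def by simp_all

lemma R_arrI:
  assumes "Src t \<in> Obj R" "Tgt t \<in> Obj R" "At t \<in> extensional (Obj I)" "\<And>x. x \<in> Obj I \<Longrightarrow> nat_at t x"
  shows "t \<in> Arr R"
  using assms unfolding R_arr R_obj is_natural_iff by simp

lemma mk_tr_arr:
  assumes "A \<in> Obj R" "B \<in> Obj R" "\<And>x. x \<in> Obj I \<Longrightarrow> nat_at (mk_tr A B t) x"
  shows "mk_tr A B t \<in> Arr R"
  by (rule R_arrI) (use assms in \<open>simp_all add: mk_tr_def\<close>)

lemma transf_eqI:
  assumes "s \<in> Arr R" "t \<in> Arr R" "Src s = Src t" "Tgt s = Tgt t" "\<And>x. x \<in> Obj I \<Longrightarrow> At s x = At t x"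
  shows "s = t"
proof -
  have "At s = At t"
    by (rule extensionalityI[of _ "Obj I"]) (use R_arrD(8) assms in simp_all)
  then show ?thesis using assms(3,4) by (cases s; cases t) simp
qed

lemma nat_at_comp:
  assumes x: "x \<in> Obj I" and st: "Src u = Src t" "Tgt u = Tgt s" "Tgt t = Src s"
    and u: "\<And>y. y \<in> Obj I \<Longrightarrow> At u y = At s y \<cdot> At t y"
    and s: "\<And>y. y \<in> Obj I \<Longrightarrow> nat_at s y" and t: "\<And>y. y \<in> Obj I \<Longrightarrow> nat_at t y"
    and fn: "fun_at (Src t) x" "fun_at (Src s) x" "fun_at (Tgt s) x"
  shows "nat_at u x"
proof -
  have "At u (Cod I f) \<cdot> AMap (Src u) f = AMap (Tgt u) f \<cdot> At u x" if f: "f \<in> Arr I" "Dom I f = x" for f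
  proof -
    have c: "Cod I f \<in> Obj I" using f by simp
    show ?thesis
      using u[OF x] u[OF c] st nat_atD(1-3)[OF s[OF x]] nat_atD(1-3)[OF t[OF x]] nat_atD(1-3)[OF s[OF c]]
          nat_atD(1-3)[OF t[OF c]]
        fun_atD(3-5)[OF fn(1) f] fun_atD(3-5)[OF fn(2) f] fun_atD(3-5)[OF fn(3) f]
        nat_atD(4)[OF t[OF x] f]
      by (simp add: nat_atD(4)[OF s[OF x] f, THEN reassoc])
  qed
  then show ?thesis using u[OF x] st nat_atD(1-3)[OF s[OF x]] nat_atD(1-3)[OF t[OF x]]
    by (simp add: nat_at_def in_hom)
qed

lemma R_comp_arr:
  assumes "t \<in> Arr R" "s \<in> Arr R" "Tgt t = Src s"
  shows "s \<cdot>\<^bsub>R\<^esub> t \<in> Arr R"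
proof (rule R_arrI)
  fix x assume "x \<in> Obj I"
  then show "nat_at (s \<cdot>\<^bsub>R\<^esub> t) x"
    using R_arrD(4,5)[OF assms(1)] R_arrD(4,5)[OF assms(2)]
    by (intro nat_at_comp[of x _ t s] R_arrD(1)[OF assms(1)] R_arrD(1)[OF assms(2)]) (simp_all add: assms(3))
qed (use assms R_arr in simp_all)

lemma R_ident_arr:
  assumes "A \<in> Obj R"
  shows "Ident R A \<in> Arr R"
proof (rule R_arrI)
  fix x assume x: "x \<in> Obj I"
  have "fun_at A x" using assms x unfolding R_obj is_functor_iff by blast
  note D = fun_atD[OF this]
  have "AMap A f \<in> Arr C \<and> Ident C (OMap A (Cod I f)) \<cdot> AMap A f = AMap A f \<cdot> Ident C (OMap A x)"
    if "f \<in> Arr I" "Dom I f = x" for f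
    using D(3-5)[OF that] by simp
  then show "nat_at (Ident R A) x" using D(1) x unfolding nat_at_def in_hom by simp
qed (use assms in simp_all)

lemma R_category: "category R"
proof
  show "f \<in> Arr R \<Longrightarrow> Dom R f \<in> Obj R" "f \<in> Arr R \<Longrightarrow> Cod R f \<in> Obj R" for f
    by (simp_all add: R_arr)
  show "Ident R A \<in> hom R A A" if "A \<in> Obj R" for A
    using R_ident_arr[OF that] unfolding hom_def by simp
  show "g \<cdot>\<^bsub>R\<^esub> f \<in> hom R a c" if "f \<in> hom R a b" "g \<in> hom R b c" for f g a b c
    using that R_comp_arr[of f g] unfolding hom_def by simp
  show "f \<cdot>\<^bsub>R\<^esub> Ident R a = f" if "f \<in> hom R a b" for f a b
  proof (rule transf_eqI)
    have f: "f \<in> Arr R" "Src f = a" "Tgt f = b" using that by (simp_all add: hom_def)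
    then show "f \<cdot>\<^bsub>R\<^esub> Ident R a \<in> Arr R" using R_comp_arr[OF R_ident_arr[of a] f(1)] R_arr by simp
    show "f \<in> Arr R" by fact
    show "At (f \<cdot>\<^bsub>R\<^esub> Ident R a) x = At f x" if "x \<in> Obj I" for x using that R_arrD(9,10)[OF f(1) that] f by simp
  qed (use that in \<open>simp_all add: hom_def\<close>)
  show "Ident R b \<cdot>\<^bsub>R\<^esub> f = f" if "f \<in> hom R a b" for f a b
  proof (rule transf_eqI)
    have f: "f \<in> Arr R" "Src f = a" "Tgt f = b" using that by (simp_all add: hom_def)
    then show "Ident R b \<cdot>\<^bsub>R\<^esub> f \<in> Arr R" using R_comp_arr[OF f(1) R_ident_arr[of b]] R_arr by simp
    show "f \<in> Arr R" by fact
    show "At (Ident R b \<cdot>\<^bsub>R\<^esub> f) x = At f x" if "x \<in> Obj I" for x using that R_arrD(9,11)[OF f(1) that] f by simp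
  qed (use that in \<open>simp_all add: hom_def\<close>)
  show "(h \<cdot>\<^bsub>R\<^esub> g) \<cdot>\<^bsub>R\<^esub> f = h \<cdot>\<^bsub>R\<^esub> (g \<cdot>\<^bsub>R\<^esub> f)"
    if "f \<in> hom R a b" "g \<in> hom R b c" "h \<in> hom R c d" for f g h a b c d
  proof (rule transf_eqI)
    have f: "f \<in> Arr R" "Tgt f = b" "g \<in> Arr R" "Src g = b" "Tgt g = c" "h \<in> Arr R" "Src h = c"
      using that by (simp_all add: hom_def)
    show "(h \<cdot>\<^bsub>R\<^esub> g) \<cdot>\<^bsub>R\<^esub> f \<in> Arr R" by (intro R_comp_arr f) (use f in simp_all)
    show "h \<cdot>\<^bsub>R\<^esub> (g \<cdot>\<^bsub>R\<^esub> f) \<in> Arr R" by (intro R_comp_arr f) (use f in simp_all)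
    show "At ((h \<cdot>\<^bsub>R\<^esub> g) \<cdot>\<^bsub>R\<^esub> f) x = At (h \<cdot>\<^bsub>R\<^esub> (g \<cdot>\<^bsub>R\<^esub> f)) x" if "x \<in> Obj I" for x
      using that R_arrD(9-11)[OF f(1) that] R_arrD(9-11)[OF f(3) that] R_arrD(9-11)[OF f(6) that] f by simp
  qed simp_all
qed

sublocale R: category R
  by (rule R_category)

section \<open>Pullbacks of Reedy small fibrations in the diagram category\<close>

lemma RS_iff: "t \<in> RS \<longleftrightarrow> t \<in> Arr R \<and> (\<forall>x \<in> Obj I. rs_at t x)"
  unfolding reedy_small_fibrations_def reedy_class_def rs_at_def R_arr is_natural_iff by auto

lemma RS_reedy_fibration: "t \<in> RS \<Longrightarrow> t \<in> reedy_fibrations I C F"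
  unfolding reedy_small_fibrations_def reedy_fibrations_def reedy_fibration_def reedy_class_def
  using small_fib by blast

lemma RS_small_at: "\<lbrakk>t \<in> RS; x \<in> Obj I\<rbrakk> \<Longrightarrow> At t x \<in> S"
  unfolding RS_iff using rs_at_small[of x t] R_arrD(2,3)[of t] prec_obj by metis

text \<open>Levelwise mediating maps are natural by uniqueness in the pullback at the codomain of
  each arrow, and they are arrows of \<open>R\<close> because \<open>R\<close> is a full
  subcategory.\<close>

lemma R_pullbackI:
  assumes ar: "q \<in> Arr R" "u \<in> Arr R" "v \<in> Arr R" "s \<in> Arr R"
    and eq: "Tgt v = Src q" "Src v = Src s" "Tgt s = Src u" "Tgt q = Tgt u"
    and pb: "\<And>x. x \<in> Obj I \<Longrightarrow> is_pullback C (At q x) (At u x) (At v x) (At s x)"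
  shows "is_pullback R q u v s"
proof (rule R.pullbackI)
  show "q \<cdot>\<^bsub>R\<^esub> v = u \<cdot>\<^bsub>R\<^esub> s"
    by (rule transf_eqI) (use R_comp_arr[OF ar(3,1)] R_comp_arr[OF ar(4,2)] eq pullbackD(9)[OF pb] in simp_all)
  show "q \<in> Arr R" "u \<in> Arr R" "v \<in> Arr R" "s \<in> Arr R" by fact+
  show "Cod R u = Cod R q" "Dom R s = Dom R v" "Cod R v = Dom R q" "Cod R s = Dom R u"
    using eq by simp_all
  fix Z a b
  assume "a \<in> Arr R" "b \<in> Arr R" "Dom R a = Z" "Dom R b = Z" "Cod R a = Dom R q" "Cod R b = Dom R u"
    and e: "q \<cdot>\<^bsub>R\<^esub> a = u \<cdot>\<^bsub>R\<^esub> b"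
  then have ab: "a \<in> Arr R" "b \<in> Arr R" "Src a = Z" "Src b = Z" "Tgt a = Src q" "Tgt b = Src u" by simp_all
  have "\<exists>w. w \<in> Arr C \<and> Dom C w = OMap Z x \<and> Cod C w = OMap (Src v) x \<and> At v x \<cdot> w = At a x \<and> At s x \<cdot> w = At b x"
    if x: "x \<in> Obj I" for x
  proof -
    note X = R_arrD(9-11)[OF ar(1) x] R_arrD(9-11)[OF ar(2) x] R_arrD(9-11)[OF ar(3) x] R_arrD(9-11)[OF ar(4) x]
      R_arrD(9-11)[OF ab(1) x] R_arrD(9-11)[OF ab(2) x]
    have "At (q \<cdot>\<^bsub>R\<^esub> a) x = At (u \<cdot>\<^bsub>R\<^esub> b) x" unfolding e ..
    then have e': "At q x \<cdot> At a x = At u x \<cdot> At b x" using x by simp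
    obtain w where "w \<in> Arr C" "Dom C w = OMap Z x" "Cod C w = Dom C (At v x)" "At v x \<cdot> w = At a x"
        "At s x \<cdot> w = At b x"
      by (rule pullback_ex[OF pb[OF x] _ _ _ _ _ _ e', where Z = "OMap Z x"]) (use X ab eq in simp_all)
    then show ?thesis using X by auto
  qed
  then obtain w where w: "\<And>x. x \<in> Obj I \<Longrightarrow> w x \<in> Arr C" "\<And>x. x \<in> Obj I \<Longrightarrow> Dom C (w x) = OMap Z x"
    "\<And>x. x \<in> Obj I \<Longrightarrow> Cod C (w x) = OMap (Src v) x"
    "\<And>x. x \<in> Obj I \<Longrightarrow> At v x \<cdot> w x = At a x" "\<And>x. x \<in> Obj I \<Longrightarrow> At s x \<cdot> w x = At b x"
    by metis
  let ?w = "mk_tr Z (Src v) w"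
  have W: "?w \<in> Arr R"
  proof (rule mk_tr_arr)
    show "Z \<in> Obj R" "Src v \<in> Obj R" using ab(1,3) ar(3) R_arr by auto
    fix x assume x: "x \<in> Obj I"
    have "w (Cod I f) \<cdot> AMap Z f = AMap (Src v) f \<cdot> w x" if f: "f \<in> Arr I" "Dom I f = x" for f
    proof (rule pullback_eq[OF pb, where Z = "OMap Z x"])
      have c: "Cod I f \<in> Obj I" using f by simp
      then show "Cod I f \<in> Obj I" .
      note X = R_arrD(9-11)[OF ar(3) x] R_arrD(9-11)[OF ar(4) x] R_arrD(9-11)[OF ar(3) c] R_arrD(9-11)[OF ar(4) c]
        R_arrD(9-11)[OF ab(1) x] R_arrD(9-11)[OF ab(2) x]
      note X' = fun_atD(3-5)[OF R_arrD(4)[OF ab(1) x] f] fun_atD(3-5)[OF R_arrD(4)[OF ar(3) x] f]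
         fun_atD(3-5)[OF R_arrD(5)[OF ar(3) x] f] fun_atD(3-5)[OF R_arrD(5)[OF ar(4) x] f]
      note N = nat_atD(4)[OF R_arrD(1)[OF ar(3) x] f] nat_atD(4)[OF R_arrD(1)[OF ar(4) x] f]
        nat_atD(4)[OF R_arrD(1)[OF ab(1) x] f] nat_atD(4)[OF R_arrD(1)[OF ab(2) x] f]
      note N = N[unfolded eq ab(3-6)]
      show "At v (Cod I f) \<cdot> (w (Cod I f) \<cdot> AMap Z f) = At v (Cod I f) \<cdot> (AMap (Src v) f \<cdot> w x)"
        using X X' N(3) w(1-4)[OF x] w(1-3)[OF c] ab eq by (simp add: w(4)[OF c, THEN reassoc] N(1)[THEN reassoc])
      show "At s (Cod I f) \<cdot> (w (Cod I f) \<cdot> AMap Z f) = At s (Cod I f) \<cdot> (AMap (Src v) f \<cdot> w x)"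
        using X X' N(4) w(1-5)[OF x] w(1-3)[OF c] ab eq N(2) by
            (simp add: w(5)[OF c, THEN reassoc] N(2)[THEN reassoc])
    qed (use f x w fun_atD(3-5)[OF R_arrD(4)[OF ab(1) x] f] fun_atD(3-5)[OF R_arrD(4)[OF ar(3) x] f]
       R_arrD(9-11)[OF ar(3)] ab in simp_all)
    then show "nat_at ?w x" using w(1-3)[OF x] x by (simp add: nat_at_def in_hom)
  qed
  show "\<exists>w. w \<in> Arr R \<and> Dom R w = Z \<and> Cod R w = Dom R v \<and> v \<cdot>\<^bsub>R\<^esub> w = a \<and> s \<cdot>\<^bsub>R\<^esub> w = b"
  proof (intro exI[of _ ?w] conjI W)
    show "v \<cdot>\<^bsub>R\<^esub> ?w = a" by (rule transf_eqI) (use R_comp_arr[OF W ar(3)] ab eq w in simp_all)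
    show "s \<cdot>\<^bsub>R\<^esub> ?w = b" by (rule transf_eqI) (use R_comp_arr[OF W ar(4)] ab eq w in simp_all)
  qed simp_all
next
  fix Z a b
  assume "a \<in> Arr R" "b \<in> Arr R" "Dom R a = Z" "Dom R b = Z" "Cod R a = Dom R v" "Cod R b = Dom R v"
    and e: "v \<cdot>\<^bsub>R\<^esub> a = v \<cdot>\<^bsub>R\<^esub> b" "s \<cdot>\<^bsub>R\<^esub> a = s \<cdot>\<^bsub>R\<^esub> b"
  then have ab: "a \<in> Arr R" "b \<in> Arr R" "Src a = Z" "Src b = Z" "Tgt a = Src v" "Tgt b = Src v" by simp_all
  show "a = b"
  proof (rule transf_eqI)
    fix x assume x: "x \<in> Obj I"
    have "At (v \<cdot>\<^bsub>R\<^esub> a) x = At (v \<cdot>\<^bsub>R\<^esub> b) x" "At (s \<cdot>\<^bsub>R\<^esub> a) x = At (s \<cdot>\<^bsub>R\<^esub> b) x" unfolding e by simp_all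
    then have e': "At v x \<cdot> At a x = At v x \<cdot> At b x" "At s x \<cdot> At a x = At s x \<cdot> At b x" using x by simp_all
    show "At a x = At b x"
      by (rule pullback_eq[OF pb[OF x] _ _ _ _ _ _ e', where Z = "OMap Z x"])
        (use R_arrD(9-11)[OF ab(1) x] R_arrD(9-11)[OF ab(2) x] R_arrD(9-11)[OF ar(3) x] ab in simp_all)
  qed (use ab in simp_all)
qed

text \<open>The components of \<open>q\<close> are small, so levelwise pullbacks exist; stability of
  Reedy small fibrations ensures that the resulting diagram is Reedy fibrant and hence an object of
  \<open>R\<close>.\<close>

lemma RS_levelwise_pullback:
  assumes q: "q \<in> RS" and u: "u \<in> Arr R" and e: "Tgt u = Tgt q"
  obtains v s where "v \<in> Arr R" "s \<in> Arr R" "Tgt v = Src q" "Src v = Src s" "Tgt s = Src u"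
    "\<And>x. x \<in> Obj I \<Longrightarrow> is_pullback C (At q x) (At u x) (At v x) (At s x)" "s \<in> RS"
proof -
  have qr: "q \<in> Arr R" "\<And>x. x \<in> Obj I \<Longrightarrow> rs_at q x" using q RS_iff by auto
  have "\<exists>a b. is_pullback C (At q x) (At u x) a b" if x: "x \<in> Obj I" for x
    by (rule fib_pullbackE[OF small_fib[OF RS_small_at[OF q x]], of "At u x"])
      (use R_arrD(9-11)[OF qr(1) x] R_arrD(9-11)[OF u x] e in auto)
  then obtain q1 q2 where pb: "\<And>x. x \<in> Obj I \<Longrightarrow> is_pullback C (At q x) (At u x) (q1 x) (q2 x)" by metis
  let ?Q = "mk_dia (\<lambda>x. Dom C (q1 x)) (\<lambda>x. pb_arr (Src q) (Src u) q1 q2)"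
  let ?v = "mk_tr ?Q (Src q) q1" and ?s = "mk_tr ?Q (Src u) q2"
  have o: "y \<in> Obj I" if "prec y x \<or> y = x" "x \<in> Obj I" for x y using that prec_obj by blast
  have F: "fun_at ?Q x" "nat_at ?v x" "nat_at ?s x" if x: "x \<in> Obj I" for x
    by (rule pb_fun_at[where r = q and g = u and Q = ?Q and ?q1.0 = q1 and ?q2.0 = q2, OF x];
      (simp add: o[OF _ x] R_arrD(1,4,5)[OF qr(1)] R_arrD(1,4,5)[OF u] e pb)?)+
  have X: "obj_at (Src ?s) x \<and> rs_at ?s x" if x: "x \<in> Obj I" for x
    by (rule rs_pullback[where q = q and u = u and v = ?v])
      (use x qr(2) R_arrD(1-5)[OF qr(1)] R_arrD(1-5)[OF u] e F pb in simp_all)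
  have Q: "?Q \<in> Obj R" unfolding R_obj using X F mk_dia_functor by simp
  have v: "?v \<in> Arr R" by (rule mk_tr_arr) (use Q F qr(1) R_arr in simp_all)
  have s: "?s \<in> Arr R" by (rule mk_tr_arr) (use Q F u R_arr in simp_all)
  have sS: "?s \<in> RS" using s X RS_iff by simp
  show thesis by (rule that[OF v s _ _ _ _ sS]) (use pb in simp_all)
qed

text \<open>A pullback in \<open>R\<close> is isomorphic to the levelwise one, and an isomorphism in
  \<open>R\<close> is one at each object. This is needed because \<open>small_fibrations\<close>
  refers to arbitrary pullbacks in \<open>R\<close>.\<close>

lemma R_pullbackD:
  assumes q: "q \<in> RS" and pb: "is_pullback R q u v s"
  shows "s \<in> RS" "x \<in> Obj I \<Longrightarrow> is_pullback C (At q x) (At u x) (At v x) (At s x)"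
proof -
  note P = R.pullbackD[OF pb]
  have e: "Tgt u = Tgt q" "Tgt v = Src q" "Src v = Src s" "Tgt s = Src u" using P by simp_all
  obtain v' s' where *: "v' \<in> Arr R" "s' \<in> Arr R" "Tgt v' = Src q" "Src v' = Src s'" "Tgt s' = Src u"
    "\<And>x. x \<in> Obj I \<Longrightarrow> is_pullback C (At q x) (At u x) (At v' x) (At s' x)"
    using RS_levelwise_pullback[OF q P(2) e(1)] by metis
  have pb': "is_pullback R q u v' s'" by (rule R_pullbackI) (use * P e in simp_all)
  obtain a where a: "is_iso R a" "Dom R a = Dom R v" "Cod R a = Dom R v'" "v' \<cdot>\<^bsub>R\<^esub> a = v" "s' \<cdot>\<^bsub>R\<^esub> a = s"
    by (rule R.pullback_unique[OF pb' pb])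
  obtain b where b: "a \<in> Arr R" "b \<in> Arr R" "Dom R b = Cod R a" "Cod R b = Dom R a"
    "b \<cdot>\<^bsub>R\<^esub> a = Ident R (Dom R a)" "a \<cdot>\<^bsub>R\<^esub> b = Ident R (Cod R a)" using a(1) by (rule R.is_isoE)
  show pbx: "is_pullback C (At q x) (At u x) (At v x) (At s x)" if x: "x \<in> Obj I" for x
  proof -
    have "At (b \<cdot>\<^bsub>R\<^esub> a) x = At (Ident R (Dom R a)) x" "At (a \<cdot>\<^bsub>R\<^esub> b) x = At (Ident R (Cod R a)) x"
      unfolding b by simp_all
    then have "is_iso C (At a x)"
      using x R_arrD(9-11)[OF b(1) x] R_arrD(9-11)[OF b(2) x] b(3,4) by (intro is_isoI[of _ "At b x"]) simp_all
    moreover have "Cod C (At a x) = Dom C (At v' x)" using R_arrD(9-11)[OF b(1) x] R_arrD(9-11)[OF *(1) x] a(3) by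
        simp
    ultimately have "is_pullback C (At q x) (At u x) (At v' x \<cdot> At a x) (At s' x \<cdot> At a x)"
      by (rule pullback_precomp_iso[OF *(6)[OF x]])
    moreover have "At (v' \<cdot>\<^bsub>R\<^esub> a) x = At v x" "At (s' \<cdot>\<^bsub>R\<^esub> a) x = At s x" unfolding a by simp_all
    ultimately show ?thesis using x by simp
  qed
  have "rs_at s x" if x: "x \<in> Obj I" for x
    using rs_pullback[of v q s u, OF e(2,3,4) e(1)[symmetric] _ _ _ _ _ _ _ _ pbx x] q P
      R_arrD(1-5)[OF P(1)] R_arrD(1-5)[OF P(2)] R_arrD(1-5)[OF P(3)] R_arrD(1-5)[OF P(4)] RS_iff by simp
  then show "s \<in> RS" using P(4) RS_iff by simp
qed

section \<open>The induced universe and its small fibrations\<close>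

definition induced_at :: "('i, 'j, 'o, 'a) transf \<Rightarrow> 'i \<Rightarrow> bool" where
  "induced_at q x \<longleftrightarrow> (\<exists>M' c' M c m w1 w2 r q1 q2 e k v.
        lim_at q x M' c' M c m \<and>
        is_product C M' (Cod C p) w1 w2 \<and>
        is_pi C m w1 r q1 q2 e \<and>
        is_matching_map I C (Tgt q) x M c r \<and>
        is_pullback C p (w2 \<cdot> e) v k \<and>
        q1 \<cdot> k = At q x \<and>
        is_matching_map I C (Src q) x M' c' (q2 \<cdot> k))"

lemma induced_fibration_iff:
  "induced_fibration I C p q \<longleftrightarrow> is_natural I C q \<and> (\<forall>x \<in> Obj I. induced_at q x)"
  unfolding induced_fibration_def induced_at_def ..

lemma p_arr: "p \<in> Arr C"
  using F_arr[OF p_fib] .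

lemma product_exists:
  assumes "X \<in> Obj C" "Y \<in> Obj C"
  obtains w1 w2 where "is_product C X Y w1 w2"
proof -
  obtain t where t: "is_terminal C t" using terminal_exists by blast
  obtain f where f: "f \<in> hom C X t" using t assms(1) unfolding is_terminal_def by blast
  obtain g where g: "g \<in> hom C Y t" using t assms(2) unfolding is_terminal_def by blast
  have fg: "f \<in> Arr C" "Dom C f = X" "Cod C f = t" "g \<in> Arr C" "Dom C g = Y" "Cod C g = t"
    using f g by (simp_all add: in_hom)
  have fF: "f \<in> F" by (rule fib_terminal) (use fg t in simp_all)
  obtain a b where ab: "is_pullback C f g a b" by (rule fib_pullbackE[OF fF fg(4)]) (use fg in simp_all)
  have "is_product C (Dom C f) (Dom C g) a b" using product_iff_pullback[OF t fg(1,3,4,6)] ab by blast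
  then show thesis using that fg by simp
qed

lemma product_fib:
  assumes w: "is_product C X Y w1 w2" and o: "X \<in> Obj C" "Y \<in> Obj C"
  shows "w1 \<in> F"
proof -
  obtain t where t: "is_terminal C t" using terminal_exists by blast
  obtain f where f: "f \<in> hom C X t" using t o(1) unfolding is_terminal_def by blast
  obtain g where g: "g \<in> hom C Y t" using t o(2) unfolding is_terminal_def by blast
  have fg: "f \<in> Arr C" "Dom C f = X" "Cod C f = t" "g \<in> Arr C" "Dom C g = Y" "Cod C g = t"
    using f g by (simp_all add: in_hom)
  have gF: "g \<in> F" by (rule fib_terminal) (use fg t in simp_all)
  have "is_pullback C f g w1 w2" using product_iff_pullback[OF t fg(1,3,4,6)] w fg by simp
  then show ?thesis by (rule fib_pullback[OF gF pullback_swap])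
qed

lemma productD:
  assumes "is_product C X Y w1 w2"
  shows "w1 \<in> Arr C" "w2 \<in> Arr C" "Dom C w2 = Dom C w1" "Cod C w1 = X" "Cod C w2 = Y"
proof -
  have "w1 \<in> hom C (Dom C w1) X" "w2 \<in> hom C (Dom C w1) Y" using assms unfolding is_product_def by blast+
  then show "w1 \<in> Arr C" "w2 \<in> Arr C" "Dom C w2 = Dom C w1" "Cod C w1 = X" "Cod C w2 = Y"
    by (simp_all add: in_hom)
qed

lemma product_ex:
  assumes "is_product C X Y w1 w2" "a \<in> Arr C" "b \<in> Arr C" "Dom C a = Z" "Dom C b = Z" "Cod C a = X" "Cod C b = Y"
  obtains u where "u \<in> Arr C" "Dom C u = Z" "Cod C u = Dom C w1" "w1 \<cdot> u = a" "w2 \<cdot> u = b"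
proof -
  have "a \<in> hom C Z X" "b \<in> hom C Z Y" using assms by (simp_all add: in_hom)
  then obtain u where "u \<in> hom C Z (Dom C w1)" "w1 \<cdot> u = a" "w2 \<cdot> u = b"
    using assms(1) unfolding is_product_def by blast
  then show thesis by (intro that[of u]) (simp_all add: in_hom)
qed

text \<open>\<open>pi_exists\<close> promises one dependent product that is a fibration, whereas the
  induced fibration may use any; the two differ by an isomorphism.\<close>

lemma pi_fib:
  assumes pi: "is_pi C g f r q1 q2 e" and "g \<in> F" "f \<in> F"
  shows "r \<in> F"
proof -
  note P = is_piD[OF pi]
  obtain r' q1' q2' e' where r': "is_pi C g f r' q1' q2' e'" "r' \<in> F" using pi_exists[OF assms(2,3) P(3)] by blast
  obtain a where "is_iso C a" "Cod C a = Dom C r'" "r' \<cdot> a = r" using is_pi_unique[OF pi r'(1)] by blast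
  then show ?thesis using fib_comp[OF fib_iso r'(2)] by metis
qed

text \<open>The domain \<open>Q\<close> of the evaluation map is the gap object of \<open>q\<close>,
  with \<open>q2\<close> to the matching object of the source and \<open>q1\<close> to the value of
  the target. The gap map is therefore \<open>k\<close>, small as a pullback of
  \<open>p\<close>.\<close>

lemma induced_at_rs:
  assumes x: "x \<in> Obj I" and A: "\<And>y. prec y x \<Longrightarrow> obj_at (Src q) y" "\<And>y. prec y x \<Longrightarrow> obj_at (Tgt q) y"
    and rs: "\<And>y. prec y x \<Longrightarrow> rs_at q y" and fn: "fun_at (Src q) x" "fun_at (Tgt q) x" "nat_at q x"
    and ind: "induced_at q x"
  shows "obj_at (Src q) x" "obj_at (Tgt q) x" "rs_at q x"
proof -
  obtain M' c' M c m w1 w2 r q1 q2 e k v where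
    l: "lim_at q x M' c' M c m" and w: "is_product C M' (Cod C p) w1 w2" and pi: "is_pi C m w1 r q1 q2 e"
    and r: "is_matching_map I C (Tgt q) x M c r" and k: "is_pullback C p (w2 \<cdot> e) v k"
    and qx: "q1 \<cdot> k = At q x" and k': "is_matching_map I C (Src q) x M' c' (q2 \<cdot> k)"
    using ind unfolding induced_at_def by (elim exE conjE)
  note L = lim_mapD[OF l] and P = is_piD[OF pi] and W = productD[OF w] and K = pullbackD[OF k]
  note Q = pullbackD[OF P(4)]
  have mS: "m \<in> S" by (rule lim_map_small[OF x A rs l])
  have w1: "w1 \<in> F" by (rule product_fib[OF w]) (use matching_objectD(1)[OF L(1)] p_arr in simp_all)
  have rF: "r \<in> F" by (rule pi_fib[OF pi small_fib[OF mS] w1])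
  have kS: "k \<in> S" using k unfolding small_fibrations_def by blast
  have q2: "q2 \<in> F" by (rule fib_pullback[OF rF P(4)])
  have kd: "Cod C k = Dom C q1" using K(8) P W by simp
  have "q2 \<cdot> k \<in> F" using fib_comp[OF small_fib[OF kS] q2] kd Q(6) by simp
  then show "obj_at (Src q) x" using k' fn unfolding obj_at_def fib_at_def by blast
  show "obj_at (Tgt q) x" using r rF fn unfolding obj_at_def fib_at_def by blast
  have "gap_map q x M' c' M c m (q2 \<cdot> k) r q2 q1 k"
    unfolding gap_map_def gap_square_def
    using l r pullback_swap[OF P(4)] k' K(4) kd Q(3,4,6) qx matching_mapD(3)[OF k'] by simp
  then show "rs_at q x" using kS fn(3) unfolding rs_at_def relative_matching_map_iff by blast
qed

lemma induced_at_cong: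
  assumes "\<And>y. prec y x \<or> y = x \<Longrightarrow> agree (Src t) (Src s) y" "\<And>y. prec y x \<or> y = x \<Longrightarrow> agree (Tgt t) (Tgt s) y"
    "\<And>y. prec y x \<or> y = x \<Longrightarrow> At t y = At s y" "induced_at t x"
  shows "induced_at s x"
proof -
  have l: "lim_at t x = lim_at s x" by (rule lim_at_cong) (use assms in simp_all)
  have m: "is_matching_map I C (Src t) x M c k = is_matching_map I C (Src s) x M c k"
      "is_matching_map I C (Tgt t) x M c k = is_matching_map I C (Tgt s) x M c k" for M c k
    using assms(1,2) matching_map_cong[of x "Src t" "Src s"] matching_map_cong[of x "Src s" "Src t"]
      matching_map_cong[of x "Tgt t" "Tgt s"] matching_map_cong[of x "Tgt s" "Tgt t"] agree_sym by metis+
  have "At t x = At s x" using assms(3) by simp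
  then show ?thesis using assms(4) unfolding induced_at_def l m by simp
qed

lemma induced_fibration_RS:
  assumes "induced_fibration I C p q"
  shows "q \<in> RS"
proof -
  have n: "is_natural I C q" and ind: "\<And>x. x \<in> Obj I \<Longrightarrow> induced_at q x"
    using assms unfolding induced_fibration_iff by auto
  have *: "obj_at (Src q) x \<and> obj_at (Tgt q) x \<and> rs_at q x" if "x \<in> Obj I" for x
    using that
  proof (induction x rule: prec_induct)
    case (less x)
    then show ?case using induced_at_rs[of x q] ind[of x] n unfolding is_natural_iff is_functor_iff by blast
  qed
  then have "Src q \<in> Obj R" "Tgt q \<in> Obj R" using n unfolding R_obj is_natural_iff by simp_all
  then show ?thesis using n * unfolding RS_iff R_arr by blast
qed

lemma induced_fibration_exists: "\<exists>q. induced_fibration I C p q"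
proof -
  \<comment> \<open>The raw data at an object are the value of the base and its outgoing arrows, the
    same two for the total diagram, and the component of the transformation.\<close>
  define V :: "('i \<Rightarrow> 'o \<times> ('j \<Rightarrow> 'a) \<times> 'o \<times> ('j \<Rightarrow> 'a) \<times> 'a) \<Rightarrow> ('i, 'j, 'o, 'a) diagram" where
    "V g = mk_dia (\<lambda>x. fst (g x)) (\<lambda>x. fst (snd (g x)))" for g
  define W :: "('i \<Rightarrow> 'o \<times> ('j \<Rightarrow> 'a) \<times> 'o \<times> ('j \<Rightarrow> 'a) \<times> 'a) \<Rightarrow> ('i, 'j, 'o, 'a) diagram" where
    "W g = mk_dia (\<lambda>x. fst (snd (snd (g x)))) (\<lambda>x. fst (snd (snd (snd (g x)))))" for g
  define q where "q g = mk_tr (W g) (V g) (\<lambda>x. snd (snd (snd (snd (g x)))))" for g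
  have ST: "Src (q g) = W g" "Tgt (q g) = V g" for g by (simp_all add: q_def)
  define Q where "Q g x \<longleftrightarrow> fun_at (W g) x \<and> fun_at (V g) x \<and> nat_at (q g) x \<and> induced_at (q g) x" for g x
  have agr: "agree (W g) (W g') y" "agree (V g) (V g') y" "At (q g) y = At (q g') y" if "g y = g' y" "y \<in> Obj I" for
      g g' y
    using that by (simp_all add: W_def V_def q_def mk_dia_agree)
  have "\<exists>g. \<forall>x \<in> Obj I. Q g x"
  proof (rule prec_recursion)
    fix g g' :: "'i \<Rightarrow> 'o \<times> ('j \<Rightarrow> 'a) \<times> 'o \<times> ('j \<Rightarrow> 'a) \<times> 'a" and x
    assume x: "x \<in> Obj I" and e: "\<And>y. y = x \<or> prec y x \<Longrightarrow> g y = g' y" and "Q g x"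
    have a: "agree (W g) (W g') y" "agree (V g) (V g') y" "At (q g) y = At (q g') y" if "prec y x \<or> y = x" for y
      using agr[of g y g'] e[of y] that x prec_obj by blast+
    from \<open>Q g x\<close> show "Q g' x"
      unfolding Q_def
      using fun_at_cong[OF a(1) x] fun_at_cong[OF a(2) x] nat_at_cong[of x "q g" "q g'", unfolded ST, OF a x]
        induced_at_cong[of x "q g" "q g'", unfolded ST, OF a] by blast
  next
    fix g :: "'i \<Rightarrow> 'o \<times> ('j \<Rightarrow> 'a) \<times> 'o \<times> ('j \<Rightarrow> 'a) \<times> 'a" and x
    assume x: "x \<in> Obj I" and IH: "\<And>y. prec y x \<Longrightarrow> Q g y"
    \<comment> \<open>The recursion predicate records only functoriality, naturality and the
      defining condition. The Reedy conditions below \<open>x\<close> are recovered from these by an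
      inner induction.\<close>
    have B: "prec y x \<Longrightarrow> obj_at (Src (q g)) y \<and> obj_at (Tgt (q g)) y \<and> rs_at (q g) y" if "y \<in> Obj I" for y
      using that
    proof (induction y rule: prec_induct)
      case (less y)
      then show ?case using induced_at_rs[of y "q g"] IH[of y] prec_trans[of _ y x] unfolding Q_def ST by blast
    qed
    then have ob: "\<And>y. prec y x \<Longrightarrow> obj_at (Src (q g)) y" "\<And>y. prec y x \<Longrightarrow> obj_at (Tgt (q g)) y"
      "\<And>y. prec y x \<Longrightarrow> rs_at (q g) y" using prec_obj by blast+
    obtain M' c' where M': "is_matching_object I C (Src (q g)) x M' c'" by (rule matching_object_exists[OF x ob(1)])
    obtain M c where M: "is_matching_object I C (Tgt (q g)) x M c" by (rule matching_object_exists[OF x ob(2)])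
    obtain m where m: "lim_at (q g) x M' c' M c m"
      by (rule lim_map_exists[OF M' M obj_fun[OF ob(1)] obj_fun[OF ob(2)] rs_nat[OF ob(3)]])
    have mS: "m \<in> S" by (rule lim_map_small[OF x ob m])
    note L = lim_mapD[OF m]
    have o: "M' \<in> Obj C" "Cod C p \<in> Obj C" using matching_objectD(1)[OF M'] p_arr by simp_all
    obtain w1 w2 where w: "is_product C M' (Cod C p) w1 w2" by (rule product_exists[OF o])
    note Wd = productD[OF w]
    obtain r q1 q2 e where pi: "is_pi C m w1 r q1 q2 e"
      using pi_exists[OF small_fib[OF mS] product_fib[OF w o]] L(4) Wd(4) by auto
    note P = is_piD[OF pi]
    note Qd = pullbackD[OF P(4)]
    obtain v k where k: "is_pullback C p (w2 \<cdot> e) v k"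
      by (rule fib_pullbackE[OF p_fib, of "w2 \<cdot> e"]) (use P Wd in simp_all)
    note K = pullbackD[OF k]
    have kd: "Cod C k = Dom C q1" using K(8) P Wd by simp
    \<comment> \<open>The matching maps \<open>r\<close> and \<open>q2 \<cdot> k\<close> prescribe
      all arrows out of \<open>x\<close> except the identity, hence the case distinction.\<close>
    define z where "z = (Dom C r, (\<lambda>f. if f = Ident I x then Ident C (Dom C r) else c f \<cdot> r),
       Dom C k, (\<lambda>f. if f = Ident I x then Ident C (Dom C k) else c' f \<cdot> (q2 \<cdot> k)), q1 \<cdot> k)"
    let ?g = "g(x := z)"
    have ag: "agree (W g) (W ?g) y" "agree (V g) (V ?g) y" "At (q g) y = At (q ?g) y" if "prec y x" for y
    proof -
      have "g y = ?g y" using that by auto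
      then show "agree (W g) (W ?g) y" "agree (V g) (V ?g) y" "At (q g) y = At (q ?g) y"
        using agr[of g y ?g] prec_obj(1)[OF that] by blast+
    qed
    have l: "lim_at (q g) x = lim_at (q ?g) x" by (rule lim_at_cong) (use ag ST in simp_all)
    note m' = m[unfolded l]
    note L' = lim_mapD[OF m', unfolded ST]
    have Q': "Q ?g y" if y: "prec y x" for y
    proof -
      have yo: "y \<in> Obj I" using y prec_obj by blast
      have a: "agree (W g) (W ?g) u" "agree (V g) (V ?g) u" "At (q g) u = At (q ?g) u" if "prec u y \<or> u = y" for u
        using ag[of u] that y prec_trans[of u y x] by blast+
      from IH[OF y] show ?thesis
        unfolding Q_def
        using fun_at_cong[OF a(1) yo] fun_at_cong[OF a(2) yo] nat_at_cong[of y "q g" "q ?g", unfolded ST, OF a yo]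
          induced_at_cong[of y "q g" "q ?g", unfolded ST, OF a] by blast
    qed
    then have Q'': "\<And>y. prec y x \<Longrightarrow> fun_at (W ?g) y" "\<And>y. prec y x \<Longrightarrow> fun_at (V ?g) y" "\<And>y. prec y x \<Longrightarrow> nat_at (q ?g) y"
      unfolding Q_def by blast+
    have V: "OMap (V ?g) x = Dom C r" "AMap (V ?g) (Ident I x) = Ident C (Dom C r)"
      "\<And>f. f \<in> out x \<Longrightarrow> AMap (V ?g) f = c f \<cdot> r"
      using x by (simp_all add: V_def z_def Obj_strict_coslice)
    have W: "OMap (W ?g) x = Dom C k" "AMap (W ?g) (Ident I x) = Ident C (Dom C k)"
      "\<And>f. f \<in> out x \<Longrightarrow> AMap (W ?g) f = c' f \<cdot> (q2 \<cdot> k)"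
      using x by (simp_all add: W_def z_def Obj_strict_coslice)
    have q: "At (q ?g) x = q1 \<cdot> k" using x by (simp add: q_def z_def)
    note ar = Qd K(4) kd L(3-5)
    have FV: "fun_at (V ?g) x" "is_matching_map I C (V ?g) x M c r"
      by (rule fun_at_extend[OF x Q''(2) L'(2) _ _ _ V(3)]; (use ar V in simp)?)+
    have FW: "fun_at (W ?g) x" "is_matching_map I C (W ?g) x M' c' (q2 \<cdot> k)"
      by (rule fun_at_extend[OF x Q''(1) L'(1) _ _ _ W(3)]; (use ar W in simp)?)+
    have N: "nat_at (q ?g) x"
    proof (rule nat_at_extend[OF x _ _ m' _ _ _ _ _ Q''(3)])
      show "r \<cdot> At (q ?g) x = m \<cdot> (q2 \<cdot> k)" unfolding q using ar by (simp add: Qd(9)[THEN reassoc])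
    qed (use FV FW q V W ar in \<open>simp_all add: ST\<close>)
    have "induced_at (q ?g) x"
      unfolding induced_at_def ST
      by (intro exI conjI) (rule m' w pi FV(2) k q[symmetric] FW(2))+
    then have "Q ?g x" unfolding Q_def using FV FW N by blast
    then show "\<exists>z. Q (g(x := z)) x" by blast
  qed
  then obtain g where g: "\<And>x. x \<in> Obj I \<Longrightarrow> Q g x" by blast
  have "is_natural I C (q g)"
    unfolding q_def
    by (rule mk_tr_natural, unfold q_def[symmetric]) (use g in \<open>simp_all add: Q_def W_def V_def mk_dia_functor\<close>)
  then show ?thesis using g unfolding induced_fibration_iff Q_def by blast
qed

text \<open>A classifying square is built by recursion from pairs of components. The gap object of
  \<open>t\<close> serves simultaneously as domain of a classifying map in \<open>C\<close> and as
  the pullback occurring in the universal property of the dependent product.\<close>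

lemma RS_classified:
  assumes ind: "induced_fibration I C p q" and t: "t \<in> RS"
  shows "t \<in> small_fibrations R q"
proof -
  have qS: "q \<in> RS" by (rule induced_fibration_RS[OF ind])
  have qr: "q \<in> Arr R" "\<And>x. x \<in> Obj I \<Longrightarrow> rs_at q x" using qS RS_iff by auto
  have tr: "t \<in> Arr R" "\<And>x. x \<in> Obj I \<Longrightarrow> rs_at t x" using t RS_iff by auto
  define U where "U g = mk_tr (Tgt t) (Tgt q) (\<lambda>x. fst (g x))" for g :: "'i \<Rightarrow> 'a \<times> 'a"
  define V where "V g = mk_tr (Src t) (Src q) (\<lambda>x. snd (g x))" for g :: "'i \<Rightarrow> 'a \<times> 'a"
  have ST: "Src (U g) = Tgt t" "Tgt (U g) = Tgt q" "Src (V g) = Src t" "Tgt (V g) = Src q" for g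
    by (simp_all add: U_def V_def)
  have At: "At (U g) x = fst (g x)" "At (V g) x = snd (g x)" if "x \<in> Obj I" for g x
    using that by (simp_all add: U_def V_def)
  \<comment> \<open>The pullback square belongs to the invariant because at later objects it is
    passed to the limit.\<close>
  define Q where "Q g x \<longleftrightarrow> nat_at (U g) x \<and> nat_at (V g) x \<and> is_pullback C (At q x) (fst (g x)) (snd (g x)) (At t x)"
      for g x
  have agr: "agree A A y" for A y by (simp add: agree_def)
  have Qcong: "Q g' x" if "x \<in> Obj I" "\<And>y. y = x \<or> prec y x \<Longrightarrow> g y = g' y" "Q g x" for g g' x
  proof -
    have e: "At (U g) y = At (U g') y" "At (V g) y = At (V g') y" if "prec y x \<or> y = x" for y
      using At[of y] that(1) \<open>\<And>y. y = x \<or> prec y x \<Longrightarrow> g y = g' y\<close>[of y] \<open>x \<in> Obj I\<close> prec_obj(1)[of y x] by auto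
    show ?thesis using that(3) that(2)[of x] nat_at_cong[of x "U g" "U g'", unfolded ST, OF agr agr e(1) that(1)]
        nat_at_cong[of x "V g" "V g'", unfolded ST, OF agr agr e(2) that(1)] unfolding Q_def by simp
  qed
  have "\<exists>g. \<forall>x \<in> Obj I. Q g x"
  proof (rule prec_recursion)
    fix g :: "'i \<Rightarrow> 'a \<times> 'a" and x
    assume x: "x \<in> Obj I" and IH: "\<And>y. prec y x \<Longrightarrow> Q g y"
    have o: "y \<in> Obj I" if "prec y x" for y using that prec_obj by blast
    have o': "y \<in> Obj I" if "prec y x \<or> y = x" for y using that prec_obj x by blast
    have "induced_at q x" using ind x unfolding induced_fibration_iff by blast
    then obtain M' c' M c m w1 w2 r q1 q2 e k v where
      lq: "lim_at q x M' c' M c m" and w: "is_product C M' (Cod C p) w1 w2" and pi: "is_pi C m w1 r q1 q2 e"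
      and r: "is_matching_map I C (Tgt q) x M c r" and k: "is_pullback C p (w2 \<cdot> e) v k"
      and qx: "q1 \<cdot> k = At q x" and k': "is_matching_map I C (Src q) x M' c' (q2 \<cdot> k)"
      unfolding induced_at_def by (elim exE conjE)
    obtain K a N d mt kA kB g1 g2 gt where gm: "gap_map t x K a N d mt kA kB g1 g2 gt" and gS: "gt \<in> S"
      by (rule rs_gap_mapE[OF x R_arrD(2)[OF tr(1) o'] R_arrD(3)[OF tr(1) o'] tr(2)[OF o']])
    note G = gap_mapD[OF gm]
    note H = gap_squareD[OF G(1)]
    note LQ = lim_mapD[OF lq] and LT = lim_mapD[OF H(1)] and P = is_piD[OF pi] and W = productD[OF w] and K =
        pullbackD[OF k]
    note PQ = pullbackD[OF P(4)] and PH = pullbackD[OF H(3)]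
    have nU: "\<And>y. prec y x \<Longrightarrow> nat_at (U g) y" and nV: "\<And>y. prec y x \<Longrightarrow> nat_at (V g) y"
      and pb: "\<And>y. prec y x \<Longrightarrow> is_pullback C (At q y) (At (U g) y) (At (V g) y) (At t y)"
      using IH o At unfolding Q_def by simp_all
    obtain mu where mu: "lim_at (U g) x N d M c mu"
      by (rule lim_map_exists[of "U g", unfolded ST, OF LT(2) LQ(2) R_arrD(5)[OF tr(1) o] R_arrD(5)[OF qr(1) o] nU])
    obtain mv where mv: "lim_at (V g) x K a M' c' mv"
      by (rule lim_map_exists[of "V g", unfolded ST, OF LT(1) LQ(1) R_arrD(4)[OF tr(1) o] R_arrD(4)[OF qr(1) o] nV])
    note LU = lim_mapD[OF mu] and LV = lim_mapD[OF mv]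
    have 1: "is_pullback C m mu mv mt"
    proof (rule lim_pullback[OF _ _ _ _ lq mu mv H(1)])
      show "\<And>y. prec y x \<Longrightarrow> fun_at (Src q) y" "\<And>y. prec y x \<Longrightarrow> fun_at (Tgt q) y"
        using R_arrD(4,5)[OF qr(1) o] by blast+
      show "\<And>y. prec y x \<Longrightarrow> fun_at (Src (U g)) y" "\<And>y. prec y x \<Longrightarrow> fun_at (Src (V g)) y"
        unfolding ST using R_arrD(4,5)[OF tr(1) o] by blast+
      show "\<And>y. prec y x \<Longrightarrow> nat_at t y" using R_arrD(1)[OF tr(1) o] by blast
    qed (use nV pb ST in simp_all)
    \<comment> \<open>This identifies the gap object of \<open>t\<close> with the pullback of
      \<open>m\<close> along \<open>mu \<cdot> kB\<close>, as required for transposing across the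
      dependent product along \<open>m\<close>.\<close>
    have 2: "is_pullback C m (mu \<cdot> kB) (mv \<cdot> g1) g2" by (rule pullback_paste[OF 1 H(3)])
    obtain u' v' where ch: "is_pullback C p u' v' gt" using p_pullback[OF gS] by blast
    note CH = pullbackD[OF ch]
    note kB = matching_mapD(2-4)[OF H(2)] and kA = matching_mapD(2-4)[OF G(2)]
    note ar = PH LT(3-5) LU(3-5) LV(3-5) LQ(3-5) kB kA G(3-5)
    have a1: "mv \<cdot> g1 \<in> Arr C" "Dom C (mv \<cdot> g1) = Dom C g1" "Cod C (mv \<cdot> g1) = M'"
      using ar by simp_all
    \<comment> \<open>The first component keeps the map over the matching object of the total
      diagram; the second is the classifying map \<open>u'\<close> of the gap map.\<close>
    obtain kk where kk: "kk \<in> Arr C" "Dom C kk = Dom C g1" "Cod C kk = Dom C w1" "w1 \<cdot> kk = mv \<cdot> g1" "w2 \<cdot> kk = u'"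
      by (rule product_ex[OF w a1(1) CH(2) a1(2)]) (use a1 CH G(5) in simp_all)
    \<comment> \<open>\<open>uu\<close> is the transpose of \<open>kk\<close> and the new component
      on bases; \<open>vv\<close> is its pullback to gap objects, so evaluation after
      \<open>vv\<close> returns \<open>u'\<close>.\<close>
    obtain uu vv where uu: "uu \<in> Arr C" "Dom C uu = Dom C (mu \<cdot> kB)" "Cod C uu = Dom C r" "r \<cdot> uu = mu \<cdot> kB"
        "vv \<in> Arr C" "Dom C vv = Dom C g2" "Cod C vv = Dom C q1" "q1 \<cdot> vv = uu \<cdot> g2" "q2 \<cdot> vv = mv \<cdot> g1" "e \<cdot> vv = kk"
      by (rule is_pi_ex[OF pi pullback_swap[OF 2], of kk]) (use kk a1 ar in simp_all)
    have du: "Dom C uu = OMap (Tgt t) x" using uu(2) ar by simp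
    have e1: "w2 \<cdot> e \<cdot> vv = u'" using uu(5-7,10) kk P W by simp
    have e2: "p \<cdot> v' = w2 \<cdot> e \<cdot> (vv \<cdot> gt)"
      using CH(9) kk uu(5-7,10) P W ar by (simp add: uu(10)[THEN reassoc] kk(5)[THEN reassoc])
    obtain vx where vx: "vx \<in> Arr C" "Dom C vx = Dom C gt" "Cod C vx = Dom C v" "v \<cdot> vx = v'" "k \<cdot> vx = vv \<cdot> gt"
      by (rule pullback_ex[OF k _ _ _ _ _ _ e2, where Z = "Dom C gt"])
        (use CH uu(5-7) K(2,8) P W ar in simp_all)
    have 3: "is_pullback C k vv vx gt"
    proof (rule pullback_unpaste[OF k])
      show "is_pullback C p (w2 \<cdot> e \<cdot> vv) (v \<cdot> vx) gt" unfolding e1 vx(4) by (rule ch)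
    qed (use vx uu K ar P W in simp_all)
    have 4: "is_pullback C q1 uu vv g2"
    proof (rule pullback_unpaste[OF pullback_swap[OF P(4)]])
      show "is_pullback C m (r \<cdot> uu) (q2 \<cdot> vv) g2" unfolding uu(4,9) by (rule 2)
    qed (use uu PQ ar du in simp_all)
    \<comment> \<open>The component of \<open>q\<close> factors as \<open>q1 \<cdot> k\<close> and
      that of \<open>t\<close> as \<open>g2 \<cdot> gt\<close>; square \<open>3\<close> lies over
      the gap maps and square \<open>4\<close> over the projections.\<close>
    have 5: "is_pullback C (At q x) uu vx (At t x)"
      using pullback_swap[OF pullback_paste[OF pullback_swap[OF 4] pullback_swap[OF 3]]] unfolding qx G(7) .
    let ?g = "g(x := (uu, vx))"
    have eg: "g y = ?g y" if "prec y x" for y using that by auto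
    have Q': "Q ?g y" if y: "prec y x" for y
      by (rule Qcong[OF o[OF y] _ IH[OF y]]) (use y eg prec_trans in blast)
    have Atx: "At (U ?g) x = uu" "At (V ?g) x = vx" using At[OF x] by simp_all
    have Aty: "At (U g) y = At (U ?g) y" "At (V g) y = At (V ?g) y" if "prec y x" for y
      using At[OF o[OF that]] eg[OF that] by simp_all
    have lU: "lim_at (U g) x = lim_at (U ?g) x" by (rule lim_at_cong) (use Aty ST agr in simp_all)
    have lV: "lim_at (V g) x = lim_at (V ?g) x" by (rule lim_at_cong) (use Aty ST agr in simp_all)
    have "nat_at (U ?g) x"
      by (rule nat_at_extend[of x "U ?g", unfolded ST Atx, OF x R_arrD(5)[OF tr(1) x] R_arrD(5)[OF qr(1) x]
            mu[unfolded lU] H(2) r uu(1) du _ _ uu(4)])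
        (use Q' uu(3) matching_mapD(3)[OF r] in \<open>simp_all add: Q_def\<close>)
    moreover have "nat_at (V ?g) x"
    proof (rule nat_at_extend[of x "V ?g", unfolded ST Atx, OF x R_arrD(4)[OF tr(1) x] R_arrD(4)[OF qr(1) x]
            mv[unfolded lV] G(2) k' vx(1)])
      show "q2 \<cdot> k \<cdot> vx = mv \<cdot> kA"
        using vx uu K(4,6,8) P W PQ(3,4,6) ar G(6) by (simp add: uu(9)[THEN reassoc])
    qed (use Q' vx G(4) matching_mapD(3)[OF k'] K(4,6,8) PQ P W in \<open>simp_all add: Q_def\<close>)
    ultimately have "Q ?g x" unfolding Q_def using 5 by simp
    then show "\<exists>z. Q (g(x := z)) x" by blast
  qed (rule Qcong)
  then obtain g where g: "\<And>x. x \<in> Obj I \<Longrightarrow> Q g x" by blast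
  have "U g \<in> Arr R" "V g \<in> Arr R"
    using g qr(1)[unfolded R_arr] tr(1)[unfolded R_arr] unfolding U_def V_def Q_def by (simp_all add: mk_tr_arr)
  then have "is_pullback R q (U g) (V g) t"
    by (intro R_pullbackI qr(1) tr(1)) (use g At ST in \<open>simp_all add: Q_def\<close>)
  then show ?thesis unfolding small_fibrations_def by blast
qed

lemma small_fibrations_eq_RS:
  assumes "induced_fibration I C p q"
  shows "small_fibrations R q = RS"
  using RS_classified[OF assms] R_pullbackD(1)[OF induced_fibration_RS[OF assms]]
  unfolding small_fibrations_def by blast

lemma RS_ident: "A \<in> Obj R \<Longrightarrow> Ident R A \<in> RS"
  unfolding RS_iff using R_ident_arr
  by (auto simp: R_obj intro!: rs_ident[where A = A] dest: prec_obj)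

lemma RS_comp:
  assumes f: "f \<in> RS" and g: "g \<in> RS" and e: "Tgt f = Src g"
  shows "g \<cdot>\<^bsub>R\<^esub> f \<in> RS"
proof -
  have fr: "f \<in> Arr R" "\<And>x. x \<in> Obj I \<Longrightarrow> rs_at f x" using f RS_iff by auto
  have gr: "g \<in> Arr R" "\<And>x. x \<in> Obj I \<Longrightarrow> rs_at g x" using g RS_iff by auto
  have c: "g \<cdot>\<^bsub>R\<^esub> f \<in> Arr R" by (rule R_comp_arr[OF fr(1) gr(1) e])
  have "rs_at (g \<cdot>\<^bsub>R\<^esub> f) x" if x: "x \<in> Obj I" for x
  proof -
    have o: "y \<in> Obj I" if "prec y x \<or> y = x" for y using that prec_obj x by blast
    show ?thesis
      by (rule rs_comp[of f g, OF e _ _ _ R_arrD(1)[OF c o] x R_arrD(2)[OF fr(1) o] R_arrD(3)[OF fr(1) o] R_arrD(3)[OF gr(1) o]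
        fr(2)[OF o] gr(2)[OF o]]) (use o in simp_all)
  qed
  then show ?thesis using c RS_iff by blast
qed

section \<open>Lifting and factorization\<close>

lemma obj_at_cong:
  assumes "\<And>y. prec y x \<or> y = x \<Longrightarrow> agree A B y" "x \<in> Obj I" "obj_at A x"
  shows "obj_at B x"
  using fun_at_cong[OF assms(1,2)] matching_map_cong[OF assms(1)] assms(3) unfolding obj_at_def fib_at_def by blast

lemma rs_at_cong:
  assumes "\<And>y. prec y x \<or> y = x \<Longrightarrow> agree (Src t) (Src s) y" "\<And>y. prec y x \<or> y = x \<Longrightarrow> agree (Tgt t) (Tgt s) y"
    "\<And>y. prec y x \<or> y = x \<Longrightarrow> At t y = At s y" "x \<in> Obj I" "rs_at t x"
  shows "rs_at s x"
proof -
  obtain k where k: "is_relative_matching_map I C t x k" and kS: "k \<in> S" using assms(5) unfolding rs_at_def by blast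
  obtain M c N d m kA kB g1 g2 where g: "gap_map t x M c N d m kA kB g1 g2 k"
    using k unfolding relative_matching_map_iff by (elim exE)
  have "lim_at t x = lim_at s x" by (rule lim_at_cong) (use assms in simp_all)
  moreover have "OMap (Src t) x = OMap (Src s) x" using assms(1)[of x] by (simp add: agree_def)
  ultimately have "gap_map s x M c N d m kA kB g1 g2 k"
    using g matching_map_cong[OF assms(1)] matching_map_cong[OF assms(2)] assms(3)[of x]
    unfolding gap_map_def gap_square_def by simp
  then have "is_relative_matching_map I C s x k" unfolding relative_matching_map_iff by blast
  then show ?thesis using kS nat_at_cong[OF assms(1-4) rs_nat[OF assms(5)]] unfolding rs_at_def by blast
qed

lemma acyclic_cofibrationE:
  assumes "acyclic_cofibration C F i" "q \<in> F" "u \<in> Arr C" "Dom C u = Dom C i" "Cod C u = Dom C q"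
    "v \<in> Arr C" "Dom C v = Cod C i" "Cod C v = Cod C q" "q \<cdot> u = v \<cdot> i"
  obtains h where "h \<in> Arr C" "Dom C h = Cod C i" "Cod C h = Dom C q" "h \<cdot> i = u" "q \<cdot> h = v"
proof -
  have "u \<in> hom C (Dom C i) (Dom C q)" "v \<in> hom C (Cod C i) (Cod C q)" using assms by (simp_all add: in_hom)
  then obtain h where "h \<in> hom C (Cod C i) (Dom C q)" "h \<cdot> i = u" "q \<cdot> h = v"
    using assms(1,2,9) unfolding acyclic_cofibration_def by blast
  then show thesis by (intro that[of h]) (simp_all add: in_hom)
qed

text \<open>The bottom map \<open>th\<close> of the lifting problem at \<open>x\<close> is assembled
  from the lifts chosen below \<open>x\<close> and from \<open>v\<close> at \<open>x\<close>. A
  filler then restricts correctly to the matching object, so it extends the natural family.\<close>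

lemma levelwise_acyclic_cofibration:
  assumes i: "i \<in> Arr R" and ac: "\<And>x. x \<in> Obj I \<Longrightarrow> acyclic_cofibration C F (At i x)"
  shows "acyclic_cofibration R (reedy_fibrations I C F) i"
  unfolding acyclic_cofibration_def
proof (intro conjI ballI impI i)
  fix q u v
  assume q: "q \<in> reedy_fibrations I C F" and "u \<in> hom R (Dom R i) (Dom R q)" "v \<in> hom R (Cod R i) (Cod R q)"
    and e: "q \<cdot>\<^bsub>R\<^esub> u = v \<cdot>\<^bsub>R\<^esub> i"
  then have u: "u \<in> Arr R" "Src u = Src i" "Tgt u = Src q" and v: "v \<in> Arr R" "Src v = Tgt i" "Tgt v = Tgt q"
    unfolding R.in_hom by simp_all
  have qr: "q \<in> Arr R" "\<And>x. x \<in> Obj I \<Longrightarrow> \<exists>k. is_relative_matching_map I C q x k \<and> k \<in> F"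
    using q unfolding reedy_fibrations_def reedy_fibration_def reedy_class_def by blast+
  have ex: "At q x \<cdot> At u x = At v x \<cdot> At i x" if "x \<in> Obj I" for x
  proof -
    have "At (q \<cdot>\<^bsub>R\<^esub> u) x = At (v \<cdot>\<^bsub>R\<^esub> i) x" unfolding e ..
    then show ?thesis using that by simp
  qed
  define H where "H g = mk_tr (Tgt i) (Src q) g" for g
  have ST: "Src (H g) = Tgt i" "Tgt (H g) = Src q" for g by (simp_all add: H_def)
  have At: "At (H g) x = g x" if "x \<in> Obj I" for g x using that by (simp add: H_def)
  define Q where "Q g x \<longleftrightarrow> nat_at (H g) x \<and> g x \<cdot> At i x = At u x \<and> At q x \<cdot> g x = At v x" for g x
  have agr: "agree A A y" for A y by (simp add: agree_def)
  have Qcong: "Q g' x" if "x \<in> Obj I" "\<And>y. y = x \<or> prec y x \<Longrightarrow> g y = g' y" "Q g x" for g g' x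
  proof -
    have e: "At (H g) y = At (H g') y" if "prec y x \<or> y = x" for y
      using At[of y] that(1) \<open>\<And>y. y = x \<or> prec y x \<Longrightarrow> g y = g' y\<close>[of y] \<open>x \<in> Obj I\<close> prec_obj(1)[of y x] by auto
    show ?thesis using that(3) that(2)[of x] nat_at_cong[of x "H g" "H g'", unfolded ST, OF agr agr e that(1)]
      unfolding Q_def by simp
  qed
  have "\<exists>g. \<forall>x \<in> Obj I. Q g x"
  proof (rule prec_recursion)
    fix g :: "'i \<Rightarrow> 'a" and x
    assume x: "x \<in> Obj I" and IH: "\<And>y. prec y x \<Longrightarrow> Q g y"
    have o: "y \<in> Obj I" if "prec y x" for y using that prec_obj by blast
    have nH: "\<And>y. prec y x \<Longrightarrow> nat_at (H g) y" using IH unfolding Q_def by blast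
    obtain k where "is_relative_matching_map I C q x k" and kF: "k \<in> F" using qr(2)[OF x] by blast
    then obtain M c N d m kX kY g1 g2 where gm: "gap_map q x M c N d m kX kY g1 g2 k"
      unfolding relative_matching_map_iff by (elim exE conjE)
    note G = gap_mapD[OF gm]
    note H = gap_squareD[OF G(1)]
    note L = lim_mapD[OF H(1)] and P = pullbackD[OF H(3)]
    obtain L a where La: "is_matching_object I C (Tgt i) x L a"
      by (rule matching_object_exists[OF x R_arrD(3)[OF i o]])
    obtain kE where kE: "is_matching_map I C (Tgt i) x L a kE"
      by (rule matching_map_exists[OF R_arrD(5)[OF i x] La])
    obtain mh where mh: "lim_at (H g) x L a M c mh"
      by (rule lim_map_exists[of "H g", unfolded ST, OF La L(1) R_arrD(5)[OF i o] R_arrD(4)[OF qr(1) o] nH])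
    note LH = lim_mapD[OF mh]
    note KE = matching_mapD[OF kE] and KX = matching_mapD[OF G(2)] and KY = matching_mapD[OF H(2)]
    note X = R_arrD(9-11)[OF i x] R_arrD(9-11)[OF u(1) x] R_arrD(9-11)[OF v(1) x] R_arrD(9-11)[OF qr(1) x]
    note ar = X G(3-5) L(3-5) P KE(2-4) KX(2-4) KY(2-4) LH(3-5) u(2,3) v(2,3)
    \<comment> \<open>Below \<open>x\<close> the lifts already compose with \<open>q\<close> to
      \<open>v\<close>; naturality of \<open>v\<close> then makes the two maps agree over the
      target's matching object, which is what the existence of \<open>th\<close> requires.\<close>
    have q1: "m \<cdot> (mh \<cdot> kE) = kY \<cdot> At v x"
    proof (rule matching_object_eq[OF L(2) R_arrD(5)[OF qr(1) o]])
      fix f assume f: "f \<in> out x"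
      have c: "Cod I f \<in> Obj I" using o[OF out_prec[OF f]] .
      note X' = R_arrD(9-11)[OF i c] R_arrD(9-11)[OF u(1) c] R_arrD(9-11)[OF v(1) c] R_arrD(9-11)[OF qr(1) c]
      note D = matching_objectD(2-4)[OF L(2) f] matching_objectD(2-4)[OF L(1) f] matching_objectD(2-4)[OF La f]
      note n = nat_atD(1-3)[OF nH[OF out_prec[OF f]]] nat_atD(4)[OF R_arrD(1)[OF v(1) x] outD[OF f]]
      have qg: "At q (Cod I f) \<cdot> At (H g) (Cod I f) = At v (Cod I f)"
        using IH[OF out_prec[OF f]] At[OF c] unfolding Q_def by simp
      show "d f \<cdot> (m \<cdot> (mh \<cdot> kE)) = d f \<cdot> (kY \<cdot> At v x)"
        using ar D n X' ST KE(5)[OF f] KY(5)[OF f] fun_atD(3-5)[OF R_arrD(5)[OF i x] outD[OF f]]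
        by (simp add: L(6)[OF f, THEN reassoc] LH(6)[OF f, THEN reassoc] qg[THEN reassoc] KY(5)[OF f, THEN reassoc])
    qed (use ar in simp_all)
    have q2: "kX \<cdot> At u x = mh \<cdot> (kE \<cdot> At i x)"
    proof (rule matching_object_eq[OF L(1) R_arrD(4)[OF qr(1) o]])
      fix f assume f: "f \<in> out x"
      have c: "Cod I f \<in> Obj I" using o[OF out_prec[OF f]] .
      note X' = R_arrD(9-11)[OF i c] R_arrD(9-11)[OF u(1) c] R_arrD(9-11)[OF v(1) c] R_arrD(9-11)[OF qr(1) c]
      note D = matching_objectD(2-4)[OF L(2) f] matching_objectD(2-4)[OF L(1) f] matching_objectD(2-4)[OF La f]
      note n = nat_atD(1-3)[OF nH[OF out_prec[OF f]]]
      note ni = nat_atD(4)[OF R_arrD(1)[OF i x] outD[OF f]] and nu = nat_atD(4)[OF R_arrD(1)[OF u(1) x] outD[OF f]]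
      note A = fun_atD(3-5)[OF R_arrD(4)[OF i x] outD[OF f]]
      have qg: "At (H g) (Cod I f) \<cdot> At i (Cod I f) = At u (Cod I f)"
        using IH[OF out_prec[OF f]] At[OF c] unfolding Q_def by simp
      have "c f \<cdot> (mh \<cdot> (kE \<cdot> At i x)) = At (H g) (Cod I f) \<cdot> (AMap (Tgt i) f \<cdot> At i x)"
        using ar D n X' ST by (simp add: LH(6)[OF f, THEN reassoc] KE(5)[OF f, THEN reassoc])
      also have "\<dots> = At u (Cod I f) \<cdot> AMap (Src i) f"
        unfolding ni[symmetric] using ar n X' A ST by (simp add: qg[THEN reassoc])
      also have "\<dots> = c f \<cdot> (kX \<cdot> At u x)"
        using ar D nu by (simp add: KX(5)[OF f, THEN reassoc])
      finally show "c f \<cdot> (kX \<cdot> At u x) = c f \<cdot> (mh \<cdot> (kE \<cdot> At i x))" by simp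
    qed (use ar in simp_all)
    obtain th where th: "th \<in> Arr C" "Dom C th = OMap (Tgt i) x" "Cod C th = Dom C g1" "g1 \<cdot> th = mh \<cdot> kE"
        "g2 \<cdot> th = At v x"
      by (rule pullback_ex[OF H(3) _ _ _ _ _ _ q1, where Z = "OMap (Tgt i) x"]) (use ar in simp_all)
    \<comment> \<open>Checked after the two projections of the gap object: the first is the matching
      condition \<open>q2\<close>, the second the original square at \<open>x\<close>.\<close>
    have q3: "k \<cdot> At u x = th \<cdot> At i x"
    proof (rule pullback_eq[OF H(3)])
      show "g1 \<cdot> (k \<cdot> At u x) = g1 \<cdot> (th \<cdot> At i x)"
        using ar th(1-3) q2 by (simp add: G(6)[THEN reassoc] th(4)[THEN reassoc])
      show "g2 \<cdot> (k \<cdot> At u x) = g2 \<cdot> (th \<cdot> At i x)"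
        using ar th(1-3) ex[OF x] by (simp add: G(7)[THEN reassoc] th(5)[THEN reassoc])
    qed (use ar th in simp_all)
    obtain h where h: "h \<in> Arr C" "Dom C h = Cod C (At i x)" "Cod C h = Dom C k" "h \<cdot> At i x = At u x" "k \<cdot> h = th"
      by (rule acyclic_cofibrationE[OF ac[OF x] kF, of "At u x" th]) (use ar th q3 in simp_all)
    let ?g = "g(x := h)"
    have eg: "g y = ?g y" if "prec y x" for y using that by auto
    have Q': "Q ?g y" if y: "prec y x" for y
      by (rule Qcong[OF o[OF y] _ IH[OF y]]) (use y eg prec_trans in blast)
    have Atx: "At (H ?g) x = h" using At[OF x] by simp
    have lH: "lim_at (H g) x = lim_at (H ?g) x"
      by (rule lim_at_cong) (use At[OF o] eg ST agr in simp_all)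
    have "nat_at (H ?g) x"
    proof (rule nat_at_extend[of x "H ?g", unfolded ST Atx, OF x R_arrD(5)[OF i x] R_arrD(4)[OF qr(1) x]
            mh[unfolded lH] kE G(2) h(1)])
      show "kX \<cdot> h = mh \<cdot> kE" using ar h(1-3) h(5) th by (simp add: G(6)[symmetric])
    qed (use Q' h ar in \<open>simp_all add: Q_def\<close>)
    moreover have "At q x \<cdot> h = At v x"
      using h(1-3) h(5) th(5) ar by (simp add: G(7)[symmetric])
    ultimately have "Q ?g x" unfolding Q_def using h by simp
    then show "\<exists>z. Q (g(x := z)) x" by blast
  qed (rule Qcong)
  then obtain g where g: "\<And>x. x \<in> Obj I \<Longrightarrow> Q g x" by blast
  have HR: "H g \<in> Arr R"
    using g qr(1)[unfolded R_arr] i[unfolded R_arr] unfolding H_def Q_def by (simp add: mk_tr_arr)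
  show "\<exists>h \<in> hom R (Cod R i) (Dom R q). h \<cdot>\<^bsub>R\<^esub> i = u \<and> q \<cdot>\<^bsub>R\<^esub> h = v"
  proof (intro bexI[of _ "H g"] conjI)
    show "H g \<cdot>\<^bsub>R\<^esub> i = u"
      by (rule transf_eqI) (use R_comp_arr[OF i HR] u ST At g in \<open>simp_all add: Q_def\<close>)
    show "q \<cdot>\<^bsub>R\<^esub> H g = v"
      by (rule transf_eqI) (use R_comp_arr[OF HR qr(1)] v ST At g in \<open>simp_all add: Q_def\<close>)
    show "H g \<in> hom R (Cod R i) (Dom R q)" using HR ST by (simp add: R.in_hom)
  qed
qed

text \<open>The map \<open>ph\<close> from the value of \<open>Src a\<close> into the gap object of
  the partially built \<open>s\<close> is factored. It lies over the common target between small
  fibrations, so the universe supplies an acyclic cofibration, which becomes \<open>i\<close> at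
  \<open>x\<close>, and a small fibration, which becomes the gap map of \<open>s\<close>.\<close>

lemma RS_factorization:
  assumes a: "a \<in> RS" and b: "b \<in> RS" and f: "f \<in> hom R (Src a) (Src b)" and ba: "b \<cdot>\<^bsub>R\<^esub> f = a"
  shows "\<exists>i s. acyclic_cofibration R (reedy_fibrations I C F) i \<and> s \<in> RS \<and> Tgt i = Src s \<and> s \<cdot>\<^bsub>R\<^esub> i = f"
proof -
  have ar: "a \<in> Arr R" and br: "b \<in> Arr R" using a b RS_iff by auto
  have fr: "f \<in> Arr R" "Src f = Src a" "Tgt f = Src b" using f unfolding R.in_hom by simp_all
  have bax: "At b x \<cdot> At f x = At a x" if "x \<in> Obj I" for x using that unfolding ba[symmetric] by simp
  have tab: "Tgt a = Tgt b" unfolding ba[symmetric] by simp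
  \<comment> \<open>The raw data are the value of the intermediate diagram, its outgoing arrows, and
    the components of \<open>i\<close> and \<open>s\<close>.\<close>
  define E :: "('i \<Rightarrow> 'o \<times> ('j \<Rightarrow> 'a) \<times> 'a \<times> 'a) \<Rightarrow> ('i, 'j, 'o, 'a) diagram" where
    "E g = mk_dia (\<lambda>x. fst (g x)) (\<lambda>x. fst (snd (g x)))" for g
  define i where "i g = mk_tr (Src a) (E g) (\<lambda>x. fst (snd (snd (g x))))" for g
  define s where "s g = mk_tr (E g) (Src b) (\<lambda>x. snd (snd (snd (g x))))" for g
  have ST: "Src (i g) = Src a" "Tgt (i g) = E g" "Src (s g) = E g" "Tgt (s g) = Src b" for g
    by (simp_all add: i_def s_def)
  define Q where "Q g x \<longleftrightarrow> obj_at (E g) x \<and> rs_at (s g) x \<and> nat_at (i g) x \<and>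
     acyclic_cofibration C F (At (i g) x) \<and> At (s g) x \<cdot> At (i g) x = At f x" for g x
  have agrr: "agree A A y" for A y by (simp add: agree_def)
  have agr: "agree (E g) (E g') y" "At (i g) y = At (i g') y" "At (s g) y = At (s g') y"
    if "g y = g' y" "y \<in> Obj I" for g g' y
    using that by (simp_all add: E_def i_def s_def mk_dia_agree)
  have Qcong: "Q g' x" if x: "x \<in> Obj I" and e: "\<And>y. y = x \<or> prec y x \<Longrightarrow> g y = g' y" and Q: "Q g x" for g g' x
  proof -
    have z: "agree (E g) (E g') y" "At (i g) y = At (i g') y" "At (s g) y = At (s g') y" if "prec y x \<or> y = x" for y
      using agr[of g y g'] e[of y] that x prec_obj by blast+
    have "At (i g) x = At (i g') x" "At (s g) x = At (s g') x" using z by simp_all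
    then show ?thesis
      using Q obj_at_cong[OF z(1) x] nat_at_cong[of x "i g" "i g'", unfolded ST, OF agrr z(1,2) x]
        rs_at_cong[of x "s g" "s g'", unfolded ST, OF z(1) agrr z(3) x]
      unfolding Q_def by simp
  qed
  have "\<exists>g. \<forall>x \<in> Obj I. Q g x"
  proof (rule prec_recursion)
    fix g :: "'i \<Rightarrow> 'o \<times> ('j \<Rightarrow> 'a) \<times> 'a \<times> 'a" and x
    assume x: "x \<in> Obj I" and IH: "\<And>y. prec y x \<Longrightarrow> Q g y"
    have o: "y \<in> Obj I" if "prec y x" for y using that prec_obj by blast
    have o': "y \<in> Obj I" if "prec y x \<or> y = x" for y using that prec_obj x by blast
    have oE: "\<And>y. prec y x \<Longrightarrow> obj_at (E g) y" and rs: "\<And>y. prec y x \<Longrightarrow> rs_at (s g) y"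
      and ni: "\<And>y. prec y x \<Longrightarrow> nat_at (i g) y" and si: "\<And>y. prec y x \<Longrightarrow> At (s g) y \<cdot> At (i g) y = At f y"
      using IH unfolding Q_def by blast+
    obtain M c N d m kB g1 g2 where gs: "gap_square (s g) x M c N d m kB g1 g2"
      by (rule gap_squareE[of x "s g", unfolded ST, OF x oE R_arrD(2)[OF br o'] rs_nat[OF rs]])
    have S: "m \<in> S" "g2 \<in> S" using gap_square_small[of x "s g", unfolded ST, OF x oE R_arrD(2)[OF br o] rs gs] by
        blast+
    note G = gap_squareD[OF gs, unfolded ST]
    note L = lim_mapD[OF G(1), unfolded ST] and P = pullbackD[OF G(3)]
    obtain L l where Ll: "is_matching_object I C (Src a) x L l"
      by (rule matching_object_exists[OF x R_arrD(2)[OF ar o]])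
    obtain kA where kA: "is_matching_map I C (Src a) x L l kA"
      by (rule matching_map_exists[OF R_arrD(4)[OF ar x] Ll])
    obtain mi where mi: "lim_at (i g) x L l M c mi"
      by (rule lim_map_exists[of "i g", unfolded ST, OF Ll L(1) R_arrD(4)[OF ar o] obj_fun[OF oE] ni])
    note LI = lim_mapD[OF mi, unfolded ST]
    note KA = matching_mapD[OF kA] and KB = matching_mapD[OF G(2)]
    note X = R_arrD(9-11)[OF ar x] R_arrD(9-11)[OF br x] R_arrD(9-11)[OF fr(1) x]
    note arr = X L(3-5) P KA(2-4) KB(2-4) LI(3-5) fr(2,3)
    have e1: "m \<cdot> (mi \<cdot> kA) = kB \<cdot> At f x"
    proof (rule matching_object_eq[OF L(2) R_arrD(4)[OF br o]])
      fix h assume h: "h \<in> out x"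
      have c: "Cod I h \<in> Obj I" using o[OF out_prec[OF h]] .
      note X' = R_arrD(9-11)[OF ar c] R_arrD(9-11)[OF br c] R_arrD(9-11)[OF fr(1) c]
      note D = matching_objectD(2-4)[OF L(2) h] matching_objectD(2-4)[OF L(1) h] matching_objectD(2-4)[OF Ll h]
      note n = nat_atD(1-3)[OF ni[OF out_prec[OF h]], unfolded ST]
          nat_atD(1-3)[OF rs_nat[OF rs[OF out_prec[OF h]]], unfolded ST]
        nat_atD(4)[OF R_arrD(1)[OF fr(1) x] outD[OF h], unfolded fr(2,3)]
      show "d h \<cdot> (m \<cdot> (mi \<cdot> kA)) = d h \<cdot> (kB \<cdot> At f x)"
        using arr D n X' KA(5)[OF h] fun_atD(3-5)[OF R_arrD(4)[OF ar x] outD[OF h]]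
        by (simp add: L(6)[OF h, THEN reassoc] LI(6)[OF h, THEN reassoc] si[OF out_prec[OF h], THEN reassoc] KB(5)[OF h, THEN reassoc])
    qed (use arr in simp_all)
    \<comment> \<open>\<open>ph\<close> combines the cofibrations chosen below \<open>x\<close>,
      through the map \<open>mi\<close> of matching objects, with \<open>f\<close> at
      \<open>x\<close>; hence any factorization of it is compatible with both.\<close>
    obtain ph where ph: "ph \<in> Arr C" "Dom C ph = OMap (Src a) x" "Cod C ph = Dom C g1" "g1 \<cdot> ph = mi \<cdot> kA"
        "g2 \<cdot> ph = At f x"
      by (rule pullback_ex[OF G(3) _ _ _ _ _ _ e1, where Z = "OMap (Src a) x"]) (use arr in simp_all)
    \<comment> \<open>The factorization clause of the universe applies only to maps between small
      fibrations over one base; the gap object is small over that base through \<open>g2\<close> and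
      \<open>b\<close>.\<close>
    have aS: "At a x \<in> S" and bS: "At b x \<cdot> g2 \<in> S"
      using RS_small_at[OF a x] small_comp[OF S(2) RS_small_at[OF b x]] arr by simp_all
    have "ph \<in> hom C (Dom C (At a x)) (Dom C (At b x \<cdot> g2))" "At b x \<cdot> g2 \<cdot> ph = At a x"
      using ph arr bax[OF x] by (simp_all add: in_hom)
    then obtain i' s' where is': "acyclic_cofibration C F i'" "s' \<in> S" "Cod C i' = Dom C s'" "s' \<cdot> i' = ph"
      using univ aS bS unfolding universe_def by meson
    have i': "i' \<in> Arr C" "s' \<in> Arr C" using is' small_arr unfolding acyclic_cofibration_def by blast+
    have d': "Dom C i' = OMap (Src a) x" "Cod C s' = Dom C g1"
      using ph is'(4) dom_comp[OF i' is'(3)] cod_comp[OF i' is'(3)] by simp_all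
    define z where "z = (Dom C s', (\<lambda>h. if h = Ident I x then Ident C (Dom C s') else c h \<cdot> (g1 \<cdot> s')), i', g2 \<cdot> s')"
    let ?g = "g(x := z)"
    have eg: "g y = ?g y" if "prec y x" for y using that by auto
    have Q': "Q ?g y" if y: "prec y x" for y
      by (rule Qcong[OF o[OF y] _ IH[OF y]]) (use y eg prec_trans in blast)
    have ag: "agree (E g) (E ?g) y" "At (i g) y = At (i ?g) y" "At (s g) y = At (s ?g) y" if "prec y x" for y
      using agr[of g y ?g, OF eg[OF that] o[OF that]] by simp_all
    have lI: "lim_at (i g) x = lim_at (i ?g) x" by (rule lim_at_cong) (use ag ST agrr in simp_all)
    have lS: "lim_at (s g) x = lim_at (s ?g) x" by (rule lim_at_cong) (use ag ST agrr in simp_all)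
    have gs': "gap_square (s ?g) x M c N d m kB g1 g2" using gs lS unfolding gap_square_def ST by simp
    have E: "OMap (E ?g) x = Dom C s'" "AMap (E ?g) (Ident I x) = Ident C (Dom C s')"
      "\<And>h. h \<in> out x \<Longrightarrow> AMap (E ?g) h = c h \<cdot> (g1 \<cdot> s')"
      using x by (simp_all add: E_def z_def Obj_strict_coslice)
    have At: "At (i ?g) x = i'" "At (s ?g) x = g2 \<cdot> s'" using x by (simp_all add: i_def s_def z_def)
    have oE': "\<And>y. prec y x \<Longrightarrow> obj_at (E ?g) y" and nS': "\<And>y. prec y x \<Longrightarrow> nat_at (s ?g) y"
      and nI': "\<And>y. prec y x \<Longrightarrow> nat_at (i ?g) y"
      using Q' rs_nat unfolding Q_def by blast+
    have X: "obj_at (E ?g) x" "rs_at (s ?g) x" "gap_map (s ?g) x M c N d m (g1 \<cdot> s') kB g1 g2 s'"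
      by (rule rs_extend[of x "s ?g", unfolded ST, OF x R_arrD(2)[OF br o'] oE' nS' gs' is'(2) d'(2) E(1) E(3)];
          (use E At in simp)?)+
    note mE = gap_mapD(2)[OF X(3), unfolded ST]
    have nI: "nat_at (i ?g) x"
    proof (rule nat_at_extend[of x "i ?g", unfolded ST At, OF x R_arrD(4)[OF ar x] obj_fun[OF X(1)] mi[unfolded lI] kA mE i'(1) d'(1) _ nI'])
      show "g1 \<cdot> s' \<cdot> i' = mi \<cdot> kA" using i' d' is' ph arr by simp
    qed (use is' E in simp_all)
    have "At (s ?g) x \<cdot> At (i ?g) x = At f x" unfolding At using i' d' is' ph arr by simp
    then have "Q ?g x" unfolding Q_def using X nI is'(1) At by simp
    then show "\<exists>z. Q (g(x := z)) x" by blast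
  qed (rule Qcong)
  then obtain g where g: "\<And>x. x \<in> Obj I \<Longrightarrow> Q g x" by blast
  have E: "E g \<in> Obj R" using g unfolding R_obj Q_def E_def by (simp add: mk_dia_functor obj_fun)
  have iR: "i g \<in> Arr R" using g ar[unfolded R_arr] E unfolding Q_def i_def by (simp add: mk_tr_arr)
  have sR: "s g \<in> Arr R" using g br[unfolded R_arr] E rs_nat unfolding Q_def s_def by (simp add: mk_tr_arr)
  have "acyclic_cofibration R (reedy_fibrations I C F) (i g)"
    by (rule levelwise_acyclic_cofibration[OF iR]) (use g Q_def in blast)
  moreover have "s g \<in> RS" using sR g unfolding RS_iff Q_def by blast
  moreover have "s g \<cdot>\<^bsub>R\<^esub> i g = f"
    by (rule transf_eqI) (use R_comp_arr[OF iR sR] fr ST g in \<open>simp_all add: Q_def\<close>)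
  ultimately show ?thesis using ST by metis
qed

section \<open>Dependent products of Reedy small fibrations\<close>

text \<open>The universal property of \<open>\<Pi>\<^sub>g f\<close> at \<open>x\<close>, relative to its restriction to the objects below \<open>x\<close>:
  \<open>\<xi>\<close> is a map from \<open>Z\<close> to the matching object of \<open>Src r\<close>, given by its components.\<close>

definition pi_cone where
  "pi_cone r g f q1 q2 e x Z \<xi> b z1 z2 k \<longleftrightarrow>
     (\<forall>\<phi> \<in> out x. \<xi> \<phi> \<in> hom C Z (OMap (Src r) (Cod I \<phi>))) \<and>
     (\<forall>\<phi> \<in> out x. \<forall>h \<in> Arr I. Dom I h = Cod I \<phi> \<longrightarrow> AMap (Src r) h \<cdot> \<xi> \<phi> = \<xi> (h \<cdot>\<^bsub>I\<^esub> \<phi>)) \<and>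
     b \<in> hom C Z (OMap (Tgt r) x) \<and> (\<forall>\<phi> \<in> out x. At r (Cod I \<phi>) \<cdot> \<xi> \<phi> = AMap (Tgt r) \<phi> \<cdot> b) \<and>
     is_pullback C b (At g x) z1 z2 \<and> k \<in> hom C (Dom C z1) (OMap (Src f) x) \<and> At f x \<cdot> k = z2 \<and>
     (\<forall>\<phi> \<in> out x. \<forall>w \<in> hom C (Dom C z1) (Dom C (q1 (Cod I \<phi>))).
        q1 (Cod I \<phi>) \<cdot> w = \<xi> \<phi> \<cdot> z1 \<and> q2 (Cod I \<phi>) \<cdot> w = AMap (Src g) \<phi> \<cdot> z2 \<longrightarrow>
        AMap (Src f) \<phi> \<cdot> k = e (Cod I \<phi>) \<cdot> w)"

text \<open>The transpose of \<open>u\<close> is the \<open>w\<close> with projections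
  \<open>u \<cdot> z1\<close> and \<open>z2\<close>. Quantifying over all such \<open>w\<close>
  avoids naming it; it is unique once \<open>q1 x\<close> and \<open>q2 x\<close> are pullback
  projections.\<close>

definition pi_solution where
  "pi_solution r q1 q2 e x Z \<xi> b z1 z2 k u \<longleftrightarrow>
     u \<in> hom C Z (OMap (Src r) x) \<and> (\<forall>\<phi> \<in> out x. AMap (Src r) \<phi> \<cdot> u = \<xi> \<phi>) \<and> At r x \<cdot> u = b \<and>
     (\<forall>w \<in> hom C (Dom C z1) (Dom C (q1 x)). q1 x \<cdot> w = u \<cdot> z1 \<and> q2 x \<cdot> w = z2 \<longrightarrow> e x \<cdot> w = k)"

text \<open>Uniqueness is relative: \<open>u\<close> and \<open>u'\<close> are compared only when
  they agree after every arrow in \<open>out x\<close>, an assumption that an induction along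
  \<open>prec\<close> supplies.\<close>

definition pi_unique_at where
  "pi_unique_at r g q1 q2 e x \<longleftrightarrow> (\<forall>Z u u' z1 z2 w w'.
     u \<in> hom C Z (OMap (Src r) x) \<and> u' \<in> hom C Z (OMap (Src r) x) \<and>
     (\<forall>\<phi> \<in> out x. AMap (Src r) \<phi> \<cdot> u = AMap (Src r) \<phi> \<cdot> u') \<and> At r x \<cdot> u = At r x \<cdot> u' \<and>
     is_pullback C (At r x \<cdot> u) (At g x) z1 z2 \<and>
     w \<in> hom C (Dom C z1) (Dom C (q1 x)) \<and> w' \<in> hom C (Dom C z1) (Dom C (q1 x)) \<and>
     q1 x \<cdot> w = u \<cdot> z1 \<and> q2 x \<cdot> w = z2 \<and> q1 x \<cdot> w' = u' \<cdot> z1 \<and> q2 x \<cdot> w' = z2 \<and> e x \<cdot> w = e x \<cdot> w'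
     \<longrightarrow> u = u')"

definition pi_at where
  "pi_at r g f q1 q2 e x \<longleftrightarrow>
     (\<forall>Z \<xi> b z1 z2 k. pi_cone r g f q1 q2 e x Z \<xi> b z1 z2 k \<longrightarrow>
        (\<exists>u. pi_solution r q1 q2 e x Z \<xi> b z1 z2 k u)) \<and> pi_unique_at r g q1 q2 e x"

abbreviation pb_dia where
  "pb_dia r g q1 q2 \<equiv> mk_dia (\<lambda>x. Dom C (q1 x)) (\<lambda>x. pb_arr (Src r) (Src g) q1 q2)"

definition pi_stage where
  "pi_stage r g f q1 q2 e x \<longleftrightarrow> obj_at (Src r) x \<and> rs_at r x \<and>
     is_pullback C (At r x) (At g x) (q1 x) (q2 x) \<and>
     nat_at (mk_tr (pb_dia r g q1 q2) (Src f) e) x \<and> At f x \<cdot> e x = q2 x"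

text \<open>The data from which \<open>\<Pi>\<^sub>g f\<close> is built at \<open>x\<close>: \<open>Dom h1\<close> is the pullback of \<open>A\<^sub>x\<close> to the gap
  object \<open>Dom g1\<close> of \<open>r\<close>, the small fibration \<open>y2\<close> over it is pulled back along \<open>th\<close> from the gap map \<open>k\<close> of \<open>f\<close>,
  and \<open>r'\<close> is the dependent product of \<open>y2\<close> along \<open>h1\<close>.\<close>

definition pi_data where
  "pi_data r g f q1 q2 e x M c g1 g2 h1 h2 a kX k1 k2 k th y1 y2 r' o1 o2 e' \<longleftrightarrow>
     (\<exists>N d m kB. gap_square r x M c N d m kB g1 g2) \<and> is_pullback C g2 (At g x) h1 h2 \<and>
     (\<exists>K L l mf kA. gap_map f x K a L l mf kX kA k1 k2 k) \<and>
     is_pullback C k th y1 y2 \<and> is_pi C h1 y2 r' o1 o2 e' \<and> r' \<in> S \<and> k2 \<cdot> th = h2 \<and>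
     (\<forall>\<phi> \<in> out x. \<exists>w \<in> hom C (Dom C h1) (Dom C (q1 (Cod I \<phi>))).
        q1 (Cod I \<phi>) \<cdot> w = c \<phi> \<cdot> (g1 \<cdot> h1) \<and> q2 (Cod I \<phi>) \<cdot> w = AMap (Src g) \<phi> \<cdot> h2 \<and>
        a \<phi> \<cdot> (k1 \<cdot> th) = e (Cod I \<phi>) \<cdot> w)"

section \<open>The step of the dependent product at one object\<close>

context
  fixes r g f :: "('i, 'j, 'o, 'a) transf" and q1 q2 e :: "'i \<Rightarrow> 'a" and x :: 'i
  assumes x: "x \<in> Obj I" and f: "f \<in> RS" and g: "g \<in> RS" and fg: "Tgt f = Src g" and rg: "Tgt r = Tgt g"
    and stage: "\<And>y. prec y x \<Longrightarrow> pi_stage r g f q1 q2 e y"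
begin

lemma pi_below:
  assumes "prec y x"
  shows "obj_at (Src r) y" "fun_at (Src r) y" "rs_at r y" "nat_at r y"
    "is_pullback C (At r y) (At g y) (q1 y) (q2 y)" "e y \<in> Arr C" "Dom C (e y) = Dom C (q1 y)"
    "Cod C (e y) = OMap (Src f) y" "At f y \<cdot> e y = q2 y" "y \<in> Obj I"
proof -
  show y: "y \<in> Obj I" using assms prec_obj by blast
  note s = stage[OF assms, unfolded pi_stage_def]
  show "obj_at (Src r) y" "rs_at r y" "is_pullback C (At r y) (At g y) (q1 y) (q2 y)" "At f y \<cdot> e y = q2 y"
    using s by blast+
  then show "fun_at (Src r) y" "nat_at r y" using obj_fun rs_nat by blast+
  have "nat_at (mk_tr (pb_dia r g q1 q2) (Src f) e) y" using s by blast
  from nat_atD(1-3)[OF this] y show "e y \<in> Arr C" "Dom C (e y) = Dom C (q1 y)" "Cod C (e y) = OMap (Src f) y" by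
      simp_all
qed

text \<open>One arrow \<open>w\<close>, the action of the pulled-back diagram on \<open>h\<close>,
  witnesses naturality of both projections and of the counit below \<open>x\<close>.\<close>

lemma pi_arr_below:
  assumes y: "prec y x" and h: "h \<in> Arr I" "Dom I h = y"
  obtains w where "w \<in> Arr C" "Dom C w = Dom C (q1 y)" "Cod C w = Dom C (q1 (Cod I h))"
     "q1 (Cod I h) \<cdot> w = AMap (Src r) h \<cdot> q1 y" "q2 (Cod I h) \<cdot> w = AMap (Src g) h \<cdot> q2 y"
     "e (Cod I h) \<cdot> w = AMap (Src f) h \<cdot> e y"
proof -
  have gr: "g \<in> Arr R" using g RS_iff by blast
  note B = pi_below[OF y]
  have le: "prec z x" if "prec z y \<or> z = y" for z using that y prec_trans by blast
  have c: "prec (Cod I h) x" using le[OF prec_cod[OF h]] .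
  note w = pb_arr[of r y g h q1 q2, OF B(4) R_arrD(1)[OF gr B(10)] rg B(2) R_arrD(4)[OF gr B(10)] _ h pi_below(5)[OF le]
      pi_below(4)[OF c] R_arrD(1)[OF gr pi_below(10)[OF c]]]
  have t: "fun_at (Tgt r) y" unfolding rg by (rule R_arrD(5)[OF gr B(10)])
  have n: "nat_at (mk_tr (pb_dia r g q1 q2) (Src f) e) y" using stage[OF y] unfolding pi_stage_def by blast
  show thesis
    by (rule that[OF w[OF t]]) (use nat_atD(4)[OF n h] h B(10) pi_below(10)[OF c] in simp_all)
qed

text \<open>The counits already built below \<open>x\<close> dictate where the counit at
  \<open>x\<close> must land in the matching object of \<open>Src f\<close>. This constraint is the
  map \<open>th\<close> into the gap object of \<open>f\<close>, and pulling back the gap map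
  \<open>k\<close> along it isolates the part of \<open>Src f\<close> still free at
  \<open>x\<close>.\<close>

lemma pi_construct:
  obtains M c g1 g2 h1 h2 a kX k1 k2 k th y1 y2 r' o1 o2 e' where
    "pi_data r g f q1 q2 e x M c g1 g2 h1 h2 a kX k1 k2 k th y1 y2 r' o1 o2 e'"
proof -
  have gr: "g \<in> Arr R" and fr: "f \<in> Arr R" using f g RS_iff by auto
  have o: "y \<in> Obj I" if "prec y x" for y using that prec_obj by blast
  have o': "y \<in> Obj I" if "prec y x \<or> y = x" for y using that prec_obj x by blast
  obtain M c N d m kB g1 g2 where gs: "gap_square r x M c N d m kB g1 g2"
    by (rule gap_squareE[OF x pi_below(1) _ pi_below(4)]) (use R_arrD(3)[OF gr o'] rg in auto)
  have S: "m \<in> S" "g2 \<in> S"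
    using gap_square_small[OF x pi_below(1) _ pi_below(3) gs] R_arrD(3)[OF gr o] rg by simp_all
  note G = gap_squareD[OF gs]
  note L = lim_mapD[OF G(1)] and P = pullbackD[OF G(3)] and KB = matching_mapD[OF G(2)]
  note X = R_arrD(9-11)[OF gr x] R_arrD(9-11)[OF fr x]
  obtain h2 h1 where h: "is_pullback C (At g x) g2 h2 h1"
    by (rule fib_pullbackE[OF small_fib[OF RS_small_at[OF g x]], of g2]) (use P KB X rg in simp_all)
  note h' = pullback_swap[OF h]
  note Ph = pullbackD[OF h']
  have h1S: "h1 \<in> S" by (rule small_pullback[OF RS_small_at[OF g x] h])
  have rsf: "\<And>y. prec y x \<or> y = x \<Longrightarrow> rs_at f y" using f o' unfolding RS_iff by blast
  obtain K a L' l mf kX kA k1 k2 k where gm: "gap_map f x K a L' l mf kX kA k1 k2 k" and kS: "k \<in> S"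
    by (rule rs_gap_mapE[OF x R_arrD(2)[OF fr o'] R_arrD(3)[OF fr o'] rsf])
  note Gf = gap_mapD[OF gm]
  note H = gap_squareD[OF Gf(1)]
  note Lf = lim_mapD[OF H(1)] and Pf = pullbackD[OF H(3)] and KX = matching_mapD[OF Gf(2)] and KA =
      matching_mapD[OF H(2)]
  note ar = X L(3-5) P KB(2-4) Ph Lf(3-5) Pf KX(2-4) KA(2-4)
  \<comment> \<open>\<open>Dom C h1\<close> is compared with the pullback of \<open>r\<close> along
    \<open>g\<close> at each object below \<open>x\<close>; the compatibility comes from the gap
    square of \<open>r\<close> and naturality of \<open>g\<close>.\<close>
  have "\<exists>w. w \<in> Arr C \<and> Dom C w = Dom C h1 \<and> Cod C w = Dom C (q1 (Cod I \<phi>)) \<and>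
      q1 (Cod I \<phi>) \<cdot> w = c \<phi> \<cdot> (g1 \<cdot> h1) \<and> q2 (Cod I \<phi>) \<cdot> w = AMap (Src g) \<phi> \<cdot> h2" if p: "\<phi> \<in> out x" for \<phi>
  proof -
    have y: "prec (Cod I \<phi>) x" by (rule out_prec[OF p])
    note B = pi_below[OF y] and D = matching_objectD(2-4)[OF L(1) p] matching_objectD(2-4)[OF L(2) p]
    note n = nat_atD(1-3)[OF B(4)] R_arrD(9-11)[OF gr B(10)] nat_atD(4)[OF R_arrD(1)[OF gr x] outD[OF p]]
    note A = fun_atD(3-5)[OF R_arrD(4)[OF gr x] outD[OF p]] fun_atD(3-5)[OF R_arrD(5)[OF gr x] outD[OF p]]
    have "At r (Cod I \<phi>) \<cdot> (c \<phi> \<cdot> (g1 \<cdot> h1)) = d \<phi> \<cdot> (m \<cdot> (g1 \<cdot> h1))"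
      using ar D n by (simp add: L(6)[OF p, THEN reassoc])
    also have "\<dots> = d \<phi> \<cdot> (kB \<cdot> (g2 \<cdot> h1))" using ar by (simp add: P(9)[THEN reassoc])
    also have "\<dots> = AMap (Tgt g) \<phi> \<cdot> (g2 \<cdot> h1)" using ar D rg by (simp add: KB(5)[OF p, THEN reassoc])
    also have "\<dots> = At g (Cod I \<phi>) \<cdot> (AMap (Src g) \<phi> \<cdot> h2)"
      using ar n A by (simp add: n(7)[THEN reassoc] Ph(9))
    finally have e: "At r (Cod I \<phi>) \<cdot> (c \<phi> \<cdot> (g1 \<cdot> h1)) = At g (Cod I \<phi>) \<cdot> (AMap (Src g) \<phi> \<cdot> h2)" .
    obtain w where "w \<in> Arr C" "Dom C w = Dom C h1" "Cod C w = Dom C (q1 (Cod I \<phi>))"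
      "q1 (Cod I \<phi>) \<cdot> w = c \<phi> \<cdot> (g1 \<cdot> h1)" "q2 (Cod I \<phi>) \<cdot> w = AMap (Src g) \<phi> \<cdot> h2"
      by (rule pullback_ex[OF B(5) _ _ _ _ _ _ e, where Z = "Dom C h1"]) (use ar D n A in simp_all)
    then show ?thesis by metis
  qed
  then obtain w where w: "\<And>\<phi>. \<phi> \<in> out x \<Longrightarrow> w \<phi> \<in> Arr C" "\<And>\<phi>. \<phi> \<in> out x \<Longrightarrow> Dom C (w \<phi>) = Dom C h1"
    "\<And>\<phi>. \<phi> \<in> out x \<Longrightarrow> Cod C (w \<phi>) = Dom C (q1 (Cod I \<phi>))"
    "\<And>\<phi>. \<phi> \<in> out x \<Longrightarrow> q1 (Cod I \<phi>) \<cdot> w \<phi> = c \<phi> \<cdot> (g1 \<cdot> h1)"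
    "\<And>\<phi>. \<phi> \<in> out x \<Longrightarrow> q2 (Cod I \<phi>) \<cdot> w \<phi> = AMap (Src g) \<phi> \<cdot> h2" by metis
  \<comment> \<open>The counits below \<open>x\<close>, applied after the maps \<open>w\<close>,
    form a cone and hence a map into the matching object of \<open>Src f\<close>.\<close>
  have "\<exists>\<xi>. \<xi> \<in> Arr C \<and> Dom C \<xi> = Dom C h1 \<and> Cod C \<xi> = K \<and> (\<forall>\<phi> \<in> out x. a \<phi> \<cdot> \<xi> = e (Cod I \<phi>) \<cdot> w \<phi>)"
  proof (rule matching_object_ex[OF Lf(1)])
    show "Dom C h1 \<in> Obj C" using Ph(3) by simp
    fix \<phi> assume p: "\<phi> \<in> out x"
    note B = pi_below[OF out_prec[OF p]]
    show "e (Cod I \<phi>) \<cdot> w \<phi> \<in> Arr C" "Dom C (e (Cod I \<phi>) \<cdot> w \<phi>) = Dom C h1"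
      "Cod C (e (Cod I \<phi>) \<cdot> w \<phi>) = OMap (Src f) (Cod I \<phi>)" using w(1-3)[OF p] B by simp_all
    fix h assume h: "h \<in> Arr I" "Dom I h = Cod I \<phi>"
    note p' = out_comp[OF p h]
    have cod: "Cod I (h \<cdot>\<^bsub>I\<^esub> \<phi>) = Cod I h" using h outD[OF p] by simp
    have cx: "prec (Cod I h) x" using out_prec[OF p'] cod by simp
    note B' = pi_below[OF cx]
    obtain v where v: "v \<in> Arr C" "Dom C v = Dom C (q1 (Cod I \<phi>))" "Cod C v = Dom C (q1 (Cod I h))"
     "q1 (Cod I h) \<cdot> v = AMap (Src r) h \<cdot> q1 (Cod I \<phi>)" "q2 (Cod I h) \<cdot> v = AMap (Src g) h \<cdot> q2 (Cod I \<phi>)"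
     "e (Cod I h) \<cdot> v = AMap (Src f) h \<cdot> e (Cod I \<phi>)"
      by (rule pi_arr_below[OF out_prec[OF p] h])
    note PB = pullbackD[OF B(5)] and PB' = pullbackD[OF B'(5)]
    note A = fun_atD(3-5)[OF R_arrD(4)[OF gr x] outD[OF p]]
        fun_atD(6)[OF R_arrD(4)[OF gr x] outD(1)[OF p] h(1) outD(2)[OF p] h(2)[symmetric]]
      fun_atD(3-5)[OF R_arrD(4)[OF gr B(10)] h] fun_atD(3-5)[OF R_arrD(4)[OF fr B(10)] h] fun_atD(3-5)[OF B(2) h]
    note D = matching_objectD(2-4)[OF L(1) p]
    note n = nat_atD(1-3)[OF B(4)] R_arrD(9-11)[OF gr B(10)]
    have "w (h \<cdot>\<^bsub>I\<^esub> \<phi>) = v \<cdot> w \<phi>"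
    proof (rule pullback_eq[OF B'(5)])
      show "q1 (Cod I h) \<cdot> w (h \<cdot>\<^bsub>I\<^esub> \<phi>) = q1 (Cod I h) \<cdot> (v \<cdot> w \<phi>)"
        using w(1-3)[OF p'] w(1-3)[OF p] v(1-3) w(4)[OF p', unfolded cod] PB(3,7) PB'(3,7) A n D ar
        by (simp add: cod v(4)[THEN reassoc] w(4)[OF p] matching_objectD(5)[OF L(1) p h, THEN reassoc])
      show "q2 (Cod I h) \<cdot> w (h \<cdot>\<^bsub>I\<^esub> \<phi>) = q2 (Cod I h) \<cdot> (v \<cdot> w \<phi>)"
        using w(1-3)[OF p'] w(1-3)[OF p] v(1-3) w(5)[OF p', unfolded cod] PB(4,6,8) PB'(4,6,8) A n h ar
        by (simp add: cod v(5)[THEN reassoc] w(5)[OF p])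
    qed (use w(1-3)[OF p'] w(1-3)[OF p] v(1-3) cod in simp_all)
    then show "AMap (Src f) h \<cdot> (e (Cod I \<phi>) \<cdot> w \<phi>) = e (Cod I (h \<cdot>\<^bsub>I\<^esub> \<phi>)) \<cdot> w (h \<cdot>\<^bsub>I\<^esub> \<phi>)"
      unfolding cod using w(1-3)[OF p] v(1-3) B(6-8) B'(6-8) A
      by (simp add: v(6)[THEN reassoc])
  qed
  then obtain \<xi> where xi: "\<xi> \<in> Arr C" "Dom C \<xi> = Dom C h1" "Cod C \<xi> = K" "\<And>\<phi>. \<phi> \<in> out x \<Longrightarrow> a \<phi> \<cdot> \<xi> = e (Cod I \<phi>) \<cdot> w \<phi>"
    by metis
  have e1: "mf \<cdot> \<xi> = kA \<cdot> h2"
  proof (rule matching_object_eq[OF Lf(2) R_arrD(5)[OF fr o]])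
    fix \<phi> assume p: "\<phi> \<in> out x"
    note B = pi_below[OF out_prec[OF p]] and D = matching_objectD(2-4)[OF Lf(1) p] matching_objectD(2-4)[OF Lf(2) p]
    note n = R_arrD(9-11)[OF fr B(10)]
    note A = fun_atD(3-5)[OF R_arrD(4)[OF gr x] outD[OF p]]
    show "l \<phi> \<cdot> (mf \<cdot> \<xi>) = l \<phi> \<cdot> (kA \<cdot> h2)"
      using ar xi(1-3) D n fg A B(6-8) w[OF p] xi(4)[OF p]
      by (simp add: Lf(6)[OF p, THEN reassoc] KA(5)[OF p, THEN reassoc] B(9)[THEN reassoc])
  qed (use ar xi fg in simp_all)
  \<comment> \<open>The equation just shown says that the matching part \<open>\<xi>\<close> and the
    projection \<open>h2\<close> agree over the matching object of \<open>Src g\<close>, so they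
    define a map into the gap object of \<open>f\<close>.\<close>
  obtain th where th: "th \<in> Arr C" "Dom C th = Dom C h1" "Cod C th = Dom C k1" "k1 \<cdot> th = \<xi>" "k2 \<cdot> th = h2"
    by (rule pullback_ex[OF H(3) _ _ _ _ _ _ e1, where Z = "Dom C h1"]) (use ar xi fg in simp_all)
  obtain y1 y2 where y: "is_pullback C k th y1 y2"
    by (rule fib_pullbackE[OF small_fib[OF kS], of th]) (use th Gf in simp_all)
  have y2: "y2 \<in> S" by (rule small_pullback[OF kS y])
  have "Cod C y2 = Dom C h1" using pullbackD(8)[OF y] th by simp
  then obtain r' o1 o2 e' where pi: "is_pi C h1 y2 r' o1 o2 e'" "r' \<in> S"
    using univ y2 h1S unfolding universe_def by meson
  have "pi_data r g f q1 q2 e x M c g1 g2 h1 h2 a kX k1 k2 k th y1 y2 r' o1 o2 e'"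
    unfolding pi_data_def
  proof (intro conjI ballI)
    show "\<exists>N d m kB. gap_square r x M c N d m kB g1 g2" using gs by blast
    show "\<exists>K L l mf kA. gap_map f x K a L l mf kX kA k1 k2 k" using gm by blast
    fix \<phi> assume p: "\<phi> \<in> out x"
    show "\<exists>w \<in> hom C (Dom C h1) (Dom C (q1 (Cod I \<phi>))).
        q1 (Cod I \<phi>) \<cdot> w = c \<phi> \<cdot> (g1 \<cdot> h1) \<and> q2 (Cod I \<phi>) \<cdot> w = AMap (Src g) \<phi> \<cdot> h2 \<and>
        a \<phi> \<cdot> (k1 \<cdot> th) = e (Cod I \<phi>) \<cdot> w"
      by (intro bexI[of _ "w \<phi>"] conjI) (use w[OF p] xi(4)[OF p] th(4) in \<open>simp_all add: in_hom\<close>)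
  qed (use h' y pi th in simp_all)
  then show thesis by (rule that)
qed

text \<open>The value at \<open>x\<close> is the domain of \<open>r'\<close>, a small fibration over
  the gap object, and the counit is \<open>y1 \<cdot> e'\<close>. A relative cone corresponds to a
  map into the gap object together with a map into the pullback of the gap map of \<open>f\<close>,
  which is the input expected by the dependent product \<open>r'\<close>.\<close>

lemma pi_finish:
  assumes data: "pi_data r g f q1 q2 e x M c g1 g2 h1 h2 a kX k1 k2 k th y1 y2 r' o1 o2 e'"
    and Px: "OMap (Src r) x = Dom C r'" "AMap (Src r) (Ident I x) = Ident C (Dom C r')"
      "\<And>\<phi>. \<phi> \<in> out x \<Longrightarrow> AMap (Src r) \<phi> = c \<phi> \<cdot> (g1 \<cdot> r')"
    and rx: "At r x = g2 \<cdot> r'" and q1x: "q1 x = o1" and q2x: "q2 x = h2 \<cdot> o2" and ex: "e x = y1 \<cdot> e'"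
  shows "pi_stage r g f q1 q2 e x" "pi_at r g f q1 q2 e x"
proof -
  have gr: "g \<in> Arr R" and fr: "f \<in> Arr R" using f g RS_iff by auto
  have o: "y \<in> Obj I" if "prec y x" for y using that prec_obj by blast
  have o': "y \<in> Obj I" if "prec y x \<or> y = x" for y using that prec_obj x by blast
  note dat = data[unfolded pi_data_def]
  obtain N d m kB where gs: "gap_square r x M c N d m kB g1 g2" using dat by blast
  have h: "is_pullback C g2 (At g x) h1 h2" using dat by blast
  obtain K L' l mf kA where gm: "gap_map f x K a L' l mf kX kA k1 k2 k" using dat by blast
  have y: "is_pullback C k th y1 y2" and pi: "is_pi C h1 y2 r' o1 o2 e'" and rS: "r' \<in> S" and th: "k2 \<cdot> th = h2"
    using dat by blast+
  have "\<forall>\<phi> \<in> out x. \<exists>w \<in> hom C (Dom C h1) (Dom C (q1 (Cod I \<phi>))).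
        q1 (Cod I \<phi>) \<cdot> w = c \<phi> \<cdot> (g1 \<cdot> h1) \<and> q2 (Cod I \<phi>) \<cdot> w = AMap (Src g) \<phi> \<cdot> h2 \<and>
        a \<phi> \<cdot> (k1 \<cdot> th) = e (Cod I \<phi>) \<cdot> w" using dat by blast
  then obtain w where w': "\<And>\<phi>. \<phi> \<in> out x \<Longrightarrow> w \<phi> \<in> hom C (Dom C h1) (Dom C (q1 (Cod I \<phi>)))"
    "\<And>\<phi>. \<phi> \<in> out x \<Longrightarrow> q1 (Cod I \<phi>) \<cdot> w \<phi> = c \<phi> \<cdot> (g1 \<cdot> h1)"
    "\<And>\<phi>. \<phi> \<in> out x \<Longrightarrow> q2 (Cod I \<phi>) \<cdot> w \<phi> = AMap (Src g) \<phi> \<cdot> h2"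
    "\<And>\<phi>. \<phi> \<in> out x \<Longrightarrow> a \<phi> \<cdot> (k1 \<cdot> th) = e (Cod I \<phi>) \<cdot> w \<phi>" by metis
  have w: "\<And>\<phi>. \<phi> \<in> out x \<Longrightarrow> w \<phi> \<in> Arr C" "\<And>\<phi>. \<phi> \<in> out x \<Longrightarrow> Dom C (w \<phi>) = Dom C h1"
    "\<And>\<phi>. \<phi> \<in> out x \<Longrightarrow> Cod C (w \<phi>) = Dom C (q1 (Cod I \<phi>))"
    using w'(1) unfolding in_hom by blast+
  note w = w w'(2-4)
  note G = gap_squareD[OF gs]
  note L = lim_mapD[OF G(1)] and P = pullbackD[OF G(3)] and KB = matching_mapD[OF G(2)]
  note X = R_arrD(9-11)[OF gr x] R_arrD(9-11)[OF fr x]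
  note Ph = pullbackD[OF h] and Y = pullbackD[OF y] and D = is_piD[OF pi]
  note O = pullbackD[OF D(4)]
  note Gf = gap_mapD[OF gm]
  note H = gap_squareD[OF Gf(1)]
  note Lf = lim_mapD[OF H(1)] and Pf = pullbackD[OF H(3)] and KX = matching_mapD[OF Gf(2)]
  note ar = X L(3-5) P(1-8) KB(2-4) Ph(1-8) Lf(3-5) Pf(1-8) KX(2-4) Y(1-8) D(1-3,5-7) O(1-8) Gf(3-5)
  have oB: "\<And>y. prec y x \<or> y = x \<Longrightarrow> obj_at (Tgt r) y" unfolding rg using R_arrD(3)[OF gr o'] .
  have ext: "obj_at (Src r) x" "rs_at r x"
    by (rule rs_extend[OF x oB pi_below(1) pi_below(4) gs rS _ _ Px(3)]; (use ar Px rx in simp)?)+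
  have "is_pullback C (At g x) (g2 \<cdot> r') (h2 \<cdot> o2) o1"
    by (rule pullback_paste[OF pullback_swap[OF h] pullback_swap[OF D(4)]])
  then have pbx: "is_pullback C (At r x) (At g x) (q1 x) (q2 x)" unfolding rx q1x q2x by (rule pullback_swap)
  have fe: "At f x \<cdot> e x = q2 x"
    unfolding ex q2x using ar D(8) by (simp add: Gf(7)[symmetric] Y(9)[THEN reassoc] th[THEN reassoc])
  have nr: "\<And>y. prec y x \<or> y = x \<Longrightarrow> nat_at r y" using pi_below(4) rs_nat[OF ext(2)] by blast
  have fnr: "\<And>y. prec y x \<or> y = x \<Longrightarrow> fun_at (Src r) y" using pi_below(2) obj_fun[OF ext(1)] by blast
  have pbl: "\<And>y. prec y x \<or> y = x \<Longrightarrow> is_pullback C (At r y) (At g y) (q1 y) (q2 y)" using pi_below(5) pbx by blast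
  let ?Q = "pb_dia r g q1 q2"
  note pf = pb_fun_at[where Q = ?Q, OF x nr R_arrD(1)[OF gr o'] rg fnr R_arrD(4)[OF gr o'] obj_fun[OF oB] pbl]
  have FQ: "fun_at ?Q x" by (rule pf(1)) (simp_all add: o')
  have n1: "nat_at (mk_tr ?Q (Src r) q1) x" by (rule pf(2)) (simp_all add: o')
  have n2: "nat_at (mk_tr ?Q (Src g) q2) x" by (rule pf(3)) (simp_all add: o')
  have e1: "e x \<in> Arr C" "Dom C (e x) = Dom C (q1 x)" "Cod C (e x) = OMap (Src f) x"
    unfolding ex q1x using ar by simp_all
  have "e (Cod I \<phi>) \<cdot> AMap ?Q \<phi> = AMap (Src f) \<phi> \<cdot> e x" if p: "\<phi> \<in> Arr I" "Dom I \<phi> = x" for \<phi>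
  proof (cases "\<phi> = Ident I x")
    case True
    have "AMap ?Q (Ident I x) = Ident C (Dom C (q1 x))" using fun_atD(2)[OF FQ] x by simp
    then show ?thesis using fun_atD(2)[OF R_arrD(4)[OF fr x]] e1 x unfolding True by simp
  next
    case False
    then have p': "\<phi> \<in> out x" using p by (simp add: Obj_strict_coslice)
    note B = pi_below[OF out_prec[OF p']]
    note Dm = matching_objectD(2-4)[OF Lf(1) p'] matching_objectD(2-4)[OF L(1) p']
    note PB = pullbackD[OF B(5)] and n = nat_atD(1-3)[OF B(4)] R_arrD(9-11)[OF gr B(10)]
    note A = fun_atD(3-5)[OF R_arrD(4)[OF gr x] p]
    have Qa: "AMap ?Q \<phi> \<in> Arr C" "Dom C (AMap ?Q \<phi>) = Dom C o1" "Cod C (AMap ?Q \<phi>) = Dom C (q1 (Cod I \<phi>))"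
      using fun_atD(3-5)[OF FQ p] x B(10) q1x by (simp_all del: mk_dia_simps(2))
    have Q1: "q1 (Cod I \<phi>) \<cdot> AMap ?Q \<phi> = AMap (Src r) \<phi> \<cdot> o1" and Q2:
        "q2 (Cod I \<phi>) \<cdot> AMap ?Q \<phi> = AMap (Src g) \<phi> \<cdot> (h2 \<cdot> o2)"
      using nat_atD(4)[OF n1 p] nat_atD(4)[OF n2 p] x B(10) q1x q2x by (simp_all del: mk_dia_simps(2))
    \<comment> \<open>Both sides have the same projections. Naturality of the counit along
      \<open>\<phi>\<close> is thereby reduced to the constraint encoded in
      \<open>th\<close>.\<close>
    have "AMap ?Q \<phi> = w \<phi> \<cdot> o2"
    proof (rule pullback_eq[OF B(5)])
      show "q1 (Cod I \<phi>) \<cdot> AMap ?Q \<phi> = q1 (Cod I \<phi>) \<cdot> (w \<phi> \<cdot> o2)"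
        unfolding Q1 using ar w(1-3)[OF p'] PB(3) Dm by (simp add: w(4)[OF p', THEN reassoc] Px(3)[OF p'] O(9))
      show "q2 (Cod I \<phi>) \<cdot> AMap ?Q \<phi> = q2 (Cod I \<phi>) \<cdot> (w \<phi> \<cdot> o2)"
        unfolding Q2 using ar w(1-3)[OF p'] PB(4,6,8) Dm A by (simp add: w(5)[OF p', THEN reassoc])
    qed (use Qa w(1-3)[OF p'] ar in simp_all)
    then have "e (Cod I \<phi>) \<cdot> AMap ?Q \<phi> = a \<phi> \<cdot> (k1 \<cdot> (th \<cdot> o2))"
      using w(1-3)[OF p'] B(6-8) ar Dm w(6)[OF p', symmetric] by (simp add: w(6)[OF p', symmetric, THEN reassoc])
    also have "\<dots> = a \<phi> \<cdot> (k1 \<cdot> (k \<cdot> (y1 \<cdot> e')))"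
      using ar D(8) by (simp add: Y(9)[THEN reassoc])
    also have "\<dots> = AMap (Src f) \<phi> \<cdot> e x"
      unfolding ex using ar Dm by (simp add: Gf(6)[THEN reassoc] KX(5)[OF p', THEN reassoc])
    finally show ?thesis .
  qed
  then have nE: "nat_at (mk_tr ?Q (Src f) e) x"
    using e1 x by (simp add: nat_at_def in_hom del: mk_dia_simps(2))
  show "pi_stage r g f q1 q2 e x" unfolding pi_stage_def using ext pbx nE fe by blast
  have sol: "\<exists>u. pi_solution r q1 q2 e x Z \<xi> b z1 z2 kk u" if cone: "pi_cone r g f q1 q2 e x Z \<xi> b z1 z2 kk" for Z \<xi>
      b z1 z2 kk
  proof -
    note cn = cone[unfolded pi_cone_def]
    have xi: "\<And>\<phi>. \<phi> \<in> out x \<Longrightarrow> \<xi> \<phi> \<in> Arr C" "\<And>\<phi>. \<phi> \<in> out x \<Longrightarrow> Dom C (\<xi> \<phi>) = Z"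
      "\<And>\<phi>. \<phi> \<in> out x \<Longrightarrow> Cod C (\<xi> \<phi>) = OMap (Src r) (Cod I \<phi>)"
      "\<And>\<phi> h. \<lbrakk>\<phi> \<in> out x; h \<in> Arr I; Dom I h = Cod I \<phi>\<rbrakk> \<Longrightarrow> AMap (Src r) h \<cdot> \<xi> \<phi> = \<xi> (h \<cdot>\<^bsub>I\<^esub> \<phi>)"
      "\<And>\<phi>. \<phi> \<in> out x \<Longrightarrow> At r (Cod I \<phi>) \<cdot> \<xi> \<phi> = AMap (Tgt r) \<phi> \<cdot> b"
      using cn unfolding in_hom by simp_all
    have b: "b \<in> Arr C" "Dom C b = Z" "Cod C b = OMap (Tgt r) x" and z: "is_pullback C b (At g x) z1 z2"
      and kk: "kk \<in> Arr C" "Dom C kk = Dom C z1" "Cod C kk = OMap (Src f) x" "At f x \<cdot> kk = z2"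
      using cn unfolding in_hom by simp_all
    note Z = pullbackD[OF z]
    \<comment> \<open>The prescribed components of the cone assemble to a map into the matching
      object; with \<open>b\<close> it becomes the map \<open>a'\<close> into the gap
      object.\<close>
    have "\<exists>a0. a0 \<in> Arr C \<and> Dom C a0 = Z \<and> Cod C a0 = M \<and> (\<forall>\<phi> \<in> out x. c \<phi> \<cdot> a0 = \<xi> \<phi>)"
      by (rule matching_object_ex[OF L(1)]) (use xi b dom_obj[OF b(1)] in simp_all)
    then obtain a0 where a0: "a0 \<in> Arr C" "Dom C a0 = Z" "Cod C a0 = M" "\<And>\<phi>. \<phi> \<in> out x \<Longrightarrow> c \<phi> \<cdot> a0 = \<xi> \<phi>" by metis
    have e1: "m \<cdot> a0 = kB \<cdot> b"
    proof (rule matching_object_eq[OF L(2)])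
      show "\<And>y. prec y x \<Longrightarrow> fun_at (Tgt r) y" using oB obj_fun by blast
      fix \<phi> assume p: "\<phi> \<in> out x"
      note B = pi_below[OF out_prec[OF p]]
      show "d \<phi> \<cdot> (m \<cdot> a0) = d \<phi> \<cdot> (kB \<cdot> b)"
        using L(3-5) KB(2-4) a0(1-3) b matching_objectD(2-4)[OF L(1) p] matching_objectD(2-4)[OF L(2) p]
          nat_atD(1-3)[OF B(4)] xi(5)[OF p] a0(4)[OF p]
        by (simp add: L(6)[OF p, THEN reassoc] KB(5)[OF p, THEN reassoc])
    qed (use L(3-5) KB(2-4) a0(1-3) b in simp_all)
    obtain a' where a': "a' \<in> Arr C" "Dom C a' = Z" "Cod C a' = Dom C g1" "g1 \<cdot> a' = a0" "g2 \<cdot> a' = b"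
      by (rule pullback_ex[OF G(3) _ _ _ _ _ _ e1, where Z = Z]) (use L(3-5) KB(2-4) a0(1-3) b in simp_all)
    have e2: "g2 \<cdot> (a' \<cdot> z1) = At g x \<cdot> z2"
      using a'(1-3) b Z ar by (simp add: a'(5)[THEN reassoc])
    obtain w2 where w2: "w2 \<in> Arr C" "Dom C w2 = Dom C z1" "Cod C w2 = Dom C h1" "h1 \<cdot> w2 = a' \<cdot> z1" "h2 \<cdot> w2 = z2"
      by (rule pullback_ex[OF h _ _ _ _ _ _ e2, where Z = "Dom C z1"]) (use a'(1-3) b Z ar in simp_all)
    have "is_pullback C h1 a' w2 z1"
    proof (rule pullback_unpaste[OF pullback_swap[OF h]])
      show "is_pullback C (At g x) (g2 \<cdot> a') (h2 \<cdot> w2) z1" unfolding a'(5) w2(5) by (rule pullback_swap[OF z])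
    qed (use a'(1-3) b Z ar w2 in simp_all)
    then have pz: "is_pullback C a' h1 z1 w2" by (rule pullback_swap)
    \<comment> \<open>The compatibility clause of the cone is used at the arrow
      \<open>w \<phi> \<cdot> w2\<close>, whose projections are the required ones.\<close>
    have kX: "kX \<cdot> kk = k1 \<cdot> (th \<cdot> w2)"
    proof (rule matching_object_eq[OF Lf(1) R_arrD(4)[OF fr o]])
      fix \<phi> assume p: "\<phi> \<in> out x"
      note B = pi_below[OF out_prec[OF p]]
      note PB = pullbackD[OF B(5)] and A = fun_atD(3-5)[OF R_arrD(4)[OF gr x] outD[OF p]]
      note Dm = matching_objectD(2-4)[OF Lf(1) p] matching_objectD(2-4)[OF L(1) p]
      have "q1 (Cod I \<phi>) \<cdot> (w \<phi> \<cdot> w2) = \<xi> \<phi> \<cdot> z1"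
        using w(1-3)[OF p] w2(1-4) PB(3) ar Dm a'(1-3) Z(3,7) b a0(1-3)
        by (simp add: w(4)[OF p, THEN reassoc] a'(4)[THEN reassoc] a0(4)[OF p, THEN reassoc])
      moreover have "q2 (Cod I \<phi>) \<cdot> (w \<phi> \<cdot> w2) = AMap (Src g) \<phi> \<cdot> z2"
        using w(1-3)[OF p] w2(1-3,5) PB(4,6,8) ar A
        by (simp add: w(5)[OF p, THEN reassoc])
      moreover have "w \<phi> \<cdot> w2 \<in> hom C (Dom C z1) (Dom C (q1 (Cod I \<phi>)))"
        using w(1-3)[OF p] w2(1-3) by (simp add: in_hom)
      ultimately have "AMap (Src f) \<phi> \<cdot> kk = e (Cod I \<phi>) \<cdot> (w \<phi> \<cdot> w2)" using cn p by blast
      then show "a \<phi> \<cdot> (kX \<cdot> kk) = a \<phi> \<cdot> (k1 \<cdot> (th \<cdot> w2))"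
        using kk(1-3) w(1-3)[OF p] w2(1-3) B(6-8) ar Dm w(6)[OF p, symmetric]
        by (simp add: KX(5)[OF p, THEN reassoc] w(6)[OF p, symmetric, THEN reassoc])
    qed (use kk w2 ar in simp_all)
    have e3: "k \<cdot> kk = th \<cdot> w2"
    proof (rule pullback_eq[OF H(3)])
      show "k1 \<cdot> (k \<cdot> kk) = k1 \<cdot> (th \<cdot> w2)" using kk(1-3) w2(1-3) ar kX by (simp add: Gf(6)[THEN reassoc])
      show "k2 \<cdot> (k \<cdot> kk) = k2 \<cdot> (th \<cdot> w2)" using kk w2 ar by (simp add: Gf(7)[THEN reassoc] th[THEN reassoc])
    qed (use kk w2 ar in simp_all)
    \<comment> \<open>\<open>kk\<close> satisfies the constraint \<open>th\<close> over
      \<open>w2\<close>, so it lifts to the pullback of the gap map, over which \<open>r'\<close> is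
      a dependent product.\<close>
    obtain k' where k': "k' \<in> Arr C" "Dom C k' = Dom C z1" "Cod C k' = Dom C y1" "y1 \<cdot> k' = kk" "y2 \<cdot> k' = w2"
      by (rule pullback_ex[OF y _ _ _ _ _ _ e3, where Z = "Dom C z1"]) (use kk w2 ar in simp_all)
    obtain u v where u: "u \<in> Arr C" "Dom C u = Dom C a'" "Cod C u = Dom C r'" "r' \<cdot> u = a'"
        "v \<in> Arr C" "Dom C v = Dom C z1" "Cod C v = Dom C o1" "o1 \<cdot> v = u \<cdot> z1" "o2 \<cdot> v = w2" "e' \<cdot> v = k'"
      by (rule is_pi_ex[OF pi pz k'(1,2) _ k'(5)]) (use k' ar in simp_all)
    have "pi_solution r q1 q2 e x Z \<xi> b z1 z2 kk u"
      unfolding pi_solution_def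
    proof (intro conjI ballI impI)
      show "u \<in> hom C Z (OMap (Src r) x)" using u a' Px by (simp add: in_hom)
      show "At r x \<cdot> u = b" unfolding rx using u(1-4) a' ar by simp
      fix \<phi> assume p: "\<phi> \<in> out x"
      show "AMap (Src r) \<phi> \<cdot> u = \<xi> \<phi>"
        unfolding Px(3)[OF p] using u(1-4) a' ar a0(4)[OF p] matching_objectD(2-4)[OF L(1) p] by simp
    next
      fix v' assume "v' \<in> hom C (Dom C z1) (Dom C (q1 x))" and q: "q1 x \<cdot> v' = u \<cdot> z1 \<and> q2 x \<cdot> v' = z2"
      then have v': "v' \<in> Arr C" "Dom C v' = Dom C z1" "Cod C v' = Dom C o1" using q1x by (simp_all add: in_hom)
      have "v' = v"
      proof (rule pullback_eq[OF pbx])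
        show "q1 x \<cdot> v' = q1 x \<cdot> v" using q u(8) q1x by simp
        show "q2 x \<cdot> v' = q2 x \<cdot> v" using q u(5-7,9) w2(5) ar unfolding q2x by simp
      qed (use v' u q1x in simp_all)
      then show "e x \<cdot> v' = kk" unfolding ex using u(5-7,10) k'(4) ar by simp
    qed
    then show ?thesis by blast
  qed
  have "pi_unique_at r g q1 q2 e x"
    unfolding pi_unique_at_def
  proof (intro allI impI, elim conjE)
    fix Z u u' z1 z2 v v'
    assume "u \<in> hom C Z (OMap (Src r) x)" "u' \<in> hom C Z (OMap (Src r) x)"
      and al: "\<forall>\<phi> \<in> out x. AMap (Src r) \<phi> \<cdot> u = AMap (Src r) \<phi> \<cdot> u'" and ru: "At r x \<cdot> u = At r x \<cdot> u'"
      and z: "is_pullback C (At r x \<cdot> u) (At g x) z1 z2"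
      and "v \<in> hom C (Dom C z1) (Dom C (q1 x))" "v' \<in> hom C (Dom C z1) (Dom C (q1 x))"
      and q: "q1 x \<cdot> v = u \<cdot> z1" "q2 x \<cdot> v = z2" "q1 x \<cdot> v' = u' \<cdot> z1" "q2 x \<cdot> v' = z2" and ee: "e x \<cdot> v = e x \<cdot> v'"
    then have u: "u \<in> Arr C" "Dom C u = Z" "Cod C u = Dom C r'" "u' \<in> Arr C" "Dom C u' = Z" "Cod C u' = Dom C r'"
      and v: "v \<in> Arr C" "Dom C v = Dom C z1" "Cod C v = Dom C o1" "v' \<in> Arr C" "Dom C v' = Dom C z1"
          "Cod C v' = Dom C o1"
      using Px(1) q1x by (simp_all add: in_hom)
    note Z = pullbackD[OF z]
    \<comment> \<open>Agreement after all arrows out of \<open>x\<close> gives agreement in the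
      matching object; together with agreement after \<open>At r x\<close> the two maps coincide in
      the gap object.\<close>
    have "g1 \<cdot> (r' \<cdot> u) = g1 \<cdot> (r' \<cdot> u')"
    proof (rule matching_object_eq[OF L(1) pi_below(2)])
      fix \<phi> assume p: "\<phi> \<in> out x"
      show "c \<phi> \<cdot> (g1 \<cdot> (r' \<cdot> u)) = c \<phi> \<cdot> (g1 \<cdot> (r' \<cdot> u'))"
        using al[rule_format, OF p] u ar matching_objectD(2-4)[OF L(1) p] unfolding Px(3)[OF p] by simp
    qed (use u ar in simp_all)
    moreover have "g2 \<cdot> (r' \<cdot> u) = g2 \<cdot> (r' \<cdot> u')" using ru u ar unfolding rx by simp
    ultimately have eu: "r' \<cdot> u = r' \<cdot> u'"
      by (rule pullback_eq[OF G(3) _ _ _ _ _ _, rotated -2]) (use u ar in simp_all)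
    have dz: "Dom C (At r x \<cdot> u) = Z" unfolding rx using u ar by simp
    have zz: "z1 \<in> Arr C" "Cod C z1 = Z" "z2 \<in> Arr C" "Dom C z2 = Dom C z1" "Cod C z2 = OMap (Src g) x"
      using Z dz X by simp_all
    have e2: "g2 \<cdot> (r' \<cdot> u \<cdot> z1) = At g x \<cdot> z2"
      using Z(9) u ar zz unfolding rx by simp
    obtain w2 where w2: "w2 \<in> Arr C" "Dom C w2 = Dom C z1" "Cod C w2 = Dom C h1" "h1 \<cdot> w2 = r' \<cdot> u \<cdot> z1"
        "h2 \<cdot> w2 = z2"
      by (rule pullback_ex[OF h _ _ _ _ _ _ e2, where Z = "Dom C z1"]) (use u zz ar in simp_all)
    have "is_pullback C h1 (r' \<cdot> u) w2 z1"
    proof (rule pullback_unpaste[OF pullback_swap[OF h]])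
      have "At r x \<cdot> u = g2 \<cdot> (r' \<cdot> u)" unfolding rx using u ar by simp
      then show "is_pullback C (At g x) (g2 \<cdot> (r' \<cdot> u)) (h2 \<cdot> w2) z1" unfolding w2(5) using pullback_swap[OF z] by
          simp
    qed (use u zz ar w2 in simp_all)
    then have pz: "is_pullback C (r' \<cdot> u) h1 z1 w2" by (rule pullback_swap)
    \<comment> \<open>Both transposes have the same image in \<open>Dom C h1\<close>, so equality of
      the counits at \<open>x\<close> lifts to equality after \<open>e'\<close> and uniqueness for
      \<open>r'\<close> applies.\<close>
    have o2: "o2 \<cdot> t = w2" if t: "t \<in> Arr C" "Dom C t = Dom C z1" "Cod C t = Dom C o1" "o1 \<cdot> t = s \<cdot> z1"
        "q2 x \<cdot> t = z2"
      and s: "r' \<cdot> s = r' \<cdot> u" "s \<in> Arr C" "Dom C s = Z" "Cod C s = Dom C r'" for t s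
    proof (rule pullback_eq[OF h])
      show "h1 \<cdot> (o2 \<cdot> t) = h1 \<cdot> w2"
        using t(1-4) s zz u ar w2(4) by (simp add: O(9)[symmetric, THEN reassoc] s(1)[THEN reassoc])
      show "h2 \<cdot> (o2 \<cdot> t) = h2 \<cdot> w2" using t(1-3,5) ar w2(5) unfolding q2x by simp
    qed (use t w2 ar in simp_all)
    have ov: "o2 \<cdot> v = w2" by (rule o2[OF v(1-3) _ q(2) refl u(1-3)]) (use q q1x in simp)
    have ov': "o2 \<cdot> v' = w2" by (rule o2[OF v(4-6) _ q(4) eu[symmetric] u(4-6)]) (use q q1x in simp)
    have ev: "e' \<cdot> v = e' \<cdot> v'"
    proof (rule pullback_eq[OF y])
      show "y1 \<cdot> (e' \<cdot> v) = y1 \<cdot> (e' \<cdot> v')" using ee v ar unfolding ex by simp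
      show "y2 \<cdot> (e' \<cdot> v) = y2 \<cdot> (e' \<cdot> v')" using v ar ov ov' by (simp add: D(8)[THEN reassoc])
    qed (use v ar in simp_all)
    show "u = u'"
      by (rule is_pi_eq[OF pi pz u(1) _ u(3) refl v(1-3) _ ov u(4) _ u(6) eu[symmetric] v(4-6) _ ov' ev])
        (use u ar q q1x in simp_all)
  qed
  then show "pi_at r g f q1 q2 e x" unfolding pi_at_def using sol by blast
qed

end

section \<open>Locality of the stage conditions and recursion over all objects\<close>

definition pi_agree where
  "pi_agree r q1 q2 e r' q1' q2' e' y \<longleftrightarrow> agree (Src r) (Src r') y \<and> Tgt r = Tgt r' \<and> At r y = At r' y \<and>
     q1 y = q1' y \<and> q2 y = q2' y \<and> e y = e' y"

lemma pi_stage_cong: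
  assumes ag: "\<And>y. prec y x \<or> y = x \<Longrightarrow> pi_agree r q1 q2 e r' q1' q2' e' y" and x: "x \<in> Obj I"
    and s: "pi_stage r g f q1 q2 e x"
  shows "pi_stage r' g f q1' q2' e' x"
proof -
  have a: "agree (Src r) (Src r') y" "At r y = At r' y" "q1 y = q1' y" "q2 y = q2' y" "e y = e' y" "Tgt r = Tgt r'"
    if "prec y x \<or> y = x" for y using ag[OF that] unfolding pi_agree_def by blast+
  have le: "prec z x \<or> z = x" if "prec z y \<or> z = y" "prec y x \<or> y = x" for y z using that prec_trans by blast
  have o: "y \<in> Obj I" if "prec y x \<or> y = x" for y using that prec_obj x by blast
  have agrr: "agree A A y" for A y by (simp add: agree_def)
  have pa: "pb_arr (Src r) (Src g) q1 q2 h = pb_arr (Src r') (Src g) q1' q2' h"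
    if h: "h \<in> Arr I" "prec (Dom I h) x \<or> Dom I h = x" for h
    using a[OF h(2)] a[OF le[OF prec_cod[OF h(1) refl] h(2)]] h(1) unfolding pb_arr_def by (simp add: agree_def)
  have pd: "agree (pb_dia r g q1 q2) (pb_dia r' g q1' q2') y" if "prec y x \<or> y = x" for y
    using a[OF that] pa that o[OF that] by (simp add: agree_def)
  have tr: "Tgt r = Tgt r'" using a(6)[of x] by simp
  have "nat_at (mk_tr (pb_dia r' g q1' q2') (Src f) e') x"
    by (rule nat_at_cong[of x "mk_tr (pb_dia r g q1 q2) (Src f) e"])
      (use pd agrr a(5) o x s in \<open>simp_all add: pi_stage_def del: mk_dia_simps\<close>)
  moreover have "obj_at (Src r') x" by (rule obj_at_cong[OF a(1) x]) (use s in \<open>simp_all add: pi_stage_def\<close>)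
  moreover have "rs_at r' x"
    by (rule rs_at_cong[of x r r', OF a(1) _ a(2) x]) (use s tr agrr in \<open>simp_all add: pi_stage_def\<close>)
  ultimately show ?thesis using s a[of x] unfolding pi_stage_def by simp
qed

lemma pi_at_cong:
  assumes ag: "\<And>y. prec y x \<or> y = x \<Longrightarrow> pi_agree r q1 q2 e r' q1' q2' e' y"
    and s: "pi_at r g f q1 q2 e x"
  shows "pi_at r' g f q1' q2' e' x"
proof -
  have a: "agree (Src r) (Src r') y" "At r y = At r' y" "q1 y = q1' y" "q2 y = q2' y" "e y = e' y" "Tgt r = Tgt r'"
    if "prec y x \<or> y = x" for y using ag[OF that] unfolding pi_agree_def by blast+
  have X: "OMap (Src r) x = OMap (Src r') x" "At r x = At r' x" "q1 x = q1' x" "q2 x = q2' x" "e x = e' x"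
      "Tgt r = Tgt r'"
    "\<And>\<phi>. \<phi> \<in> out x \<Longrightarrow> AMap (Src r) \<phi> = AMap (Src r') \<phi>"
    using a[of x] outD[of _ x] by (simp_all add: agree_def)
  have Y: "OMap (Src r) (Cod I \<phi>) = OMap (Src r') (Cod I \<phi>)" "At r (Cod I \<phi>) = At r' (Cod I \<phi>)"
    "q1 (Cod I \<phi>) = q1' (Cod I \<phi>)" "q2 (Cod I \<phi>) = q2' (Cod I \<phi>)" "e (Cod I \<phi>) = e' (Cod I \<phi>)"
    "\<And>h. \<lbrakk>h \<in> Arr I; Dom I h = Cod I \<phi>\<rbrakk> \<Longrightarrow> AMap (Src r) h = AMap (Src r') h" if "\<phi> \<in> out x" for \<phi>
    using a[OF disjI1[OF out_prec[OF that]]] by (simp_all add: agree_def)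
  have 1: "pi_cone r g f q1 q2 e x Z \<xi> b z1 z2 k \<longleftrightarrow> pi_cone r' g f q1' q2' e' x Z \<xi> b z1 z2 k" for Z \<xi> b z1 z2 k
    unfolding pi_cone_def using X Y by (simp cong: ball_cong)
  have 2: "pi_solution r q1 q2 e x Z \<xi> b z1 z2 k u \<longleftrightarrow> pi_solution r' q1' q2' e' x Z \<xi> b z1 z2 k u" for Z \<xi> b z1 z2 k u
    unfolding pi_solution_def using X by (simp cong: ball_cong)
  have 3: "pi_unique_at r g q1 q2 e x \<longleftrightarrow> pi_unique_at r' g q1' q2' e' x"
    unfolding pi_unique_at_def using X by (simp cong: ball_cong)
  show ?thesis using s unfolding pi_at_def 1 2 3 .
qed

lemma pi_data_cong:
  assumes ag: "\<And>y. prec y x \<Longrightarrow> pi_agree r q1 q2 e r' q1' q2' e' y" and tr: "Tgt r = Tgt r'"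
    and s: "pi_data r g f q1 q2 e x M c g1 g2 h1 h2 a kX k1 k2 k th y1 y2 s' o1 o2 u"
  shows "pi_data r' g f q1' q2' e' x M c g1 g2 h1 h2 a kX k1 k2 k th y1 y2 s' o1 o2 u"
proof -
  have a: "agree (Src r) (Src r') y" "At r y = At r' y" "q1 y = q1' y" "q2 y = q2' y" "e y = e' y"
    if "prec y x" for y using ag[OF that] unfolding pi_agree_def by blast+
  have agrr: "agree A A y" for A y by (simp add: agree_def)
  have "lim_at r x = lim_at r' x" by (rule lim_at_cong) (use a agrr tr in simp_all)
  then have "gap_square r x M c N d m kB g1 g2 = gap_square r' x M c N d m kB g1 g2" for N d m kB
    unfolding gap_square_def tr by simp
  then show ?thesis
    using s a(3-5)[OF out_prec] unfolding pi_data_def by (simp cong: ball_cong)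
qed

lemma pi_exists_stagewise:
  assumes f: "f \<in> RS" and g: "g \<in> RS" and fg: "Tgt f = Src g"
  obtains r q1 q2 e where "r \<in> RS" "Tgt r = Tgt g" "\<And>x. x \<in> Obj I \<Longrightarrow> pi_stage r g f q1 q2 e x"
    "\<And>x. x \<in> Obj I \<Longrightarrow> pi_at r g f q1 q2 e x"
proof -
  \<comment> \<open>The raw data are the value of the dependent product, its outgoing arrows, the
    component of \<open>r\<close>, the two projections of its pullback along \<open>g\<close>, and
    the counit.\<close>
  define P :: "('i \<Rightarrow> 'o \<times> ('j \<Rightarrow> 'a) \<times> 'a \<times> 'a \<times> 'a \<times> 'a) \<Rightarrow> ('i, 'j, 'o, 'a) diagram" where
    "P w = mk_dia (\<lambda>x. fst (w x)) (\<lambda>x. fst (snd (w x)))" for w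
  define r where "r w = mk_tr (P w) (Tgt g) (\<lambda>x. fst (snd (snd (w x))))" for w
  define q1 :: "('i \<Rightarrow> 'o \<times> ('j \<Rightarrow> 'a) \<times> 'a \<times> 'a \<times> 'a \<times> 'a) \<Rightarrow> 'i \<Rightarrow> 'a" where "q1 w x = fst (snd (snd (snd (w x))))"
      for w x
  define q2 :: "('i \<Rightarrow> 'o \<times> ('j \<Rightarrow> 'a) \<times> 'a \<times> 'a \<times> 'a \<times> 'a) \<Rightarrow> 'i \<Rightarrow> 'a" where
      "q2 w x = fst (snd (snd (snd (snd (w x)))))" for w x
  define e :: "('i \<Rightarrow> 'o \<times> ('j \<Rightarrow> 'a) \<times> 'a \<times> 'a \<times> 'a \<times> 'a) \<Rightarrow> 'i \<Rightarrow> 'a" where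
      "e w x = snd (snd (snd (snd (snd (w x)))))" for w x
  have ST: "Src (r w) = P w" "Tgt (r w) = Tgt g" for w by (simp_all add: r_def)
  define Q where "Q w x \<longleftrightarrow> pi_stage (r w) g f (q1 w) (q2 w) (e w) x \<and> pi_at (r w) g f (q1 w) (q2 w) (e w) x" for w x
  have agr: "pi_agree (r w) (q1 w) (q2 w) (e w) (r w') (q1 w') (q2 w') (e w') y" if "w y = w' y" "y \<in> Obj I" for w
      w' y
    using that by (simp add: pi_agree_def ST P_def r_def q1_def q2_def e_def mk_dia_agree)
  have Qcong: "Q w' x" if x: "x \<in> Obj I" and ww: "\<And>y. y = x \<or> prec y x \<Longrightarrow> w y = w' y" and Q: "Q w x" for w w' x
  proof -
    have a: "pi_agree (r w) (q1 w) (q2 w) (e w) (r w') (q1 w') (q2 w') (e w') y" if "prec y x \<or> y = x" for y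
      using agr[of w y w'] ww[of y] that x prec_obj by blast
    show ?thesis using Q pi_stage_cong[OF a x] pi_at_cong[OF a] unfolding Q_def by blast
  qed
  have "\<exists>w. \<forall>x \<in> Obj I. Q w x"
  proof (rule prec_recursion)
    fix w :: "'i \<Rightarrow> 'o \<times> ('j \<Rightarrow> 'a) \<times> 'a \<times> 'a \<times> 'a \<times> 'a" and x
    assume x: "x \<in> Obj I" and IH: "\<And>y. prec y x \<Longrightarrow> Q w y"
    have o: "y \<in> Obj I" if "prec y x" for y using that prec_obj by blast
    have st: "\<And>y. prec y x \<Longrightarrow> pi_stage (r w) g f (q1 w) (q2 w) (e w) y" using IH unfolding Q_def by blast
    obtain M c g1 g2 h1 h2 a kX k1 k2 k th y1 y2 r' o1 o2 e' where
      D: "pi_data (r w) g f (q1 w) (q2 w) (e w) x M c g1 g2 h1 h2 a kX k1 k2 k th y1 y2 r' o1 o2 e'"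
      by (rule pi_construct[OF x f g fg ST(2) st])
    define z where "z = (Dom C r', (\<lambda>\<phi>. if \<phi> = Ident I x then Ident C (Dom C r') else c \<phi> \<cdot> (g1 \<cdot> r')),
      g2 \<cdot> r', o1, h2 \<cdot> o2, y1 \<cdot> e')"
    let ?w = "w(x := z)"
    have ew: "w y = ?w y" if "prec y x" for y using that by auto
    have Q': "Q ?w y" if y: "prec y x" for y
      by (rule Qcong[OF o[OF y] _ IH[OF y]]) (use y ew prec_trans in blast)
    have st': "\<And>y. prec y x \<Longrightarrow> pi_stage (r ?w) g f (q1 ?w) (q2 ?w) (e ?w) y" using Q' unfolding Q_def by blast
    have D': "pi_data (r ?w) g f (q1 ?w) (q2 ?w) (e ?w) x M c g1 g2 h1 h2 a kX k1 k2 k th y1 y2 r' o1 o2 e'"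
      by (rule pi_data_cong[OF agr[of w _ ?w, OF ew o] _ D]) (simp_all add: ST)
    have V: "OMap (Src (r ?w)) x = Dom C r'" "AMap (Src (r ?w)) (Ident I x) = Ident C (Dom C r')"
      "\<And>\<phi>. \<phi> \<in> out x \<Longrightarrow> AMap (Src (r ?w)) \<phi> = c \<phi> \<cdot> (g1 \<cdot> r')"
      "At (r ?w) x = g2 \<cdot> r'" "q1 ?w x = o1" "q2 ?w x = h2 \<cdot> o2" "e ?w x = y1 \<cdot> e'"
      using x unfolding ST by (simp_all add: P_def r_def q1_def q2_def e_def z_def Obj_strict_coslice)
    have "Q ?w x" unfolding Q_def using pi_finish[OF x f g fg ST(2) st' D' V] by blast
    then show "\<exists>z. Q (w(x := z)) x" by blast
  qed (rule Qcong)
  then obtain w where w: "\<And>x. x \<in> Obj I \<Longrightarrow> Q w x" by blast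
  then have ob: "\<And>x. x \<in> Obj I \<Longrightarrow> obj_at (P w) x" "\<And>x. x \<in> Obj I \<Longrightarrow> rs_at (r w) x"
    unfolding Q_def pi_stage_def ST by blast+
  have "P w \<in> Obj R" unfolding R_obj using ob(1) by (simp add: P_def mk_dia_functor obj_fun)
  moreover have "Tgt g \<in> Obj R" using g unfolding RS_iff R_arr by blast
  ultimately have "r w \<in> Arr R" unfolding r_def using rs_nat[OF ob(2)] by (intro mk_tr_arr) (simp_all add: r_def)
  then have "r w \<in> RS" unfolding RS_iff using ob by blast
  then show thesis using that w ST unfolding Q_def by blast
qed

text \<open>The stagewise data assemble to transformations. A transposed map is constructed by
  recursion from the relative existence property, and its uniqueness is an induction from the
  relative uniqueness property.\<close>

lemma RS_pi:
  assumes f: "f \<in> RS" and g: "g \<in> RS" and fg: "Tgt f = Src g"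
  shows "\<exists>r q1 q2 e. is_pi R g f r q1 q2 e \<and> r \<in> RS"
proof -
  obtain r q1 q2 e where rS: "r \<in> RS" and rg: "Tgt r = Tgt g"
    and stage: "\<And>x. x \<in> Obj I \<Longrightarrow> pi_stage r g f q1 q2 e x" and pi: "\<And>x. x \<in> Obj I \<Longrightarrow> pi_at r g f q1 q2 e x"
    using pi_exists_stagewise[OF f g fg] by metis
  have gr: "g \<in> Arr R" and fr: "f \<in> Arr R" and rr: "r \<in> Arr R" using f g rS RS_iff by auto
  have rs: "\<And>x. x \<in> Obj I \<Longrightarrow> rs_at r x" using rS RS_iff by blast
  have pb: "\<And>x. x \<in> Obj I \<Longrightarrow> is_pullback C (At r x) (At g x) (q1 x) (q2 x)"
    and nE: "\<And>x. x \<in> Obj I \<Longrightarrow> nat_at (mk_tr (pb_dia r g q1 q2) (Src f) e) x" and fe: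
        "\<And>x. x \<in> Obj I \<Longrightarrow> At f x \<cdot> e x = q2 x"
    using stage unfolding pi_stage_def by blast+
  let ?Q = "pb_dia r g q1 q2"
  define t1 where "t1 = mk_tr ?Q (Src r) q1"
  define t2 where "t2 = mk_tr ?Q (Src g) q2"
  define ep where "ep = mk_tr ?Q (Src f) e"
  have ST: "Src t1 = ?Q" "Tgt t1 = Src r" "Src t2 = ?Q" "Tgt t2 = Src g" "Src ep = ?Q" "Tgt ep = Src f"
    by (simp_all add: t1_def t2_def ep_def)
  have At: "At t1 x = q1 x" "At t2 x = q2 x" "At ep x = e x" if "x \<in> Obj I" for x
    using that by (simp_all add: t1_def t2_def ep_def)
  have o: "y \<in> Obj I" if "prec y x \<or> y = x" "x \<in> Obj I" for x y using that prec_obj by blast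
  have NQ: "fun_at ?Q x" "nat_at t1 x" "nat_at t2 x" if x: "x \<in> Obj I" for x
    by (rule pb_fun_at[where r = r and g = g and Q = ?Q and ?q1.0 = q1 and ?q2.0 = q2, OF x];
      (simp add: o[OF _ x] R_arrD(1,4,5)[OF rr] R_arrD(1,4,5)[OF gr] rg pb ST At)?)+
  have "obj_at (Src t2) x \<and> rs_at t2 x" if x: "x \<in> Obj I" for x
    by (rule rs_pullback[where q = r and u = g and v = t1])
      (use x rs R_arrD(1-5)[OF rr] R_arrD(1-5)[OF gr] rg NQ pb ST At in simp_all)
  then have Q: "?Q \<in> Obj R" unfolding R_obj using NQ(1) ST mk_dia_functor by simp
  have t1: "t1 \<in> Arr R" unfolding t1_def by (rule mk_tr_arr)
      (use Q NQ rr[unfolded R_arr] in \<open>simp_all add: t1_def[symmetric]\<close>)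
  have t2: "t2 \<in> Arr R" unfolding t2_def by (rule mk_tr_arr)
      (use Q NQ gr[unfolded R_arr] in \<open>simp_all add: t2_def[symmetric]\<close>)
  have ep: "ep \<in> Arr R" unfolding ep_def by (rule mk_tr_arr) (use Q nE fr[unfolded R_arr] in simp_all)
  have pbR: "is_pullback R r g t1 t2" by (rule R_pullbackI) (use rr gr t1 t2 ST rg pb At in simp_all)
  \<comment> \<open>Since \<open>g\<close> is a Reedy small fibration, an arbitrary pullback along
    it in \<open>R\<close> is levelwise, so the conditions in \<open>C\<close> can be applied to
    it.\<close>
  have lw: "is_pullback C (At h x) (At g x) (At s1 x) (At s2 x)" if "is_pullback R h g s1 s2" "x \<in> Obj I" for h s1
      s2 x
    using pullback_swap[OF R_pullbackD(2)[OF g R.pullback_swap[OF that(1)] that(2)]] .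
  have "is_pi R g f r t1 t2 ep"
  proof (rule R.is_piI)
    show "f \<cdot>\<^bsub>R\<^esub> ep = t2" by (rule transf_eqI) (use R_comp_arr[OF ep fr] t2 ST At fe fg in simp_all)
    show "is_pullback R r g t1 t2" "g \<in> Arr R" "f \<in> Arr R" "ep \<in> Arr R" by fact+
    show "Cod R f = Dom R g" "Dom R ep = Dom R t1" "Cod R ep = Dom R f" using fg ST by simp_all
  next
    fix h s1 s2 k
    assume hp: "is_pullback R h g s1 s2" and k: "k \<in> Arr R" "Dom R k = Dom R s1" "Cod R k = Dom R f" and fk:
        "f \<cdot>\<^bsub>R\<^esub> k = s2"
    note HP = R.pullbackD[OF hp]
    have hr: "h \<in> Arr R" "s1 \<in> Arr R" "s2 \<in> Arr R" "Tgt h = Tgt g" "Src s2 = Src s1" "Tgt s1 = Src h" "Tgt s2 = Src g"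
      "Src k = Src s1" "Tgt k = Src f" using HP k by simp_all
    have fkx: "At f x \<cdot> At k x = At s2 x" if "x \<in> Obj I" for x using that unfolding fk[symmetric] by simp
    define H where "H u = mk_tr (Src h) (Src r) u" for u
    have SH: "Src (H u) = Src h" "Tgt (H u) = Src r" for u by (simp_all add: H_def)
    have AH: "At (H u) x = u x" if "x \<in> Obj I" for u x using that by (simp add: H_def)
    \<comment> \<open>Besides naturality and lying over \<open>h\<close>, the invariant records that
      the transpose at \<open>x\<close> is \<open>k\<close>; this is what makes the next relative
      cone compatible.\<close>
    define Q where "Q u x \<longleftrightarrow> nat_at (H u) x \<and> At r x \<cdot> u x = At h x \<and>
       (\<forall>w \<in> hom C (Dom C (At s1 x)) (Dom C (q1 x)). q1 x \<cdot> w = u x \<cdot> At s1 x \<and> q2 x \<cdot> w = At s2 x \<longrightarrow> e x \<cdot> w = At k x)" for u x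
    have agr: "agree A A y" for A y by (simp add: agree_def)
    have Qcong: "Q u' x" if "x \<in> Obj I" "\<And>y. y = x \<or> prec y x \<Longrightarrow> u y = u' y" "Q u x" for u u' x
    proof -
      have e: "At (H u) y = At (H u') y" if "prec y x \<or> y = x" for y
        using AH[of y] that(1) \<open>\<And>y. y = x \<or> prec y x \<Longrightarrow> u y = u' y\<close>[of y] \<open>x \<in> Obj I\<close> prec_obj(1)[of y x] by auto
      show ?thesis using that(3) that(2)[of x] nat_at_cong[of x "H u" "H u'", unfolded SH, OF agr agr e that(1)]
        unfolding Q_def by simp
    qed
    have "\<exists>u. \<forall>x \<in> Obj I. Q u x"
    proof (rule prec_recursion)
      fix u :: "'i \<Rightarrow> 'a" and x
      assume x: "x \<in> Obj I" and IH: "\<And>y. prec y x \<Longrightarrow> Q u y"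
      have oo: "y \<in> Obj I" if "prec y x" for y using that prec_obj by blast
      note X = R_arrD(9-11)[OF hr(1) x] R_arrD(9-11)[OF hr(2) x] R_arrD(9-11)[OF hr(3) x] R_arrD(9-11)[OF k(1) x]
          hr(4-9)
      have U: "u (Cod I \<phi>) \<in> Arr C" "Dom C (u (Cod I \<phi>)) = OMap (Src h) (Cod I \<phi>)"
          "Cod C (u (Cod I \<phi>)) = OMap (Src r) (Cod I \<phi>)"
        "At r (Cod I \<phi>) \<cdot> u (Cod I \<phi>) = At h (Cod I \<phi>)"
        "\<And>h'. \<lbrakk>h' \<in> Arr I; Dom I h' = Cod I \<phi>\<rbrakk> \<Longrightarrow> u (Cod I h') \<cdot> AMap (Src h) h' = AMap (Src r) h' \<cdot> u (Cod I \<phi>)"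
        if p: "\<phi> \<in> out x" for \<phi>
      proof -
        have q: "nat_at (H u) (Cod I \<phi>)" "At r (Cod I \<phi>) \<cdot> u (Cod I \<phi>) = At h (Cod I \<phi>)"
          using IH[OF out_prec[OF p]] unfolding Q_def by blast+
        have c: "Cod I \<phi> \<in> Obj I" using oo[OF out_prec[OF p]] .
        show "u (Cod I \<phi>) \<in> Arr C" "Dom C (u (Cod I \<phi>)) = OMap (Src h) (Cod I \<phi>)"
            "Cod C (u (Cod I \<phi>)) = OMap (Src r) (Cod I \<phi>)"
          "At r (Cod I \<phi>) \<cdot> u (Cod I \<phi>) = At h (Cod I \<phi>)" using nat_atD(1-3)[OF q(1)] q(2) c AH SH by simp_all
        fix h' assume h': "h' \<in> Arr I" "Dom I h' = Cod I \<phi>"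
        show "u (Cod I h') \<cdot> AMap (Src h) h' = AMap (Src r) h' \<cdot> u (Cod I \<phi>)"
          using nat_atD(4)[OF q(1) h'] h'(1) c AH SH by simp
      qed
      \<comment> \<open>If \<open>u\<close> is to be natural at \<open>x\<close>, its components in
        the matching object must be the values chosen below \<open>x\<close>, precomposed with the
        arrows of \<open>Src h\<close>.\<close>
      have cone:
          "pi_cone r g f q1 q2 e x (OMap (Src h) x) (\<lambda>\<phi>. u (Cod I \<phi>) \<cdot> AMap (Src h) \<phi>) (At h x) (At s1 x) (At s2 x) (At k x)"
        unfolding pi_cone_def
      proof (intro conjI ballI impI)
        show "At h x \<in> hom C (OMap (Src h) x) (OMap (Tgt r) x)" using X rg by (simp add: in_hom)
        show "is_pullback C (At h x) (At g x) (At s1 x) (At s2 x)" by (rule lw[OF hp x])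
        show "At k x \<in> hom C (Dom C (At s1 x)) (OMap (Src f) x)" using X by (simp add: in_hom)
        show "At f x \<cdot> At k x = At s2 x" by (rule fkx[OF x])
        fix \<phi> assume p: "\<phi> \<in> out x"
        note Ah = fun_atD(3-5)[OF R_arrD(4)[OF hr(1) x] outD[OF p]] and UU = U[OF p]
        have c: "Cod I \<phi> \<in> Obj I" using oo[OF out_prec[OF p]] .
        note Rc = R_arrD(9-11)[OF rr c]
        show "u (Cod I \<phi>) \<cdot> AMap (Src h) \<phi> \<in> hom C (OMap (Src h) x) (OMap (Src r) (Cod I \<phi>))"
          using Ah UU(1-3) by (simp add: in_hom)
        show "At r (Cod I \<phi>) \<cdot> (u (Cod I \<phi>) \<cdot> AMap (Src h) \<phi>) = AMap (Tgt r) \<phi> \<cdot> At h x"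
          using Ah UU(1-3) Rc nat_atD(4)[OF R_arrD(1)[OF hr(1) x] outD[OF p]] rg hr(4) by
              (simp add: UU(4)[THEN reassoc])
        {
          fix h' assume h': "h' \<in> Arr I" "Dom I h' = Cod I \<phi>"
          note p' = out_comp[OF p h']
          have cod: "Cod I (h' \<cdot>\<^bsub>I\<^esub> \<phi>) = Cod I h'" using h' outD[OF p] by simp
          note U' = U[OF p', unfolded cod]
          show "AMap (Src r) h' \<cdot> (u (Cod I \<phi>) \<cdot> AMap (Src h) \<phi>) = u (Cod I (h' \<cdot>\<^bsub>I\<^esub> \<phi>)) \<cdot> AMap (Src h) (h' \<cdot>\<^bsub>I\<^esub> \<phi>)"
            unfolding cod fun_atD(6)[OF R_arrD(4)[OF hr(1) x] outD(1)[OF p] h'(1) outD(2)[OF p] h'(2)[symmetric]]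
            using Ah UU(1-3) U'(1-3) fun_atD(3-5)[OF R_arrD(4)[OF hr(1) c] h'] fun_atD(3-5)[OF R_arrD(4)[OF rr c] h']
            by (simp add: UU(5)[OF h', THEN reassoc])
        }
        fix w assume "w \<in> hom C (Dom C (At s1 x)) (Dom C (q1 (Cod I \<phi>)))"
          and "q1 (Cod I \<phi>) \<cdot> w = u (Cod I \<phi>) \<cdot> AMap (Src h) \<phi> \<cdot> At s1 x \<and> q2 (Cod I \<phi>) \<cdot> w = AMap (Src g) \<phi> \<cdot> At s2 x"
        then have w: "w \<in> Arr C" "Dom C w = OMap (Src s1) x" "Cod C w = Dom C (q1 (Cod I \<phi>))"
          "q1 (Cod I \<phi>) \<cdot> w = u (Cod I \<phi>) \<cdot> (AMap (Src h) \<phi> \<cdot> At s1 x)" "q2 (Cod I \<phi>) \<cdot> w = AMap (Src g) \<phi> \<cdot> At s2 x"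
          using X Ah UU(1-3) by (simp_all add: in_hom)
        note Pc = pullbackD[OF lw[OF hp c]]
        note Xc = R_arrD(9-11)[OF hr(1) c] R_arrD(9-11)[OF hr(2) c] R_arrD(9-11)[OF hr(3) c] R_arrD(9-11)[OF k(1) c]
            R_arrD(9-11)[OF gr c]
        note As = fun_atD(3-5)[OF R_arrD(4)[OF hr(2) x] outD[OF p]] fun_atD(3-5)[OF R_arrD(4)[OF fr x] outD[OF p]]
          fun_atD(3-5)[OF R_arrD(4)[OF gr x] outD[OF p]]
        note ns1 = nat_atD(4)[OF R_arrD(1)[OF hr(2) x] outD[OF p]] and ns2 =
            nat_atD(4)[OF R_arrD(1)[OF hr(3) x] outD[OF p]]
          and nk = nat_atD(4)[OF R_arrD(1)[OF k(1) x] outD[OF p]]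
        have e1: "At r (Cod I \<phi>) \<cdot> (u (Cod I \<phi>) \<cdot> At s1 (Cod I \<phi>)) = At g (Cod I \<phi>) \<cdot> At s2 (Cod I \<phi>)"
          using UU(1-3) Xc Rc hr Pc(9) by (simp add: UU(4)[THEN reassoc])
        obtain v where v: "v \<in> Arr C" "Dom C v = OMap (Src s1) (Cod I \<phi>)" "Cod C v = Dom C (q1 (Cod I \<phi>))"
          "q1 (Cod I \<phi>) \<cdot> v = u (Cod I \<phi>) \<cdot> At s1 (Cod I \<phi>)" "q2 (Cod I \<phi>) \<cdot> v = At s2 (Cod I \<phi>)"
          by (rule pullback_ex[OF pb[OF c] _ _ _ _ _ _ e1, where Z = "OMap (Src s1) (Cod I \<phi>)"])
            (use UU(1-3) Xc Rc hr in simp_all)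
        have ev: "e (Cod I \<phi>) \<cdot> v = At k (Cod I \<phi>)"
          using IH[OF out_prec[OF p]] v Xc unfolding Q_def by (simp add: in_hom)
        note Pq = pullbackD[OF pb[OF c]]
        \<comment> \<open>Uniqueness in the pullback below \<open>x\<close> reduces an arbitrary
          \<open>w\<close> to the transpose \<open>v\<close> there, for which the invariant gives
          \<open>k\<close>; naturality of \<open>k\<close> finishes the compatibility
          clause.\<close>
        have "w = v \<cdot> AMap (Src s1) \<phi>"
        proof (rule pullback_eq[OF pb[OF c]])
          show "q1 (Cod I \<phi>) \<cdot> w = q1 (Cod I \<phi>) \<cdot> (v \<cdot> AMap (Src s1) \<phi>)"
            using w v(1-3) As UU(1-3) Xc Pq(3) ns1 hr by (simp add: v(4)[THEN reassoc])
          show "q2 (Cod I \<phi>) \<cdot> w = q2 (Cod I \<phi>) \<cdot> (v \<cdot> AMap (Src s1) \<phi>)"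
            using w v(1-3) As UU(1-3) Xc Pq(4,6) ns2[unfolded hr(5,7)] by (simp add: v(5)[THEN reassoc])
        qed (use w v As in simp_all)
        moreover have "e (Cod I \<phi>) \<in> Arr C" "Dom C (e (Cod I \<phi>)) = Dom C (q1 (Cod I \<phi>))"
          using nat_atD(1-3)[OF nE[OF c]] c by simp_all
        ultimately show "AMap (Src f) \<phi> \<cdot> At k x = e (Cod I \<phi>) \<cdot> w"
          using v(1-3) As nk hr by (simp add: ev[THEN reassoc])
      qed
      obtain v where v:
          "pi_solution r q1 q2 e x (OMap (Src h) x) (\<lambda>\<phi>. u (Cod I \<phi>) \<cdot> AMap (Src h) \<phi>) (At h x) (At s1 x) (At s2 x) (At k x) v"
        using pi[OF x] cone unfolding pi_at_def by blast
      let ?u = "u(x := v)"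
      have eu: "u y = ?u y" if "prec y x" for y using that by auto
      have vd: "v \<in> Arr C" "Dom C v = OMap (Src h) x" "Cod C v = OMap (Src r) x" "At r x \<cdot> v = At h x"
        using v unfolding pi_solution_def in_hom by blast+
      have "?u (Cod I \<phi>) \<cdot> AMap (Src h) \<phi> = AMap (Src r) \<phi> \<cdot> v" if p: "\<phi> \<in> Arr I" "Dom I \<phi> = x" for \<phi>
      proof (cases "\<phi> = Ident I x")
        case True
        then show ?thesis
          using fun_atD(2)[OF R_arrD(4)[OF hr(1) x]] fun_atD(2)[OF R_arrD(4)[OF rr x]] vd x by simp
      next
        case False
        then have p': "\<phi> \<in> out x" using p by (simp add: Obj_strict_coslice)
        have "AMap (Src r) \<phi> \<cdot> v = u (Cod I \<phi>) \<cdot> AMap (Src h) \<phi>" using v p' unfolding pi_solution_def by blast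
        then show ?thesis using eu[OF out_prec[OF p']] by simp
      qed
      then have "nat_at (H ?u) x"
        using x vd by (simp add: nat_at_def in_hom SH AH del: fun_upd_apply) simp
      moreover have
          "\<forall>w \<in> hom C (Dom C (At s1 x)) (Dom C (q1 x)). q1 x \<cdot> w = v \<cdot> At s1 x \<and> q2 x \<cdot> w = At s2 x \<longrightarrow> e x \<cdot> w = At k x"
        using v unfolding pi_solution_def by blast
      ultimately have "Q ?u x" unfolding Q_def using vd by simp
      then show "\<exists>z. Q (u(x := z)) x" by blast
    qed (rule Qcong)
    then obtain u where u: "\<And>x. x \<in> Obj I \<Longrightarrow> Q u x" by blast
    have HR: "H u \<in> Arr R"
      using u rr[unfolded R_arr] hr(1)[unfolded R_arr] unfolding H_def Q_def by (simp add: mk_tr_arr)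
    have ru: "r \<cdot>\<^bsub>R\<^esub> H u = h"
      by (rule transf_eqI) (use R_comp_arr[OF HR rr] hr SH AH rg u in \<open>simp_all add: Q_def\<close>)
    have us: "H u \<cdot>\<^bsub>R\<^esub> s1 \<in> Arr R" by (rule R_comp_arr[OF hr(2) HR]) (simp add: SH hr)
    have e1: "r \<cdot>\<^bsub>R\<^esub> (H u \<cdot>\<^bsub>R\<^esub> s1) = g \<cdot>\<^bsub>R\<^esub> s2"
      using R.Comp_assoc[of s1 "Src s1" "Src h" "H u" "Src r" r "Tgt r"] hr HR rr SH ru HP(9) by
          (simp add: R.in_hom del: R_simps(4))
    obtain v where v: "v \<in> Arr R" "Dom R v = Src s1" "Cod R v = Dom R t1" "t1 \<cdot>\<^bsub>R\<^esub> v = H u \<cdot>\<^bsub>R\<^esub> s1" "t2 \<cdot>\<^bsub>R\<^esub> v = s2"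
      by (rule R.pullback_ex[OF pbR us hr(3) _ _ _ _ e1, where Z = "Src s1"]) (use hr SH in simp_all)
    have "ep \<cdot>\<^bsub>R\<^esub> v = k"
    proof (rule transf_eqI)
      show "ep \<cdot>\<^bsub>R\<^esub> v \<in> Arr R" by (rule R_comp_arr[OF v(1) ep]) (use v ST in simp)
      show "k \<in> Arr R" by fact
      show "Src (ep \<cdot>\<^bsub>R\<^esub> v) = Src k" "Tgt (ep \<cdot>\<^bsub>R\<^esub> v) = Tgt k" using v ST hr by simp_all
      fix x assume x: "x \<in> Obj I"
      have "At (t1 \<cdot>\<^bsub>R\<^esub> v) x = At (H u \<cdot>\<^bsub>R\<^esub> s1) x" "At (t2 \<cdot>\<^bsub>R\<^esub> v) x = At s2 x" unfolding v by simp_all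
      then have "q1 x \<cdot> At v x = u x \<cdot> At s1 x" "q2 x \<cdot> At v x = At s2 x" using x At AH by simp_all
      moreover have "At v x \<in> hom C (Dom C (At s1 x)) (Dom C (q1 x))"
        using R_arrD(9-11)[OF v(1) x] R_arrD(9-11)[OF hr(2) x] v ST x by (simp add: in_hom)
      ultimately show "At (ep \<cdot>\<^bsub>R\<^esub> v) x = At k x" using u[OF x] x At unfolding Q_def by simp
    qed
    then show "\<exists>u v. u \<in> Arr R \<and> Dom R u = Dom R h \<and> Cod R u = Dom R r \<and> r \<cdot>\<^bsub>R\<^esub> u = h \<and>
        v \<in> Arr R \<and> Dom R v = Dom R s1 \<and> Cod R v = Dom R t1 \<and> t1 \<cdot>\<^bsub>R\<^esub> v = u \<cdot>\<^bsub>R\<^esub> s1 \<and> t2 \<cdot>\<^bsub>R\<^esub> v = s2 \<and> ep \<cdot>\<^bsub>R\<^esub> v = k"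
      by (intro exI[of _ "H u"] exI[of _ v] conjI) (use HR ru v SH in \<open>simp_all del: R_simps(4)\<close>)
  next
    fix h s1 s2 u u' v v'
    assume hp: "is_pullback R h g s1 s2"
      and "u \<in> Arr R" "Dom R u = Dom R h" "Cod R u = Dom R r" "r \<cdot>\<^bsub>R\<^esub> u = h"
       "v \<in> Arr R" "Dom R v = Dom R s1" "Cod R v = Dom R t1" "t1 \<cdot>\<^bsub>R\<^esub> v = u \<cdot>\<^bsub>R\<^esub> s1" "t2 \<cdot>\<^bsub>R\<^esub> v = s2"
       "u' \<in> Arr R" "Dom R u' = Dom R h" "Cod R u' = Dom R r" "r \<cdot>\<^bsub>R\<^esub> u' = h"
       "v' \<in> Arr R" "Dom R v' = Dom R s1" "Cod R v' = Dom R t1" "t1 \<cdot>\<^bsub>R\<^esub> v' = u' \<cdot>\<^bsub>R\<^esub> s1" "t2 \<cdot>\<^bsub>R\<^esub> v' = s2"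
       "ep \<cdot>\<^bsub>R\<^esub> v = ep \<cdot>\<^bsub>R\<^esub> v'"
    then have u: "u \<in> Arr R" "Src u = Src h" "Tgt u = Src r" "u' \<in> Arr R" "Src u' = Src h" "Tgt u' = Src r"
      and v: "v \<in> Arr R" "Src v = Src s1" "Tgt v = ?Q" "v' \<in> Arr R" "Src v' = Src s1" "Tgt v' = ?Q"
      and E: "r \<cdot>\<^bsub>R\<^esub> u = h" "r \<cdot>\<^bsub>R\<^esub> u' = h" "t1 \<cdot>\<^bsub>R\<^esub> v = u \<cdot>\<^bsub>R\<^esub> s1" "t1 \<cdot>\<^bsub>R\<^esub> v' = u' \<cdot>\<^bsub>R\<^esub> s1"
        "t2 \<cdot>\<^bsub>R\<^esub> v = s2" "t2 \<cdot>\<^bsub>R\<^esub> v' = s2" "ep \<cdot>\<^bsub>R\<^esub> v = ep \<cdot>\<^bsub>R\<^esub> v'"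
      using ST by (simp_all del: R_simps(4))
    have hr: "h \<in> Arr R" "s1 \<in> Arr R" "Src s1 = Src s1" using R.pullbackD[OF hp] by simp_all
    have "At u x = At u' x" if "x \<in> Obj I" for x
      using that
    proof (induction x rule: prec_induct)
      case (less x)
      note x = less(1)
      have "At (r \<cdot>\<^bsub>R\<^esub> u) x = At h x" "At (r \<cdot>\<^bsub>R\<^esub> u') x = At h x" "At (t1 \<cdot>\<^bsub>R\<^esub> v) x = At (u \<cdot>\<^bsub>R\<^esub> s1) x"
        "At (t1 \<cdot>\<^bsub>R\<^esub> v') x = At (u' \<cdot>\<^bsub>R\<^esub> s1) x" "At (t2 \<cdot>\<^bsub>R\<^esub> v) x = At s2 x" "At (t2 \<cdot>\<^bsub>R\<^esub> v') x = At s2 x"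
        "At (ep \<cdot>\<^bsub>R\<^esub> v) x = At (ep \<cdot>\<^bsub>R\<^esub> v') x" unfolding E by (rule refl)+
      then have Ex: "At r x \<cdot> At u x = At h x" "At r x \<cdot> At u' x = At h x" "q1 x \<cdot> At v x = At u x \<cdot> At s1 x"
        "q1 x \<cdot> At v' x = At u' x \<cdot> At s1 x" "q2 x \<cdot> At v x = At s2 x" "q2 x \<cdot> At v' x = At s2 x"
            "e x \<cdot> At v x = e x \<cdot> At v' x"
        using x At by simp_all
      \<comment> \<open>Naturality moves both composites to the components below \<open>x\<close>,
        which agree by induction; this is the hypothesis of relative uniqueness.\<close>
      have al: "AMap (Src r) \<phi> \<cdot> At u x = AMap (Src r) \<phi> \<cdot> At u' x" if p: "\<phi> \<in> out x" for \<phi>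
        using nat_atD(4)[OF R_arrD(1)[OF u(1) x] outD[OF p]] nat_atD(4)[OF R_arrD(1)[OF u(4) x] outD[OF p]]
            less(2)[OF out_prec[OF p]] u
        by simp
      have mem: "At u x \<in> hom C (OMap (Src h) x) (OMap (Src r) x)" "At u' x \<in> hom C (OMap (Src h) x) (OMap (Src r) x)"
        "At v x \<in> hom C (Dom C (At s1 x)) (Dom C (q1 x))" "At v' x \<in> hom C (Dom C (At s1 x)) (Dom C (q1 x))"
        using R_arrD(9-11)[OF u(1) x] R_arrD(9-11)[OF u(4) x] R_arrD(9-11)[OF v(1) x] R_arrD(9-11)[OF v(4) x]
            R_arrD(9-11)[OF hr(2) x] u v x
        by (simp_all add: in_hom)
      have pz: "is_pullback C (At r x \<cdot> At u x) (At g x) (At s1 x) (At s2 x)" unfolding Ex(1) by (rule lw[OF hp x])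
      have "pi_unique_at r g q1 q2 e x" using pi[OF x] unfolding pi_at_def by blast
      then show ?case
        unfolding pi_unique_at_def
        using mem al pz Ex by metis
    qed
    then show "u = u'" by (intro transf_eqI) (use u in simp_all)
  qed
  then show ?thesis using rS by blast
qed

section \<open>The universe axioms for the induced fibration\<close>

lemma induced_fibration_universe:
  assumes "induced_fibration I C p q"
  shows "universe R (reedy_fibrations I C F) q"
  unfolding universe_def small_fibrations_eq_RS[OF assms]
proof (intro conjI ballI impI)
  show "q \<in> reedy_fibrations I C F" using RS_reedy_fibration[OF induced_fibration_RS[OF assms]] .
  show "Ident R A \<in> RS" if "A \<in> Obj R" for A by (rule RS_ident[OF that])
  show "g \<cdot>\<^bsub>R\<^esub> f \<in> RS" if "f \<in> RS" "g \<in> RS" "Cod R f = Dom R g" for f g using RS_comp that R_simps(1,2) by metis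
  show "\<exists>r q1 q2 e. is_pi R g f r q1 q2 e \<and> r \<in> RS" if "f \<in> RS" "g \<in> RS" "Cod R f = Dom R g" for f g
    using RS_pi that R_simps(1,2) by metis
  show "\<exists>i s. acyclic_cofibration R (reedy_fibrations I C F) i \<and> s \<in> RS \<and> Cod R i = Dom R s \<and> s \<cdot>\<^bsub>R\<^esub> i = f"
    if "a \<in> RS" "b \<in> RS" "f \<in> hom R (Dom R a) (Dom R b)" "b \<cdot>\<^bsub>R\<^esub> f = a" for a b f
    using RS_factorization[OF that(1,2) _ that(4)] that(3) R_simps(1,2) by metis
qed

end

theorem theorem11p19:
  fixes C :: "('o, 'a) cat_data" and F :: "'a set" and p :: 'a
    and I :: "('i, 'j) cat_data"
  assumes "tt_fibration_category C F"
    and "universe C F p"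
    and "inverse_category I"
    and "admissible_for_universe I C F p"
  shows "(\<exists>q. induced_fibration I C p q) \<and>
    (\<forall>q. induced_fibration I C p q \<longrightarrow>
       universe (reedy_category I C F) (reedy_fibrations I C F) q \<and>
       small_fibrations (reedy_category I C F) q = reedy_small_fibrations I C F p)"
proof -
  interpret tt_fibration_category C F by fact
  interpret I: category I using assms(3) by (simp add: inverse_category_def)
  interpret reedy_universe C F I p by unfold_locales fact+
  show ?thesis using induced_fibration_exists induced_fibration_universe small_fibrations_eq_RS by blast
qed

end
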